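(* Let $m$ be even and $G'_\infty=R(G(m,1,\infty))$. (i) If $f_1,f_2$ are characters of $G'_\infty$ which are factorisable, then the product $f_1f_2$ is also a character. Symbolically, $F(G'_\infty)F(G'_\infty)\subset F(G'_\infty)$ and, with $\chi^{{\rm Y}_3}=\chi^{{\rm Y}_1}\chi^{{\rm Y}_2}$, $F(G'_\infty;\chi^{{\rm Y}_1})\cdot F(G'_\infty;\chi^{{\rm Y}_2})\subset F(G'_\infty;\chi^{{\rm Y}_3})$. In case $\chi^{{\rm Y}_1},\chi^{{\rm Y}_2}$ are both of the first kind, this means also that $$E(G'_\infty;\chi^{{\rm Y}_1})\,E(G'_\infty;\chi^{{\rm Y}_2})\subset E(G'_\infty;\chi^{{\rm Y}_3}).\qquad( * )$$ (ii) Let $\chi^{{\rm Y}_3}=\chi^{{\rm Y}_1}\chi^{{\rm Y}_2}$ and assume that one of ${\rm Y}_1,{\rm Y}_2,{\rm Y}_3$ is ${\rm V}$ or ${\rm VI}$. Then $( * )$ holds.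
   Context: $m$ is an even positive integer. $G_\infty=G(m,1,\infty)=D_\infty\rtimes\mathfrak S_\infty$, where $\mathfrak S_\infty$ is the group of finite permutations of $\{1,2,\dots\}$, $D_\infty$ is the restricted direct product of cyclic groups $T_j=\langle y_j\rangle$ of order $m$ ($j\ge1$), $\sigma y_j\sigma^{-1}=y_{\sigma(j)}$. $G'_\infty=R(G(m,1,\infty))$ is the group with generators $z_1,z_2,z_3,r_i,\widehat\eta_j$ ($i,j\ge1$) and relations: $z_k$ central, $z_k^2=e$; $r_i^2=e$, $(r_ir_{i+1})^3=e$, $r_ir_j=z_1r_jr_i$ ($|i-j|\ge2$); $\widehat\eta_j^{\,m}=e$, $\widehat\eta_j\widehat\eta_k=z_2\widehat\eta_k\widehat\eta_j$ ($j\ne k$); $r_i\widehat\eta_jr_i^{-1}=z_3\widehat\eta_{s_i(j)}$, $s_i=(i\ i{+}1)$. $Z=\langle z_1,z_2,z_3\rangle\cong\mathbf{Z}_2^3$; $\Phi:G'_\infty\to G_\infty$, $r_i\mapsto s_i$, $\widehat\eta_j\mapsto y_j$, is surjective with kernel $Z$. For $g=(d,\sigma)\in G_\infty$, $\mathrm{supp}(g)=\{j;\ d\text{ has nontrivial }j\text{-th component}\}\cup\{j;\sigma(j)\ne j\}$; $\mathrm{supp}(g')=\mathrm{supp}(\Phi(g'))$ for $g'\in G'_\infty$. $K_1(G'_\infty)$ is the convex set of positive-definite functions $f$ on $G'_\infty$, invariant under inner automorphisms, with $f(e)=1$; $E(G'_\infty)$ is the set of its extremal points, called characters. $f$ is factorisable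 if $f(h'k')=f(h')f(k')$ whenever $\mathrm{supp}(h')\cap\mathrm{supp}(k')=\emptyset$; $F(G'_\infty)$ is the set of factorisable $f\in K_1(G'_\infty)$. For $\chi\in\widehat Z$, $f$ has spin type $\chi$ if $f(zg')=\chi(z)f(g')$ ($z\in Z$); $E(G'_\infty;\chi)$ and $F(G'_\infty;\chi)$ are the subsets of elements of spin type $\chi$. Products of functions are pointwise. The elements of $\widehat Z$, written $(\chi(z_1),\chi(z_2),\chi(z_3))$, are $\chi^{\rm I}=(-1,-1,-1)$, $\chi^{\rm II}=(-1,-1,1)$, $\chi^{\rm III}=(-1,1,-1)$, $\chi^{\rm IV}=(-1,1,1)$, $\chi^{\rm V}=(1,-1,-1)$, $\chi^{\rm VI}=(1,-1,1)$, $\chi^{\rm VII}=(1,1,-1)$, $\chi^{\rm VIII}=(1,1,1)$. Those with index I, IV, V, VI, VIII are of the first kind, those with index II, III, VII of the second kind. *)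

theory Defs
  imports Complex_Main "HOL-Algebra.Algebra" "HOL-Combinatorics.Permutations" "HOL-Library.Nonpos_Ints"
begin

section \<open>Groups given by generators and relations\<close>

text \<open>A letter \<open>(a, True)\<close> is the generator \<open>a\<close>, a letter \<open>(a, False)\<close> its formal inverse.
  A pair of words related by \<open>R\<close> is a defining relation \<open>u = v\<close>.\<close>

type_synonym 'a word = "('a \<times> bool) list"

abbreviation pos :: "'a \<Rightarrow> 'a \<times> bool" where "pos a \<equiv> (a, True)"
abbreviation neg :: "'a \<Rightarrow> 'a \<times> bool" where "neg a \<equiv> (a, False)"

inductive pres_cong :: "('a word \<Rightarrow> 'a word \<Rightarrow> bool) \<Rightarrow> 'a word \<Rightarrow> 'a word \<Rightarrow> bool"
  for R where
  rel: "R u v \<Longrightarrow> pres_cong R u v"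
| cancel_right: "pres_cong R [pos a, neg a] []"
| cancel_left: "pres_cong R [neg a, pos a] []"
| refl: "pres_cong R u u"
| sym: "pres_cong R u v \<Longrightarrow> pres_cong R v u"
| trans: "pres_cong R u v \<Longrightarrow> pres_cong R v w \<Longrightarrow> pres_cong R u w"
| append: "pres_cong R u u' \<Longrightarrow> pres_cong R v v' \<Longrightarrow> pres_cong R (u @ v) (u' @ v')"

definition word_class :: "('a word \<Rightarrow> 'a word \<Rightarrow> bool) \<Rightarrow> 'a word \<Rightarrow> 'a word set" where
  "word_class R u = {v. pres_cong R u v}"

definition presented_group :: "('a word \<Rightarrow> 'a word \<Rightarrow> bool) \<Rightarrow> 'a word set monoid" where
  "presented_group R =
     \<lparr>carrier = range (word_class R),
      monoid.mult = (\<lambda>A B. \<Union>u\<in>A. \<Union>v\<in>B. word_class R (u @ v)),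
      one = word_class R []\<rparr>"

fun eval_word :: "('b, 'c) monoid_scheme \<Rightarrow> ('a \<Rightarrow> 'b) \<Rightarrow> 'a word \<Rightarrow> 'b" where
  "eval_word G h [] = \<one>\<^bsub>G\<^esub>"
| "eval_word G h ((a, b) # w) =
     (if b then h a else inv\<^bsub>G\<^esub> (h a)) \<otimes>\<^bsub>G\<^esub> eval_word G h w"

lemma word_class_eq_iff: "word_class R u = word_class R v \<longleftrightarrow> pres_cong R u v"
  unfolding word_class_def set_eq_iff mem_Collect_eq
  by (meson pres_cong.refl pres_cong.sym pres_cong.trans)

lemma mult_word_class:
  "word_class R u \<otimes>\<^bsub>presented_group R\<^esub> word_class R v = word_class R (u @ v)"
proof -
  have "word_class R (u' @ v') = word_class R (u @ v)"
    if "u' \<in> word_class R u" "v' \<in> word_class R v" for u' v'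
    using that unfolding word_class_eq_iff
    by (simp add: word_class_def pres_cong.append pres_cong.sym)
  moreover have "u \<in> word_class R u" "v \<in> word_class R v"
    by (auto simp: word_class_def intro: pres_cong.refl)
  ultimately have "(\<Union>u'\<in>word_class R u. \<Union>v'\<in>word_class R v. word_class R (u' @ v'))
      = word_class R (u @ v)"
    by blast
  then show ?thesis
    by (simp add: presented_group_def)
qed

lemma inverse_word: "\<exists>v. pres_cong R (v @ u) []"
proof (induction u)
  case Nil
  show ?case by (auto intro: exI[of _ "[]"] pres_cong.refl)
next
  case (Cons x u)
  then obtain v where v: "pres_cong R (v @ u) []" by blast
  obtain a b where x: "x = (a, b)" by (cases x)
  have c: "pres_cong R [(a, \<not> b), (a, b)] []"
    by (cases b) (auto intro: pres_cong.cancel_left pres_cong.cancel_right)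
  have "pres_cong R (v @ [(a, \<not> b), (a, b)] @ u) (v @ [] @ u)"
    by (intro pres_cong.append pres_cong.refl c)
  then have "pres_cong R ((v @ [(a, \<not> b)]) @ x # u) []"
    using v by (simp add: x) (rule pres_cong.trans)
  then show ?case by (rule exI)
qed

lemma group_presented_group: "group (presented_group R)"
proof (rule groupI)
  have car: "carrier (presented_group R) = range (word_class R)"
    and one: "\<one>\<^bsub>presented_group R\<^esub> = word_class R []"
    by (auto simp: presented_group_def)
  show "\<exists>y\<in>carrier (presented_group R). y \<otimes>\<^bsub>presented_group R\<^esub> x = \<one>\<^bsub>presented_group R\<^esub>"
    if "x \<in> carrier (presented_group R)" for x
  proof -
    obtain u where u: "x = word_class R u" using \<open>x \<in> _\<close> by (auto simp: car)
    obtain v where "pres_cong R (v @ u) []" using inverse_word by blast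
    then show ?thesis
      by (auto simp: car one u mult_word_class word_class_eq_iff)
  qed
  show "x \<otimes>\<^bsub>presented_group R\<^esub> y \<in> carrier (presented_group R)"
    if "x \<in> carrier (presented_group R)" "y \<in> carrier (presented_group R)" for x y
    using that unfolding car by (auto simp: mult_word_class)
  show "x \<otimes>\<^bsub>presented_group R\<^esub> y \<otimes>\<^bsub>presented_group R\<^esub> z =
      x \<otimes>\<^bsub>presented_group R\<^esub> (y \<otimes>\<^bsub>presented_group R\<^esub> z)"
    if "x \<in> carrier (presented_group R)" "y \<in> carrier (presented_group R)"
       "z \<in> carrier (presented_group R)" for x y z
    using that unfolding car by (auto simp: mult_word_class)
  show "\<one>\<^bsub>presented_group R\<^esub> \<otimes>\<^bsub>presented_group R\<^esub> x = x"
    if "x \<in> carrier (presented_group R)" for x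
    using that unfolding car one by (auto simp: mult_word_class)
qed (simp add: presented_group_def)

lemma (in group) eval_word_closed:
  assumes "\<And>a. h a \<in> carrier G"
  shows "eval_word G h w \<in> carrier G"
  by (induction w) (auto simp: assms)

lemma (in group) eval_word_append:
  assumes "\<And>a. h a \<in> carrier G"
  shows "eval_word G h (u @ v) = eval_word G h u \<otimes> eval_word G h v"
  by (induction u) (auto simp: assms eval_word_closed m_assoc)

lemma (in group) eval_word_cong:
  assumes "\<And>a. h a \<in> carrier G" and "\<And>u v. R u v \<Longrightarrow> eval_word G h u = eval_word G h v"
    and "pres_cong R u v"
  shows "eval_word G h u = eval_word G h v"
  using assms(3)
  by (induction rule: pres_cong.induct) (auto simp: assms(1,2) eval_word_append)



section \<open>The group \<open>G(m,1,\<infinity>)\<close> and its representation group\<close>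

text \<open>All indices are shifted by one: the index set \<open>{1,2,\<dots>}\<close> of the coordinates and of
  the generators becomes the type of natural numbers, starting at \<open>0\<close>.\<close>

abbreviation D_inf :: "nat \<Rightarrow> (nat \<Rightarrow> int) monoid" where
  "D_inf m \<equiv> sum_group UNIV (\<lambda>_. integer_mod_group m)"

text \<open>A permutation \<open>\<sigma>\<close> acts on \<open>D_inf m\<close> by moving the \<open>j\<close>-th component to position \<open>\<sigma> j\<close>,
  so that \<open>\<sigma> y\<^sub>j \<sigma>\<inverse> = y\<^bsub>\<sigma>(j)\<^esub>\<close>.\<close>

definition G_inf :: "nat \<Rightarrow> ((nat \<Rightarrow> int) \<times> (nat \<Rightarrow> nat)) monoid" where
  "G_inf m =
     \<lparr>carrier = carrier (D_inf m) \<times> {\<sigma>. permutation \<sigma>},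
      monoid.mult = (\<lambda>(d, \<sigma>) (d', \<sigma>'). (d \<otimes>\<^bsub>D_inf m\<^esub> (\<lambda>j. d' (inv_into UNIV \<sigma> j)), \<sigma> \<circ> \<sigma>')),
      one = (\<one>\<^bsub>D_inf m\<^esub>, id)\<rparr>"

text \<open>The generators of the cyclic groups are the residue classes of \<open>1\<close>.\<close>

definition y_gen :: "nat \<Rightarrow> (nat \<Rightarrow> int) \<times> (nat \<Rightarrow> nat)" where
  "y_gen j = ((\<lambda>k. if k = j then 1 else 0), id)"

definition s_gen :: "nat \<Rightarrow> nat \<Rightarrow> (nat \<Rightarrow> int) \<times> (nat \<Rightarrow> nat)" where
  "s_gen m i = (\<one>\<^bsub>D_inf m\<^esub>, Transposition.transpose i (Suc i))"

datatype gen = Z1 | Z2 | Z3 | Rg nat | Eta nat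

inductive G'_rel :: "nat \<Rightarrow> gen word \<Rightarrow> gen word \<Rightarrow> bool" for m where
  z_central: "z \<in> {Z1, Z2, Z3} \<Longrightarrow> G'_rel m [pos z, pos x] [pos x, pos z]"
| z_square: "z \<in> {Z1, Z2, Z3} \<Longrightarrow> G'_rel m [pos z, pos z] []"
| r_square: "G'_rel m [pos (Rg i), pos (Rg i)] []"
| r_braid: "G'_rel m [pos (Rg i), pos (Rg (Suc i)), pos (Rg i), pos (Rg (Suc i)),
                      pos (Rg i), pos (Rg (Suc i))] []"
| r_comm: "i + 2 \<le> j \<or> j + 2 \<le> i \<Longrightarrow>
    G'_rel m [pos (Rg i), pos (Rg j)] [pos Z1, pos (Rg j), pos (Rg i)]"
| eta_power: "G'_rel m (replicate m (pos (Eta j))) []"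
| eta_comm: "j \<noteq> k \<Longrightarrow>
    G'_rel m [pos (Eta j), pos (Eta k)] [pos Z2, pos (Eta k), pos (Eta j)]"
| r_eta: "G'_rel m [pos (Rg i), pos (Eta j), neg (Rg i)]
                   [pos Z3, pos (Eta (Transposition.transpose i (Suc i) j))]"

type_synonym G'_elem = "gen word set"

definition G'_inf :: "nat \<Rightarrow> G'_elem monoid" where
  "G'_inf m = presented_group (G'_rel m)"

definition G'_gen :: "nat \<Rightarrow> gen \<Rightarrow> G'_elem" where
  "G'_gen m a = word_class (G'_rel m) [pos a]"

definition Z_sub :: "nat \<Rightarrow> G'_elem set" where
  "Z_sub m = generate (G'_inf m) (G'_gen m ` {Z1, Z2, Z3})"

fun Phi_gen :: "nat \<Rightarrow> gen \<Rightarrow> (nat \<Rightarrow> int) \<times> (nat \<Rightarrow> nat)" where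
  "Phi_gen m (Rg i) = s_gen m i"
| "Phi_gen m (Eta j) = y_gen j"
| "Phi_gen m _ = \<one>\<^bsub>G_inf m\<^esub>"

text \<open>\<open>\<Phi>\<close> is the homomorphism extending \<open>Phi_gen\<close>: all words in a class have the same value
  (see \<open>Phi_word_class\<close>), and this is the value of \<open>\<Phi>\<close>.\<close>

definition Phi :: "nat \<Rightarrow> G'_elem \<Rightarrow> (nat \<Rightarrow> int) \<times> (nat \<Rightarrow> nat)" where
  "Phi m A = the_elem (eval_word (G_inf m) (Phi_gen m) ` A)"

lemma carrier_D_inf: "carrier (D_inf m) =
    {d. range d \<subseteq> carrier (integer_mod_group m) \<and> finite {j. d j \<noteq> 0}}"
  by (simp add: carrier_sum_group PiE_UNIV_domain Pi_def image_subset_iff)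

lemma group_D_inf: "group (D_inf m)"
  by (rule sum_group) simp

lemma D_inf_shift:
  assumes "d \<in> carrier (D_inf m)" "permutation \<sigma>"
  shows "(\<lambda>j. d (\<sigma> j)) \<in> carrier (D_inf m)"
proof -
  have b: "bij \<sigma>" using assms(2) by (simp add: permutation)
  have "finite (\<sigma> -` {j. d j \<noteq> 0})"
    using assms(1) b by (intro finite_vimageI) (auto simp: carrier_D_inf bij_def)
  then show ?thesis using assms(1) by (auto simp: carrier_D_inf vimage_def)
qed

lemma group_G_inf: "group (G_inf m)"
proof (rule groupI)
  interpret D: group "D_inf m" by (rule group_D_inf)
  show "x \<otimes>\<^bsub>G_inf m\<^esub> y \<in> carrier (G_inf m)"
    if "x \<in> carrier (G_inf m)" "y \<in> carrier (G_inf m)" for x y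
  proof -
    obtain d s d' s' where xy: "x = (d, s)" "y = (d', s')" by (cases x, cases y)
    then have "d \<in> carrier (D_inf m)" "d' \<in> carrier (D_inf m)" "permutation s" "permutation s'"
      using that by (simp_all add: G_inf_def)
    then show ?thesis
      using D.m_closed[of d "\<lambda>j. d' (inv_into UNIV s j)"] D_inf_shift[of d' m "inv_into UNIV s"]
        permutation_inverse[of s] permutation_compose[of s s']
      by (simp add: xy G_inf_def del: mult_sum_group)
  qed
  show "\<one>\<^bsub>G_inf m\<^esub> \<in> carrier (G_inf m)"
    using D.one_closed permutation_id by (simp add: G_inf_def id_def del: one_sum_group)
  show "x \<otimes>\<^bsub>G_inf m\<^esub> y \<otimes>\<^bsub>G_inf m\<^esub> z = x \<otimes>\<^bsub>G_inf m\<^esub> (y \<otimes>\<^bsub>G_inf m\<^esub> z)"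
    if "x \<in> carrier (G_inf m)" "y \<in> carrier (G_inf m)" "z \<in> carrier (G_inf m)" for x y z
  proof -
    obtain d s d' s' d'' s'' where xyz: "x = (d, s)" "y = (d', s')" "z = (d'', s'')"
      by (cases x, cases y, cases z)
    then have "bij s" "bij s'"
      using that by (simp_all add: G_inf_def permutation)
    then have "inv_into UNIV (s \<circ> s') = inv_into UNIV s' \<circ> inv_into UNIV s"
      by (rule o_inv_distrib)
    then show ?thesis
      by (simp add: xyz G_inf_def mod_simps add.assoc comp_assoc)
  qed
  show "\<one>\<^bsub>G_inf m\<^esub> \<otimes>\<^bsub>G_inf m\<^esub> x = x" if "x \<in> carrier (G_inf m)" for x
  proof -
    obtain d s where x: "x = (d, s)" by (cases x)
    have "d \<in> carrier (D_inf m)" using that by (simp add: x G_inf_def)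
    from D.l_one[OF this] show ?thesis
      by (simp add: x G_inf_def inv_id)
  qed
  show "\<exists>y\<in>carrier (G_inf m). y \<otimes>\<^bsub>G_inf m\<^esub> x = \<one>\<^bsub>G_inf m\<^esub>" if "x \<in> carrier (G_inf m)" for x
  proof -
    obtain d s where x: "x = (d, s)" by (cases x)
    have d: "d \<in> carrier (D_inf m)" and s: "permutation s" using that by (simp_all add: x G_inf_def)
    have b: "bij s" using s by (simp add: permutation)
    let ?d = "\<lambda>j. d (s j)"
    have d': "?d \<in> carrier (D_inf m)" using D_inf_shift[OF d s] .
    have "(inv\<^bsub>D_inf m\<^esub> ?d, inv_into UNIV s) \<in> carrier (G_inf m)"
      using D.inv_closed[OF d'] permutation_inverse[OF s] by (simp add: G_inf_def)
    moreover have "(inv\<^bsub>D_inf m\<^esub> ?d, inv_into UNIV s) \<otimes>\<^bsub>G_inf m\<^esub> x = \<one>\<^bsub>G_inf m\<^esub>"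
      using D.l_inv[OF d'] b
      by (simp add: G_inf_def x inv_inv_eq bij_is_inj inv_o_cancel del: mult_sum_group one_sum_group)
    ultimately show ?thesis by (rule bexI[rotated])
  qed
qed

context
  fixes m :: nat
  assumes m: "m > 1"
begin

lemma Phi_gen_closed: "Phi_gen m a \<in> carrier (G_inf m)"
proof -
  interpret D: group "D_inf m" by (rule group_D_inf)
  have "range (\<lambda>k. if k = j then 1 else 0) \<subseteq> {0..<int m}" for j :: nat using m by auto
  moreover have "finite {k. (if k = j then 1 else 0 :: int) \<noteq> 0}" for j :: nat by simp
  ultimately have "y_gen j \<in> carrier (G_inf m)" for j
    using m by (simp add: y_gen_def G_inf_def carrier_D_inf carrier_integer_mod_group)
  moreover have "s_gen m i \<in> carrier (G_inf m)" for i
    using D.one_closed by (simp add: s_gen_def G_inf_def permutation_swap_id del: one_sum_group)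
  moreover have "\<one>\<^bsub>G_inf m\<^esub> \<in> carrier (G_inf m)"
    using group_G_inf by (simp add: group.is_monoid)
  ultimately show ?thesis by (cases a) auto
qed

lemma y_power:
  "eval_word (G_inf m) (Phi_gen m) (replicate n (pos (Eta j))) = 
   ((\<lambda>k. if k = j then int n mod int m else 0), id)"
  by (induction n) (use m in \<open>auto simp: G_inf_def y_gen_def mod_simps fun_eq_iff\<close>)

lemma s_inv: "inv\<^bsub>G_inf m\<^esub> (s_gen m i) = s_gen m i"
proof -
  interpret G: group "G_inf m" by (rule group_G_inf)
  show ?thesis
    by (rule G.inv_equality)
       (use Phi_gen_closed[of "Rg i"] in \<open>simp_all add: s_gen_def G_inf_def\<close>)
qed

lemma tr_comm: "i + 2 \<le> j \<Longrightarrow> Transposition.transpose i (Suc i) \<circ> Transposition.transpose j (Suc j)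
   = Transposition.transpose j (Suc j) \<circ> Transposition.transpose i (Suc i)"
  by (auto simp: fun_eq_iff Transposition.transpose_def)

lemma Phi_respects: "G'_rel m u v \<Longrightarrow>
    eval_word (G_inf m) (Phi_gen m) u = eval_word (G_inf m) (Phi_gen m) v"
proof -
  interpret G: group "G_inf m" by (rule group_G_inf)
  note cl = Phi_gen_closed
  assume "G'_rel m u v" then show ?thesis
  proof cases
    case (z_central z x)
    then have "Phi_gen m z = \<one>\<^bsub>G_inf m\<^esub>" by auto
    then show ?thesis using z_central cl[of x] by simp
  next
    case (z_square z)
    then have "Phi_gen m z = \<one>\<^bsub>G_inf m\<^esub>" by auto
    then show ?thesis using z_square by simp
  next
    case (r_square i)
    then show ?thesis by (simp add: s_gen_def G_inf_def)
  next
    case (r_braid i)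
    then show ?thesis by (auto simp: s_gen_def G_inf_def fun_eq_iff Transposition.transpose_def)
  next
    case (r_comm i j)
    then show ?thesis using tr_comm[of i j] tr_comm[of j i] by (auto simp: s_gen_def G_inf_def)
  next
    case (eta_power j)
    then show ?thesis using y_power[of m j] by (auto simp: G_inf_def)
  next
    case (eta_comm j k)
    then show ?thesis using m by (auto simp: y_gen_def G_inf_def fun_eq_iff)
  next
    case (r_eta i j)
    have "Phi_gen m Z3 = \<one>\<^bsub>G_inf m\<^esub>" by auto
    then show ?thesis using r_eta m s_inv[of i]
      by (auto simp: y_gen_def s_gen_def G_inf_def fun_eq_iff)
  qed
qed

lemma Phi_word_class: "Phi m (word_class (G'_rel m) w) = eval_word (G_inf m) (Phi_gen m) w"
proof -
  interpret G: group "G_inf m" by (rule group_G_inf)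
  have "eval_word (G_inf m) (Phi_gen m) ` word_class (G'_rel m) w = {eval_word (G_inf m) (Phi_gen m) w}"
    using G.eval_word_cong[OF Phi_gen_closed Phi_respects] pres_cong.refl
    by (fastforce simp: word_class_def)
  then show ?thesis by (simp add: Phi_def)
qed

lemma Phi_hom: "Phi m \<in> hom (G'_inf m) (G_inf m)"
proof -
  interpret G: group "G_inf m" by (rule group_G_inf)
  show ?thesis
  by (rule homI)
     (auto simp: G'_inf_def presented_group_def Phi_word_class G.eval_word_closed Phi_gen_closed
         mult_word_class[unfolded presented_group_def, simplified] G.eval_word_append)
qed
end

definition supp_G :: "nat \<Rightarrow> (nat \<Rightarrow> int) \<times> (nat \<Rightarrow> nat) \<Rightarrow> nat set" where
  "supp_G m = (\<lambda>(d, \<sigma>). {j. d j \<noteq> \<one>\<^bsub>integer_mod_group m\<^esub>} \<union> {j. \<sigma> j \<noteq> j})"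

definition supp :: "nat \<Rightarrow> G'_elem \<Rightarrow> nat set" where
  "supp m g = supp_G m (Phi m g)"


section \<open>Characters, factorisable functions and spin types\<close>

text \<open>A function on a group is given by its values on the carrier; values elsewhere
  are irrelevant in all that follows.\<close>

definition positive_definite :: "('a, 'b) monoid_scheme \<Rightarrow> ('a \<Rightarrow> complex) \<Rightarrow> bool" where
  "positive_definite G f \<longleftrightarrow>
     (\<forall>S c. finite S \<and> S \<subseteq> carrier G \<longrightarrow>
        (\<Sum>g\<in>S. \<Sum>h\<in>S. c g * cnj (c h) * f (inv\<^bsub>G\<^esub> h \<otimes>\<^bsub>G\<^esub> g)) \<in> \<real>\<^sub>\<ge>\<^sub>0)"

definition K1 :: "('a, 'b) monoid_scheme \<Rightarrow> ('a \<Rightarrow> complex) set" where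
  "K1 G = {f. positive_definite G f \<and>
              (\<forall>g\<in>carrier G. \<forall>h\<in>carrier G. f (h \<otimes>\<^bsub>G\<^esub> g \<otimes>\<^bsub>G\<^esub> inv\<^bsub>G\<^esub> h) = f g) \<and>
              f \<one>\<^bsub>G\<^esub> = 1}"

definition E_char :: "('a, 'b) monoid_scheme \<Rightarrow> ('a \<Rightarrow> complex) set" where
  "E_char G = {f \<in> K1 G. \<forall>f1\<in>K1 G. \<forall>f2\<in>K1 G. \<forall>t::real. 0 < t \<and> t < 1 \<and>
            (\<forall>g\<in>carrier G. f g = of_real t * f1 g + of_real (1 - t) * f2 g) \<longrightarrow>
            (\<forall>g\<in>carrier G. f1 g = f g \<and> f2 g = f g)}"

definition factorisable :: "nat \<Rightarrow> (G'_elem \<Rightarrow> complex) \<Rightarrow> bool" where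
  "factorisable m f \<longleftrightarrow>
     (\<forall>h\<in>carrier (G'_inf m). \<forall>k\<in>carrier (G'_inf m).
        supp m h \<inter> supp m k = {} \<longrightarrow> f (h \<otimes>\<^bsub>G'_inf m\<^esub> k) = f h * f k)"

definition F_fact :: "nat \<Rightarrow> (G'_elem \<Rightarrow> complex) set" where
  "F_fact m = {f \<in> K1 (G'_inf m). factorisable m f}"

definition circle_group :: "complex monoid" where
  "circle_group = \<lparr>carrier = {z. cmod z = 1}, monoid.mult = (*), one = 1\<rparr>"

definition Z_dual :: "nat \<Rightarrow> (G'_elem \<Rightarrow> complex) set" where
  "Z_dual m = hom (G'_inf m\<lparr>carrier := Z_sub m\<rparr>) circle_group"

definition has_spin_type :: "nat \<Rightarrow> (G'_elem \<Rightarrow> complex) \<Rightarrow> (G'_elem \<Rightarrow> complex) \<Rightarrow> bool" where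
  "has_spin_type m \<chi> f \<longleftrightarrow>
     (\<forall>z\<in>Z_sub m. \<forall>g\<in>carrier (G'_inf m). f (z \<otimes>\<^bsub>G'_inf m\<^esub> g) = \<chi> z * f g)"

definition E_spin :: "nat \<Rightarrow> (G'_elem \<Rightarrow> complex) \<Rightarrow> (G'_elem \<Rightarrow> complex) set" where
  "E_spin m \<chi> = {f \<in> E_char (G'_inf m). has_spin_type m \<chi> f}"

definition F_spin :: "nat \<Rightarrow> (G'_elem \<Rightarrow> complex) \<Rightarrow> (G'_elem \<Rightarrow> complex) set" where
  "F_spin m \<chi> = {f \<in> F_fact m. has_spin_type m \<chi> f}"

datatype spin_index = Y_I | Y_II | Y_III | Y_IV | Y_V | Y_VI | Y_VII | Y_VIII

fun spin_triple :: "spin_index \<Rightarrow> complex \<times> complex \<times> complex" where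
  "spin_triple Y_I = (-1, -1, -1)"
| "spin_triple Y_II = (-1, -1, 1)"
| "spin_triple Y_III = (-1, 1, -1)"
| "spin_triple Y_IV = (-1, 1, 1)"
| "spin_triple Y_V = (1, -1, -1)"
| "spin_triple Y_VI = (1, -1, 1)"
| "spin_triple Y_VII = (1, 1, -1)"
| "spin_triple Y_VIII = (1, 1, 1)"

text \<open>\<open>is_chi m Y \<chi>\<close> says that \<open>\<chi>\<close> is the character of \<open>Z\<close> with index \<open>Y\<close>.\<close>

definition is_chi :: "nat \<Rightarrow> spin_index \<Rightarrow> (G'_elem \<Rightarrow> complex) \<Rightarrow> bool" where
  "is_chi m Y \<chi> \<longleftrightarrow> \<chi> \<in> Z_dual m \<and>
     (\<chi> (G'_gen m Z1), \<chi> (G'_gen m Z2), \<chi> (G'_gen m Z3)) = spin_triple Y"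

definition first_kind :: "spin_index \<Rightarrow> bool" where
  "first_kind Y \<longleftrightarrow> Y \<in> {Y_I, Y_IV, Y_V, Y_VI, Y_VIII}"

definition pointwise_prod ::
    "('a \<Rightarrow> complex) set \<Rightarrow> ('a \<Rightarrow> complex) set \<Rightarrow> ('a \<Rightarrow> complex) set" (infixl \<open>\<star>\<close> 70) where
  "A \<star> B = {\<lambda>g. f1 g * f2 g | f1 f2. f1 \<in> A \<and> f2 \<in> B}"

end

theory Submission
  imports Defs "HOL-Library.Z2" "HOL-Library.Product_Plus"
begin

text \<open>Both parts of the theorem come down to comparing extremal with factorisable functions, since
  factorisability passes to products at once, and so does membership in \<open>K1\<close> by the Schur product
  theorem (\<open>K1_mult\<close>).

  A factorisable \<open>f\<close> is extremal (\<open>F_fact_subset_E_char\<close>): an element \<open>k\<close> has as many conjugates with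
  pairwise disjoint supports as one likes, these are uncorrelated under \<open>f\<close>, and so their average
  acts in the limit like the number \<open>f k\<close>. The same average has mean \<open>f1 k\<close> and \<open>f2 k\<close> for the two
  parts of a convex decomposition of \<open>f\<close>, and strict convexity of the square leaves no room for
  \<open>f1 k \<noteq> f2 k\<close>.

  In the other direction, two elements \<open>h\<close>, \<open>k\<close> with disjoint supports commute up to a central
  element \<open>\<zeta> (\<beta> h k)\<close> that is bilinear in their parities, the numbers modulo two of letters \<open>r i\<close> and
  \<open>\<eta> j\<close> (\<open>com_disjoint\<close>). Composed with a spin type this is a symmetric form over the field with two
  elements. If the parity of \<open>k\<close> lies in the radical of the form, then pushing \<open>k\<close> to infinity by
  conjugations produces a sequence that is asymptotically central for \<open>f\<close>, which forces
  \<open>f (h \<otimes> k) = f h * f k\<close> for extremal \<open>f\<close> (\<open>E_char_radical_mult\<close>).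
  If neither parity lies in the radical, and the spin type is of the first kind, then \<open>f (h \<otimes> k)\<close> and
  \<open>f h\<close> both vanish, because \<open>h \<otimes> k\<close> is conjugate to a central multiple of itself on which \<open>f\<close>
  changes sign (\<open>first_kind_vanish\<close>). The conjugating element is one far away, or \<open>h\<close> itself, or,
  for the types V and VI, the product of the \<open>\<eta> j\<close> over the support of \<open>h\<close>. Hence extremal functions of the
  first kind are factorisable.

  The vanishing argument uses only invariance and the spin type, and the trivial parity is radical for
  every type. So a product \<open>f1 f2\<close> of extremal functions is factorisable as soon as one of \<open>f1\<close>,
  \<open>f2\<close>, \<open>f1 f2\<close> has type V or VI: where the other arguments fail, that one of the three is zero
  (\<open>E_mult_type_V_VI\<close>).

  All this presupposes that an element is controlled by its support, that is, that the kernel of \<open>\<Phi>\<close>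
  is \<open>Z\<close> (\<open>kernel_Phi\<close>). This is the coset enumeration behind the Coxeter presentation of the symmetric
  group, carried out in the central extension.\<close>

section \<open>Positive-definite functions\<close>

context group
begin

text \<open>The definition sums over a set of group elements, whereas the vectors used below come as families
  whose members may coincide. Adding up the coefficients of equal members reduces one to the other.\<close>

lemma positive_definite_family:
  assumes pd: "positive_definite G f" and I: "finite I" and x: "\<And>i. i \<in> I \<Longrightarrow> x i \<in> carrier G"
  shows "(\<Sum>i\<in>I. \<Sum>j\<in>I. c i * cnj (c j) * f (inv (x j) \<otimes> x i)) \<in> \<real>\<^sub>\<ge>\<^sub>0"
proof -
  define C where "C g = (\<Sum>i | i \<in> I \<and> x i = g. c i)" for g
  have inner: "(\<Sum>j\<in>I. cnj (c j) * f (inv (x j) \<otimes> g)) = (\<Sum>h\<in>x ` I. cnj (C h) * f (inv h \<otimes> g))" for g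
    unfolding C_def cnj_sum sum_distrib_right
    by (subst sum.image_gen[OF I, of _ x]) (auto intro!: sum.cong)
  have "(\<Sum>i\<in>I. \<Sum>j\<in>I. c i * cnj (c j) * f (inv (x j) \<otimes> x i))
      = (\<Sum>i\<in>I. c i * (\<Sum>h\<in>x ` I. cnj (C h) * f (inv h \<otimes> x i)))"
    by (simp only: inner[symmetric] sum_distrib_left mult.assoc)
  also have "\<dots> = (\<Sum>g\<in>x ` I. C g * (\<Sum>h\<in>x ` I. cnj (C h) * f (inv h \<otimes> g)))"
    unfolding C_def[of "_ :: 'a", abs_def] sum_distrib_right
    by (subst sum.image_gen[OF I, of _ x]) (auto intro!: sum.cong)
  also have "\<dots> = (\<Sum>g\<in>x ` I. \<Sum>h\<in>x ` I. C g * cnj (C h) * f (inv h \<otimes> g))"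
    by (simp only: sum_distrib_left mult.assoc)
  finally show ?thesis
    using pd I x unfolding positive_definite_def by (simp add: image_subset_iff)
qed

lemma K1_closed:
  assumes "f \<in> K1 G"
  shows "positive_definite G f" "f \<one> = 1"
    "\<And>g h. g \<in> carrier G \<Longrightarrow> h \<in> carrier G \<Longrightarrow> f (h \<otimes> g \<otimes> inv h) = f g"
  using assms by (auto simp: K1_def)

lemma K1_comm:
  assumes "f \<in> K1 G" "g \<in> carrier G" "h \<in> carrier G"
  shows "f (g \<otimes> h) = f (h \<otimes> g)"
  using K1_closed(3)[OF assms(1), of "g \<otimes> h" "h"] assms by (simp add: m_assoc)

lemma positive_definite_two:
  assumes "positive_definite G f" "f \<one> = 1" "g \<in> carrier G"
  shows "1 + c * f g + cnj c * f (inv g) + c * cnj c \<in> \<real>\<^sub>\<ge>\<^sub>0"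
  using positive_definite_family[OF assms(1), of "{0::nat,1}" "\<lambda>i. if i = 0 then \<one> else g"
      "\<lambda>i. if i = 0 then 1 else c"] assms by (simp add: algebra_simps)

lemma positive_definite_inv:
  assumes "positive_definite G f" "f \<one> = 1" "g \<in> carrier G"
  shows "f (inv g) = cnj (f g)"
  using positive_definite_two[OF assms, of 1] positive_definite_two[OF assms, of \<i>]
  by (auto simp: complex_nonneg_Reals_iff complex_eq_iff)

lemma positive_definite_le_1:
  assumes "positive_definite G f" "f \<one> = 1" "g \<in> carrier G"
  shows "cmod (f g) \<le> 1"
proof (cases "f g = 0")
  case False
  \<comment> \<open>The unit for which \<open>c * f g = - cmod (f g)\<close>, so that the bound is sharpest.\<close>
  define c where "c = - cnj (f g) / cmod (f g)"
  have r: "f g * cnj (f g) = of_real (cmod (f g)) * of_real (cmod (f g))"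
    by (metis complex_norm_square power2_eq_square of_real_power)
  have c1: "c * f g = - cmod (f g)" "cnj c * cnj (f g) = - cmod (f g)"
    using False r by (simp_all add: c_def field_simps)
  have c2: "c * cnj c = 1"
    using False r by (simp add: c_def field_simps)
  have "1 + c * f g + cnj c * cnj (f g) + c * cnj c \<in> \<real>\<^sub>\<ge>\<^sub>0"
    using positive_definite_two[OF assms, of c] by (simp add: positive_definite_inv[OF assms])
  then show ?thesis unfolding c1 c2 by (simp add: complex_nonneg_Reals_iff)
qed simp

text \<open>The Cauchy-Schwarz inequality between the sum of the \<open>x i\<close> and the neutral element, in the inner product
  that \<open>f\<close> defines on the group algebra. It is positivity at the sum of the \<open>x i\<close> minus its
  projection \<open>card I * a\<close> on the neutral element, which takes the additional index \<open>None\<close>.\<close>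

lemma positive_definite_variance:
  fixes I :: "'i set"
  assumes pd: "positive_definite G f" and f1: "f \<one> = 1"
    and I: "finite I" and x: "\<And>i. i \<in> I \<Longrightarrow> x i \<in> carrier G" and fx: "\<And>i. i \<in> I \<Longrightarrow> f (x i) = a"
  shows "(real (card I) * cmod a)\<^sup>2 \<le> Re (\<Sum>i\<in>I. \<Sum>j\<in>I. f (inv (x j) \<otimes> x i))"
proof -
  define w where "w = - (of_nat (card I) * a)"
  let ?J = "insert None (Some ` I)" 
  let ?x = "case_option \<one> x" and ?c = "case_option w (\<lambda>_. 1)"
  have J: "(\<Sum>i\<in>?J. F i) = F None + (\<Sum>i\<in>I. F (Some i))" for F :: "'i option \<Rightarrow> complex"
    using I by (simp add: sum.reindex)
  have "(\<Sum>i\<in>?J. \<Sum>j\<in>?J. ?c i * cnj (?c j) * f (inv (?x j) \<otimes> ?x i)) \<in> \<real>\<^sub>\<ge>\<^sub>0"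
    by (rule positive_definite_family[OF pd]) (use I x in auto)
  also have "(\<Sum>i\<in>?J. \<Sum>j\<in>?J. ?c i * cnj (?c j) * f (inv (?x j) \<otimes> ?x i))
     = w * cnj w + w * (\<Sum>i\<in>I. cnj (f (x i))) + cnj w * (\<Sum>i\<in>I. f (x i))
        + (\<Sum>i\<in>I. \<Sum>j\<in>I. f (inv (x j) \<otimes> x i))"
    unfolding J by (simp add: sum.distrib sum_distrib_left f1 x positive_definite_inv[OF pd f1])
  also have "w * cnj w + w * (\<Sum>i\<in>I. cnj (f (x i))) + cnj w * (\<Sum>i\<in>I. f (x i)) = - (w * cnj w)"
    by (simp add: fx w_def)
  also have "w * cnj w = of_real ((real (card I) * cmod a)\<^sup>2)"
    by (simp only: complex_norm_square[symmetric] w_def norm_minus_cancel norm_mult norm_of_nat)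
  finally show ?thesis by (simp add: complex_nonneg_Reals_iff)
qed

end

text \<open>On vectors supported by \<open>s\<close> and \<open>g\<close> the form is quadratic only in the coordinate of \<open>g\<close>, and a
  small multiple of the conjugate of \<open>A g s\<close> in that coordinate would make it negative.\<close>

lemma psd_zero_diagonal:
  fixes A :: "'b \<Rightarrow> 'b \<Rightarrow> complex"
  assumes psd: "\<And>c. (\<Sum>g\<in>S. \<Sum>h\<in>S. c g * cnj (c h) * A g h) \<in> \<real>\<^sub>\<ge>\<^sub>0" and "finite S"
   and "s \<in> S" "g \<in> S" "A s s = 0" "A s g = cnj (A g s)" "A g g \<in> \<real>\<^sub>\<ge>\<^sub>0"
  shows "A g s = 0"
proof (rule ccontr)
  assume nz: "A g s \<noteq> 0"
  then have "g \<noteq> s" using assms by auto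
  have *: "c * cnj c * A g g + c * A g s + cnj c * cnj (A g s) \<in> \<real>\<^sub>\<ge>\<^sub>0" for c
  proof -
    have S: "S = insert s (insert g (S - {s,g}))" using assms by auto
    have "(\<Sum>h\<in>S. \<Sum>k\<in>S. (if h = g then c else if h = s then 1 else 0) *
             cnj (if k = g then c else if k = s then 1 else 0) * A h k) \<in> \<real>\<^sub>\<ge>\<^sub>0"
      by (rule psd)
    moreover have sumS: "(\<Sum>h\<in>S. (if h = g then c else if h = s then 1 else 0) * F h) = F s + c * F g"
      for F and c :: complex
      using \<open>g \<noteq> s\<close> \<open>finite S\<close> by (subst S) (auto simp: sum.neutral)
    have "(\<Sum>h\<in>S. \<Sum>k\<in>S. (if h = g then c else if h = s then 1 else 0) *
             cnj (if k = g then c else if k = s then 1 else 0) * A h k)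
      = (\<Sum>h\<in>S. (if h = g then c else if h = s then 1 else 0) *
          (\<Sum>k\<in>S. (if k = g then cnj c else if k = s then 1 else 0) * A h k))"
      unfolding sum_distrib_left by (intro sum.cong HOL.refl) auto
    also have "\<dots> = A s s + cnj c * A s g + c * (A g s + cnj c * A g g)"
      unfolding sumS ..
    ultimately show ?thesis using assms by (simp add: algebra_simps)
  qed
  \<comment> \<open>Negative, and small enough for the linear term \<open>2 * t\<close> to outweigh the square term \<open>t * t * A g g\<close>.\<close>
  define t where "t = - 1 / (1 + Re (A g g))"
  define a where "a = (cmod (A g s))\<^sup>2"
  have a: "A g s * cnj (A g s) = of_real a" by (simp add: a_def complex_norm_square[symmetric])
  have ap: "a > 0" using nz by (simp add: a_def)
  have G: "Re (A g g) \<ge> 0" "A g g = of_real (Re (A g g))"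
    using assms(7) by (auto simp: complex_nonneg_Reals_iff complex_eq_iff)
  define b where "b = Re (A g g)"
  have b: "b \<ge> 0" "A g g = of_real b" using G by (simp_all add: b_def)
  have "(t * cnj (A g s)) * cnj (t * cnj (A g s)) * A g g + (t * cnj (A g s)) * A g s
      + cnj (t * cnj (A g s)) * cnj (A g s) = of_real (t * t * b * a + 2 * t * a)"
    using a b(2) by (simp add: algebra_simps)
  then have "t * t * b * a + 2 * t * a \<ge> 0"
    using *[of "t * cnj (A g s)"] by (simp only: nonneg_Reals_of_real_iff)
  then have "a * (t * (t * b + 2)) \<ge> 0" by (simp add: algebra_simps)
  then have "t * (t * b + 2) \<ge> 0" using ap by (simp add: zero_le_mult_iff)
  moreover have "t < 0" "t * b + 2 > 0"
    using b(1) unfolding t_def b_def[symmetric] by (auto simp: field_simps)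
  ultimately show False by (simp add: zero_le_mult_iff)
qed

text \<open>Induction on the index set. Subtracting the rank-one matrix of the vector \<open>v\<close>, the normalised column of
  \<open>s\<close>, clears the row and the column of \<open>s\<close>. What is left, the Schur complement \<open>B\<close>, is again positive
  semidefinite, because every vector on \<open>S\<close> extends to one on \<open>insert s S\<close> that is orthogonal to \<open>v\<close>,
  and on such vectors \<open>A\<close> and \<open>B\<close> agree.\<close>

lemma psd_decomposition:
  fixes A :: "'b \<Rightarrow> 'b \<Rightarrow> complex"
  assumes "finite S" and "\<And>c. (\<Sum>g\<in>S. \<Sum>h\<in>S. c g * cnj (c h) * A g h) \<in> \<real>\<^sub>\<ge>\<^sub>0"
    and "\<And>g h. g \<in> S \<Longrightarrow> h \<in> S \<Longrightarrow> A h g = cnj (A g h)"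
  shows "\<exists>w :: 'b \<Rightarrow> 'b \<Rightarrow> complex. \<forall>g\<in>S. \<forall>h\<in>S. A g h = (\<Sum>k\<in>S. w k g * cnj (w k h))"
  using assms
proof (induction S arbitrary: A rule: finite_induct)
  case (insert s S)
  have diag: "A g g \<in> \<real>\<^sub>\<ge>\<^sub>0" if "g \<in> insert s S" for g
  proof -
    have d: "(if h = g then 1 else 0) * F h = (if h = g then F h else 0)" for h and F :: "'b \<Rightarrow> complex"
      by simp
    have "(\<Sum>h\<in>insert s S. \<Sum>k\<in>insert s S. (if h = g then 1 else 0) * cnj (if k = g then 1 else 0) * A h k)
      = (\<Sum>h\<in>insert s S. if h = g then (\<Sum>k\<in>insert s S. if k = g then A h k else 0) else 0)"
      by (intro sum.cong HOL.refl) (auto intro!: sum.cong)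
    also have "\<dots> = A g g" using that insert.hyps(1) by (simp only: sum.delta finite_insert if_True)
    finally show ?thesis using insert.prems(1)[of "\<lambda>h. if h = g then 1 else 0"] by simp
  qed
  define a where "a = Re (A s s)"
  have a: "A s s = of_real a" "a \<ge> 0"
    using diag[of s] by (auto simp: complex_nonneg_Reals_iff a_def complex_eq_iff)
  define v where "v g = (if a = 0 then 0 else A g s / of_real (sqrt a))" for g
  define B where "B g h = A g h - v g * cnj (v h)" for g h
  have herm: "A s g = cnj (A g s)" if "g \<in> S" for g using insert.prems(2)[of g s] that by simp
  have z: "A g s = v g * cnj (v s) \<and> A s g = v s * cnj (v g)" if "g \<in> insert s S" for g
  proof (cases "a = 0")
    case True
    have "A g s = 0"
      by (rule psd_zero_diagonal[OF insert.prems(1) _ insertI1 that])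
        (use True a diag[OF that] insert.hyps insert.prems(2)[OF that insertI1] in simp_all)
    moreover have "A s g = cnj (A g s)" using insert.prems(2)[of g s] that by simp
    ultimately show ?thesis using True by (simp add: v_def)
  next
    case False
    have sq: "complex_of_real (sqrt a) * of_real (sqrt a) = of_real a"
      using a(2) by (metis of_real_mult real_sqrt_mult_self abs_of_nonneg)
    have "v s = of_real (sqrt a)" using False sq a by (simp add: v_def field_simps)
    then show ?thesis using False a insert.prems(2)[of g s] that by (simp add: v_def)
  qed
  have "\<exists>w. \<forall>g\<in>S. \<forall>h\<in>S. B g h = (\<Sum>k\<in>S. w k g * cnj (w k h))"
  proof (rule insert.IH)
    fix g h assume "g \<in> S" "h \<in> S"
    then show "B h g = cnj (B g h)" using insert.prems(2)[of g h] by (simp add: B_def)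
  next
    fix c :: "'b \<Rightarrow> complex"
    define p where "p = (\<Sum>g\<in>S. c g * v g)"
    \<comment> \<open>The extension of \<open>c\<close> that is orthogonal to \<open>v\<close>.\<close>
    define c' where "c' = c(s := if a = 0 then 0 else - p / of_real (sqrt a))"
    have cp: "c' s * v s = - (if a = 0 then 0 else p)"
    proof (cases "a = 0")
      case False
      have sq: "complex_of_real (sqrt a) * of_real (sqrt a) = of_real a"
        using a(2) by (metis of_real_mult real_sqrt_mult_self abs_of_nonneg)
      have "v s = of_real (sqrt a)" using False sq a by (simp add: v_def field_simps)
      then show ?thesis using False a(2) by (simp add: c'_def)
    qed (simp add: c'_def)
    have p0: "p = 0" if "a = 0" using that by (simp add: p_def v_def)
    have csum: "(\<Sum>g\<in>insert s S. c' g * v g) = 0"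
    proof -
      have "(\<Sum>g\<in>S. c' g * v g) = p"
        unfolding p_def by (rule sum.cong) (use insert.hyps in \<open>auto simp: c'_def\<close>)
      then show ?thesis using insert.hyps cp p0 by simp
    qed
    have "(\<Sum>g\<in>insert s S. \<Sum>h\<in>insert s S. c' g * cnj (c' h) * A g h)
       = (\<Sum>g\<in>insert s S. \<Sum>h\<in>insert s S. c' g * cnj (c' h) * B g h)
         + (\<Sum>g\<in>insert s S. \<Sum>h\<in>insert s S. (c' g * v g) * cnj (c' h * v h))"
      unfolding sum.distrib[symmetric]
      by (rule sum.cong[OF HOL.refl], rule sum.cong[OF HOL.refl]) (simp add: B_def algebra_simps)
    also have "(\<Sum>g\<in>insert s S. \<Sum>h\<in>insert s S. (c' g * v g) * cnj (c' h * v h)) = 0"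
      unfolding sum_product[symmetric] csum by simp
    also have "(\<Sum>g\<in>insert s S. \<Sum>h\<in>insert s S. c' g * cnj (c' h) * B g h)
       = (\<Sum>g\<in>S. \<Sum>h\<in>S. c g * cnj (c h) * B g h)"
    proof -
      have Bz: "B g s = 0" "B s g = 0" if "g \<in> insert s S" for g using z[OF that] by (simp_all add: B_def)
      have c': "c' g = c g" if "g \<in> S" for g using that insert.hyps by (auto simp: c'_def)
      have row: "(\<Sum>h\<in>insert s S. c' g * cnj (c' h) * B g h) = (\<Sum>h\<in>S. c' g * cnj (c h) * B g h)"
        if "g \<in> insert s S" for g
        by (simp only: sum.insert[OF insert.hyps] Bz[OF that] mult_zero_right add_0)
          (rule sum.cong[OF HOL.refl], simp add: c')
      have "(\<Sum>g\<in>insert s S. \<Sum>h\<in>insert s S. c' g * cnj (c' h) * B g h)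
          = (\<Sum>g\<in>insert s S. \<Sum>h\<in>S. c' g * cnj (c h) * B g h)"
        by (rule sum.cong[OF HOL.refl row])
      also have "\<dots> = (\<Sum>g\<in>S. \<Sum>h\<in>S. c' g * cnj (c h) * B g h)"
        by (simp add: sum.insert[OF insert.hyps] Bz)
      also have "\<dots> = (\<Sum>g\<in>S. \<Sum>h\<in>S. c g * cnj (c h) * B g h)"
        by (simp add: c')
      finally show ?thesis .
    qed
    finally show "(\<Sum>g\<in>S. \<Sum>h\<in>S. c g * cnj (c h) * B g h) \<in> \<real>\<^sub>\<ge>\<^sub>0"
      using insert.prems(1)[of c'] by simp
  qed
  then obtain w where w: "\<And>g h. g \<in> S \<Longrightarrow> h \<in> S \<Longrightarrow> B g h = (\<Sum>k\<in>S. w k g * cnj (w k h))" by blast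
  define w' where "w' = (\<lambda>k g. if k = s then v g else if g = s then 0 else w k g)"
  have "A g h = (\<Sum>k\<in>insert s S. w' k g * cnj (w' k h))" if "g \<in> insert s S" "h \<in> insert s S" for g h
  proof -
    have "(\<Sum>k\<in>insert s S. w' k g * cnj (w' k h))
       = v g * cnj (v h) + (\<Sum>k\<in>S. if g = s \<or> h = s then 0 else w k g * cnj (w k h))"
      using insert.hyps by (auto simp: w'_def intro!: sum.cong)
    also have "\<dots> = A g h"
    proof (cases "g = s \<or> h = s")
      case True
      then show ?thesis using z[of g] z[of h] that by auto
    next
      case False
      then show ?thesis using that w[of g h, symmetric] by (simp add: B_def)
    qed
    finally show ?thesis ..
  qed
  then show ?case by (intro exI[of _ w'] ballI)
next
  case empty
  show ?case by simp
qed

lemma sum_nonneg_Reals: "(\<And>x. F x \<in> \<real>\<^sub>\<ge>\<^sub>0) \<Longrightarrow> sum F A \<in> \<real>\<^sub>\<ge>\<^sub>0" for F :: "'b \<Rightarrow> complex"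
  by (induction A rule: infinite_finite_induct) auto

context group
begin

text \<open>The Schur product theorem: a decomposition of the matrix of \<open>f\<close> into rank-one matrices turns the form
  of the product into a sum of forms of \<open>f'\<close> with rescaled coefficients.\<close>

lemma positive_definite_mult:
  assumes "positive_definite G f" "f \<one> = 1" "positive_definite G f'"
  shows "positive_definite G (\<lambda>g. f g * f' g)"
  unfolding positive_definite_def
proof (intro allI impI, elim conjE)
  fix S and c :: "'a \<Rightarrow> complex" assume S: "finite S" "S \<subseteq> carrier G"
  have "\<exists>w :: 'a \<Rightarrow> 'a \<Rightarrow> complex. \<forall>g\<in>S. \<forall>h\<in>S. f (inv h \<otimes> g) = (\<Sum>k\<in>S. w k g * cnj (w k h))"
  proof (rule psd_decomposition)
    fix g h assume "g \<in> S" "h \<in> S"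
    then have "inv g \<otimes> h = inv (inv h \<otimes> g)" "inv h \<otimes> g \<in> carrier G"
      using S by (auto simp: inv_mult_group subset_iff)
    then show "f (inv g \<otimes> h) = cnj (f (inv h \<otimes> g))"
      using positive_definite_inv[OF assms(1,2)] by simp
  qed (use S assms(1) in \<open>auto simp: positive_definite_def\<close>)
  then obtain w where w: "\<And>g h. g \<in> S \<Longrightarrow> h \<in> S \<Longrightarrow> f (inv h \<otimes> g) = (\<Sum>k\<in>S. w k g * cnj (w k h))"
    by blast
  have "(\<Sum>g\<in>S. \<Sum>h\<in>S. c g * cnj (c h) * (f (inv h \<otimes> g) * f' (inv h \<otimes> g)))
     = (\<Sum>g\<in>S. \<Sum>h\<in>S. \<Sum>k\<in>S. (c g * w k g) * cnj (c h * w k h) * f' (inv h \<otimes> g))"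
    by (intro sum.cong HOL.refl) (simp add: w sum_distrib_left sum_distrib_right mult_ac)
  also have "\<dots> = (\<Sum>g\<in>S. \<Sum>k\<in>S. \<Sum>h\<in>S. (c g * w k g) * cnj (c h * w k h) * f' (inv h \<otimes> g))"
    by (intro sum.cong HOL.refl sum.swap)
  also have "\<dots> = (\<Sum>k\<in>S. \<Sum>g\<in>S. \<Sum>h\<in>S. (c g * w k g) * cnj (c h * w k h) * f' (inv h \<otimes> g))"
    by (rule sum.swap)
  also have "\<dots> \<in> \<real>\<^sub>\<ge>\<^sub>0"
  proof -
    have "(\<Sum>g\<in>S. \<Sum>h\<in>S. (c g * w k g) * cnj (c h * w k h) * f' (inv h \<otimes> g)) \<in> \<real>\<^sub>\<ge>\<^sub>0" for k
      using assms(3)[unfolded positive_definite_def, rule_format, of S "\<lambda>g. c g * w k g"] S by simp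
    then show ?thesis by (rule sum_nonneg_Reals)
  qed
  finally show "(\<Sum>g\<in>S. \<Sum>h\<in>S. c g * cnj (c h) * (f (inv h \<otimes> g) * f' (inv h \<otimes> g))) \<in> \<real>\<^sub>\<ge>\<^sub>0" .
qed

lemma K1_mult: "f \<in> K1 G \<Longrightarrow> f' \<in> K1 G \<Longrightarrow> (\<lambda>g. f g * f' g) \<in> K1 G"
  using positive_definite_mult[of f f'] by (auto simp: K1_def)

section \<open>Extremal functions\<close>

text \<open>Suppose that \<open>f = t f1 + (1 - t) f2\<close> and let \<open>a\<close> be the average of \<open>n\<close> conjugates of \<open>k\<close> that are uncorrelated
  under \<open>f\<close>. Then \<open>f (a\<^sup>* a)\<close> exceeds \<open>\<bar>f k\<bar>\<^sup>2\<close> by at most \<open>1 / n\<close>, while \<open>fi (a\<^sup>* a)\<close> is at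
  least \<open>\<bar>fi k\<bar>\<^sup>2\<close>. Letting \<open>n\<close> grow gives \<open>t \<bar>f1 k\<bar>\<^sup>2 + (1 - t) \<bar>f2 k\<bar>\<^sup>2 \<le> \<bar>t f1 k + (1 - t) f2 k\<bar>\<^sup>2\<close>,
  and by strict convexity \<open>f1 k = f2 k\<close>.\<close>

lemma E_charI_conjugates:
  assumes f: "f \<in> K1 G"
    and spread: "\<And>k n. k \<in> carrier G \<Longrightarrow> \<exists>x :: nat \<Rightarrow> 'a. (\<forall>i<n. x i \<in> carrier G) \<and>
      (\<forall>i<n. \<forall>j<n. i \<noteq> j \<longrightarrow>
         f (inv (x j \<otimes> k \<otimes> inv (x j)) \<otimes> (x i \<otimes> k \<otimes> inv (x i))) = cnj (f k) * f k)"
  shows "f \<in> E_char G"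
proof -
  have key: "f1 k = f2 k" 
    if f1: "f1 \<in> K1 G" and f2: "f2 \<in> K1 G" and t: "0 < t" "t < 1"
      and eq: "\<And>g. g \<in> carrier G \<Longrightarrow> f g = of_real t * f1 g + of_real (1 - t) * f2 g"
      and k: "k \<in> carrier G" for f1 f2 k and t :: real
  proof -
    define a where "a = (cmod (f k))\<^sup>2"
    define b where "b = t * (cmod (f1 k))\<^sup>2 + (1 - t) * (cmod (f2 k))\<^sup>2"
    have bound: "real n * (b - a) \<le> 1 - a" if n: "n > 0" for n :: nat
    proof -
      obtain x :: "nat \<Rightarrow> 'a" where x: "\<And>i. i < n \<Longrightarrow> x i \<in> carrier G"
        and fx: "\<And>i j. i < n \<Longrightarrow> j < n \<Longrightarrow> i \<noteq> j \<Longrightarrow>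
         f (inv (x j \<otimes> k \<otimes> inv (x j)) \<otimes> (x i \<otimes> k \<otimes> inv (x i))) = cnj (f k) * f k"
        using spread[OF k, of n] by blast
      define y where "y i = x i \<otimes> k \<otimes> inv (x i)" for i
      have y: "y i \<in> carrier G" if "i < n" for i using x[OF that] k by (simp add: y_def)
      have ya: "g (y i) = g k" if "i < n" "g \<in> K1 G" for i g
        using K1_closed(3)[OF that(2) k x[OF that(1)]] by (simp add: y_def)
      have aC: "of_real a = cnj (f k) * f k"
        unfolding a_def complex_norm_square by (rule mult.commute)
      have yf: "f (inv (y j) \<otimes> y i) = of_real a + of_real (if i = j then 1 - a else 0)"
        if "i < n" "j < n" for i j
        using that fx[OF that] K1_closed(2)[OF f] y
        by (auto simp: aC y_def)
      have row: "(\<Sum>j<n. of_real a + of_real (if i = j then 1 - a else 0)) = (of_real (n * a + (1 - a)) :: complex)"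
        if "i < n" for i
        using that by (simp add: sum.distrib if_distrib[of of_real] cong: if_cong)
      have "(\<Sum>i<n. \<Sum>j<n. f (inv (y j) \<otimes> y i)) = (\<Sum>i<n. of_real (n * a + (1 - a)))"
      proof (rule sum.cong[OF HOL.refl])
        fix i assume "i \<in> {..<n}"
        then have i: "i < n" by simp
        have "(\<Sum>j<n. f (inv (y j) \<otimes> y i)) = (\<Sum>j<n. of_real a + of_real (if i = j then 1 - a else 0))"
          by (rule sum.cong[OF HOL.refl]) (simp only: yf i lessThan_iff)
        then show "(\<Sum>j<n. f (inv (y j) \<otimes> y i)) = of_real (n * a + (1 - a))"
          by (simp only: row[OF i])
      qed
      then have "n * (n * a + (1 - a)) = Re (\<Sum>i<n. \<Sum>j<n. f (inv (y j) \<otimes> y i))"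
        by simp
      also have "(\<Sum>i<n. \<Sum>j<n. f (inv (y j) \<otimes> y i))
         = of_real t * (\<Sum>i<n. \<Sum>j<n. f1 (inv (y j) \<otimes> y i))
          + of_real (1 - t) * (\<Sum>i<n. \<Sum>j<n. f2 (inv (y j) \<otimes> y i))"
        unfolding sum_distrib_left sum.distrib[symmetric]
        by (intro sum.cong HOL.refl) (simp add: eq y)
      also have "Re \<dots> = t * Re (\<Sum>i<n. \<Sum>j<n. f1 (inv (y j) \<otimes> y i))
          + (1 - t) * Re (\<Sum>i<n. \<Sum>j<n. f2 (inv (y j) \<otimes> y i))"
        by simp
      also have "\<dots> \<ge> t * (real n * cmod (f1 k))\<^sup>2 + (1 - t) * (real n * cmod (f2 k))\<^sup>2"
        using positive_definite_variance[of f1 "{..<n}" y "f1 k"] K1_closed[OF f1] ya[OF _ f1]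
           positive_definite_variance[of f2 "{..<n}" y "f2 k"] K1_closed[OF f2] ya[OF _ f2] y t
        by (intro add_mono mult_left_mono) auto
      finally have "real n * (real n * b) \<le> real n * (n * a + (1 - a))"
        by (simp add: b_def power2_eq_square algebra_simps)
      then have "real n * b \<le> n * a + (1 - a)"
        using n by simp
      then show ?thesis by (simp add: algebra_simps)
    qed
    have "b \<le> a"
    proof (rule ccontr)
      assume "\<not> b \<le> a"
      then obtain n :: nat where "1 - a < n * (b - a)" using reals_Archimedean3[of "b - a"] by auto
      moreover from this have "n > 0" using bound[of 1] \<open>\<not> b \<le> a\<close> by (cases n) auto
      ultimately show False using bound[of n] by simp
    qed
    moreover have "b - a = t * (1 - t) * (cmod (f1 k - f2 k))\<^sup>2"
      unfolding a_def b_def eq[OF k] cmod_power2 by (simp add: power2_eq_square algebra_simps)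
    ultimately have "t * (1 - t) * (cmod (f1 k - f2 k))\<^sup>2 \<le> 0" by simp
    then show "f1 k = f2 k" using t by (simp add: mult_le_0_iff)
  qed
  have eqs: "f1 k = f k \<and> f2 k = f k"
    if "f1 k = f2 k" "f k = of_real t * f1 k + of_real (1 - t) * f2 k" for f1 f2 k and t :: real
    using that by (simp add: algebra_simps)
  show ?thesis
    unfolding E_char_def using f key eqs by blast
qed

lemma E_char_K1: "f \<in> E_char G \<Longrightarrow> f \<in> K1 G"
  unfolding E_char_def by blast

lemma E_charD:
  assumes "f \<in> E_char G" "f1 \<in> K1 G" "f2 \<in> K1 G" "0 < t" "t < 1"
    and "\<And>g. g \<in> carrier G \<Longrightarrow> f g = of_real t * f1 g + of_real (1 - t) * f2 g"
    and "g \<in> carrier G"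
  shows "f1 g = f g"
  using assms by (auto simp: E_char_def)

text \<open>For every \<open>c\<close> the limit of \<open>f ((1 + c u\<^sub>n)\<^sup>* g (1 + c u\<^sub>n))\<close> is positive definite in \<open>g\<close>, and a class function
  because \<open>\<phi>\<close> is one. The functions for \<open>c\<close> and \<open>- c\<close> add up to a multiple of \<open>f\<close>, so for extremal \<open>f\<close>
  each is a multiple of \<open>f\<close>. Comparing \<open>c = 1/2\<close> with \<open>c = \<i>/2\<close> separates \<open>\<phi>\<close> from the
  conjugate term.\<close>

lemma E_char_asymptotically_central:
  assumes f: "f \<in> E_char G" and u: "\<And>n. u n \<in> carrier G"
    and lim: "\<And>g. g \<in> carrier G \<Longrightarrow> \<forall>\<^sub>F n in sequentially. f (g \<otimes> u n) = \<phi> g"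
    and inv_lim: "\<And>a g. a \<in> carrier G \<Longrightarrow> g \<in> carrier G \<Longrightarrow> \<phi> (a \<otimes> g \<otimes> inv a) = \<phi> g"
    and g: "g \<in> carrier G"
  shows "\<phi> g = \<phi> \<one> * f g"
proof -
  have fK: "f \<in> K1 G" using f by (rule E_char_K1)
  note fK1 = K1_closed[OF fK]
  note finv = positive_definite_inv[OF fK1(1,2)]
  \<comment> \<open>The last term is the limit of \<open>f (inv (u n) \<otimes> g)\<close>.\<close>
  define \<psi> where "\<psi> c g = (1 + c * cnj c) * f g + c * \<phi> g + cnj c * cnj (\<phi> (inv g))" for c g
  have pd: "positive_definite G (\<psi> c)" for c
    unfolding positive_definite_def
  proof (intro allI impI, elim conjE)
    fix S :: "'a set" and a :: "'a \<Rightarrow> complex" assume S: "finite S" "S \<subseteq> carrier G"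
    \<comment> \<open>The form involves finitely many values, and one large \<open>n\<close> serves for all of them.\<close>
    have "\<forall>\<^sub>F n in sequentially. \<forall>x\<in>(\<lambda>(g, h). inv h \<otimes> g) ` (S \<times> S). f (x \<otimes> u n) = \<phi> x"
      by (rule eventually_ball_finite) (use S lim in \<open>auto simp: subset_iff\<close>)
    then obtain n where n: "\<And>g h. g \<in> S \<Longrightarrow> h \<in> S \<Longrightarrow> f (inv h \<otimes> g \<otimes> u n) = \<phi> (inv h \<otimes> g)"
      by (auto simp: eventually_sequentially)
    let ?x = "\<lambda>(g, b). if b then g \<otimes> u n else g" and ?c = "\<lambda>(g, b). if b then c * a g else a g"
    have "(\<Sum>p\<in>S\<times>UNIV. \<Sum>q\<in>S\<times>UNIV. ?c p * cnj (?c q) * f (inv (?x q) \<otimes> ?x p)) \<in> \<real>\<^sub>\<ge>\<^sub>0"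
      by (rule positive_definite_family[OF fK1(1)]) (use S u in auto)
    also have "(\<Sum>p\<in>S\<times>UNIV. \<Sum>q\<in>S\<times>UNIV. ?c p * cnj (?c q) * f (inv (?x q) \<otimes> ?x p))
       = (\<Sum>g\<in>S. \<Sum>b\<in>UNIV. \<Sum>h\<in>S. \<Sum>d\<in>UNIV.
            ?c (g, b) * cnj (?c (h, d)) * f (inv (?x (h, d)) \<otimes> ?x (g, b)))"
      by (simp only: sum.cartesian_product' case_prod_beta)
    also have "\<dots> = (\<Sum>g\<in>S. \<Sum>h\<in>S. \<Sum>b\<in>UNIV. \<Sum>d\<in>UNIV.
            ?c (g, b) * cnj (?c (h, d)) * f (inv (?x (h, d)) \<otimes> ?x (g, b)))"
      by (intro sum.cong HOL.refl sum.swap)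
    also have "\<dots> = (\<Sum>g\<in>S. \<Sum>h\<in>S. a g * cnj (a h) * \<psi> c (inv h \<otimes> g))"
    proof (intro sum.cong HOL.refl)
      fix g h assume gh: "g \<in> S" "h \<in> S"
      then have c: "g \<in> carrier G" "h \<in> carrier G" using S by auto
      have 1: "f (inv h \<otimes> (g \<otimes> u n)) = \<phi> (inv h \<otimes> g)"
        using n[OF gh] c u by (simp add: m_assoc)
      have 2: "f (inv (h \<otimes> u n) \<otimes> g) = cnj (\<phi> (inv (inv h \<otimes> g)))"
      proof -
        have "f (inv (inv g \<otimes> h \<otimes> u n)) = cnj (\<phi> (inv g \<otimes> h))"
          using n[OF gh(2,1)] c u by (simp add: finv)
        then show ?thesis using c u by (simp add: inv_mult_group m_assoc)
      qed
      have 3: "f (inv (h \<otimes> u n) \<otimes> (g \<otimes> u n)) = f (inv h \<otimes> g)"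
        using K1_comm[OF fK, of "inv (u n)" "inv h \<otimes> g \<otimes> u n"] c u
        by (simp add: inv_mult_group m_assoc)
      show "(\<Sum>b\<in>UNIV. \<Sum>d\<in>UNIV. ?c (g, b) * cnj (?c (h, d)) * f (inv (?x (h, d)) \<otimes> ?x (g, b)))
         = a g * cnj (a h) * \<psi> c (inv h \<otimes> g)"
        by (simp add: UNIV_bool 1 2 3 \<psi>_def algebra_simps)
    qed
    finally show "(\<Sum>g\<in>S. \<Sum>h\<in>S. a g * cnj (a h) * \<psi> c (inv h \<otimes> g)) \<in> \<real>\<^sub>\<ge>\<^sub>0" .
  qed
  have "\<forall>\<^sub>F n in sequentially. cmod (\<phi> \<one>) \<le> 1"
    using lim[OF one_closed] by eventually_elim
      (use u positive_definite_le_1[OF fK1(1,2)] in \<open>metis l_one\<close>)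
  then have \<phi>1: "cmod (\<phi> \<one>) \<le> 1" by simp
  \<comment> \<open>With a modulus below one the normalising factor \<open>T c\<close> stays positive.\<close>
  have main: "\<psi> c g = \<psi> c \<one> * f g" if c: "cmod c = 1/2" for c
  proof -
    have cc: "c * cnj c = 1/4"
      using complex_norm_square[of c] c by (simp add: power2_eq_square)
    define T where "T c = 5/4 + 2 * Re (c * \<phi> \<one>)" for c :: complex
    have T: "\<psi> c \<one> = of_real (T c)" and Tpos: "T c > 0" if "cmod c = 1/2" "c * cnj c = 1/4" for c
    proof -
      show "\<psi> c \<one> = of_real (T c)"
        by (simp add: \<psi>_def T_def that fK1 complex_eq_iff algebra_simps)
      have "\<bar>Re (c * \<phi> \<one>)\<bar> \<le> cmod c * cmod (\<phi> \<one>)"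
        using abs_Re_le_cmod[of "c * \<phi> \<one>"] by (simp add: norm_mult)
      also have "\<dots> \<le> 1/2 * 1" using \<phi>1 that by (intro mult_mono) auto
      finally show "T c > 0" unfolding T_def by linarith
    qed
    have inK: "(\<lambda>g. \<psi> c g / of_real (T c)) \<in> K1 G" if "cmod c = 1/2" "c * cnj c = 1/4" for c
    proof -
      have "positive_definite G (\<lambda>g. \<psi> c g / of_real (T c))"
        unfolding positive_definite_def
      proof (intro allI impI, elim conjE)
        fix S and a :: "'a \<Rightarrow> complex" assume "finite S" "S \<subseteq> carrier G"
        then have "(\<Sum>g\<in>S. \<Sum>h\<in>S. a g * cnj (a h) * \<psi> c (inv h \<otimes> g)) / of_real (T c) \<in> \<real>\<^sub>\<ge>\<^sub>0"
          using pd[of c] Tpos[OF that] by (intro nonneg_Reals_divide_I) (auto simp: positive_definite_def)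
        then show "(\<Sum>g\<in>S. \<Sum>h\<in>S. a g * cnj (a h) * (\<psi> c (inv h \<otimes> g) / of_real (T c))) \<in> \<real>\<^sub>\<ge>\<^sub>0"
          by (simp add: sum_divide_distrib)
      qed
      moreover have "\<psi> c (h \<otimes> g \<otimes> inv h) = \<psi> c g" if "g \<in> carrier G" "h \<in> carrier G" for g h
      proof -
        have "inv (h \<otimes> g \<otimes> inv h) = h \<otimes> inv g \<otimes> inv h"
          using that by (simp add: inv_mult_group m_assoc)
        then show ?thesis using that by (simp add: \<psi>_def inv_lim fK1)
      qed
      ultimately show ?thesis using T[OF that] Tpos[OF that] by (auto simp: K1_def)
    qed
    have c': "cmod (- c) = 1/2" "(- c) * cnj (- c) = 1/4" using c cc by simp_all
    define t where "t = T c / (5/2)"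
    have "T c + T (- c) = 5/2" by (simp add: T_def)
    then have t: "1 - t = T (- c) / (5/2)" "0 < t" "t < 1"
      using Tpos[OF c cc] Tpos[OF c'] by (auto simp: t_def field_simps)
    have comb: "f g = of_real t * (\<psi> c g / of_real (T c)) + of_real (1 - t) * (\<psi> (- c) g / of_real (T (- c)))" for g
    proof -
      have "\<psi> c g + \<psi> (- c) g = of_real (5/2) * f g"
        using cc by (simp add: \<psi>_def algebra_simps)
      then show ?thesis using Tpos[OF c cc] Tpos[OF c'] by (simp only: t(1)) (simp add: t_def field_simps)
    qed
    have "\<psi> c g / of_real (T c) = f g"
      by (rule E_charD[OF f inK[OF c cc] inK[OF c'] t(2,3) comb g])
    then show ?thesis using Tpos[OF c cc] T[OF c cc] by (simp add: field_simps)
  qed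
  have eq: "c * \<phi> g + cnj c * cnj (\<phi> (inv g)) = (c * \<phi> \<one> + cnj c * cnj (\<phi> \<one>)) * f g" if "cmod c = 1/2" for c
    using main[OF that] by (simp add: \<psi>_def fK1 algebra_simps)
  have half: "a = b" if "c * a = c * b" "c \<noteq> 0" for a b c :: complex
    using that by simp
  have "\<phi> g + cnj (\<phi> (inv g)) = (\<phi> \<one> + cnj (\<phi> \<one>)) * f g"
    by (rule half[of "1/2"]) (use eq[of "1/2"] in \<open>simp_all add: algebra_simps\<close>)
  note sum = this
  have "\<phi> g - cnj (\<phi> (inv g)) = (\<phi> \<one> - cnj (\<phi> \<one>)) * f g"
    by (rule half[of "\<i>/2"]) (use eq[of "\<i>/2"] in \<open>simp_all add: norm_divide algebra_simps\<close>)
  note diff = this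
  have "2 * \<phi> g = (\<phi> g + cnj (\<phi> (inv g))) + (\<phi> g - cnj (\<phi> (inv g)))" by simp
  also have "\<dots> = 2 * (\<phi> \<one> * f g)" unfolding sum diff by (simp add: algebra_simps)
  finally show ?thesis by simp
qed

end

section \<open>The generators and the parities of an element\<close>

text \<open>A generator and its formal inverse have the same weight, as the weights are taken modulo two.\<close>

definition weight :: "(gen \<Rightarrow> bit) \<Rightarrow> gen word \<Rightarrow> bit" where
  "weight \<phi> w = (\<Sum>x\<leftarrow>w. \<phi> (fst x))"

declare add_bit_eq_xor [simp del] mult_bit_eq_and [simp del]

lemma bit_add_self [simp]: "(a::bit) + a = 0"
  by (cases a) simp_all

lemma bit_conj [simp]: "a + b + a = (b :: bit)"
  by (cases a; cases b) simp_all

lemma bit_add_eq_0: "a + b = 0 \<longleftrightarrow> a = (b::bit)"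
  by (cases a; cases b) simp_all

lemma add_self_bit3 [simp]: "v + v = (0 :: bit \<times> bit \<times> bit)"
  by (cases v) (simp add: zero_prod_def)

lemma weight_pres_cong:
  assumes "pres_cong R u v" and "\<And>u v. R u v \<Longrightarrow> weight \<phi> u = weight \<phi> v"
  shows "weight \<phi> u = weight \<phi> v"
  using assms(1) by (induction rule: pres_cong.induct) (auto simp: assms(2)[unfolded weight_def] weight_def)

text \<open>Each further point is corrected by one transposition of two points that are not among the values already
  attained.\<close>

lemma permutes_extend:
  assumes "finite A" "A \<subseteq> C" "inj_on f A" "f ` A \<subseteq> C"
  shows "\<exists>p. p permutes C \<and> (\<forall>x\<in>A. p x = f x)"
  using assms
proof (induction A rule: finite_induct)
  case empty
  show ?case using permutes_id by blast
next
  case (insert x A)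
  then obtain p where p: "p permutes C" "\<And>y. y \<in> A \<Longrightarrow> p y = f y" by auto
  let ?q = "Transposition.transpose (p x) (f x) \<circ> p"
  have "?q permutes C"
    using p(1) insert.prems permutes_in_image[OF p(1), of x] by (intro permutes_compose permutes_swap_id) auto
  moreover have "?q y = f y" if "y \<in> insert x A" for y
  proof (cases "y = x")
    case False
    then have y: "y \<in> A" using that by simp
    have "f y \<noteq> f x" using insert.prems(2) insert.hyps y False by (auto simp: inj_on_def)
    moreover have "p y \<noteq> p x" using permutes_inj[OF p(1)] False by (auto dest: injD)
    ultimately show ?thesis using p(2)[OF y] by simp
  qed simp
  ultimately show ?case by blast
qed

text \<open>The group is a parameter of the locale so that products and inverses without index refer to it.\<close>

locale rep_group = group G for G :: "G'_elem monoid" (structure) +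
  fixes m :: nat
  assumes G_eq: "G = G'_inf m" and even_m: "even m" and m_pos: "m > 0"
begin

abbreviation "r i \<equiv> G'_gen m (Rg i)"
abbreviation "\<eta> j \<equiv> G'_gen m (Eta j)"

lemma m_gt_1: "m > 1"
  using even_m m_pos by (cases "m = 1") auto

lemma gen_closed [simp, intro]: "G'_gen m a \<in> carrier G"
  by (simp add: G_eq G'_inf_def presented_group_def G'_gen_def)

lemma word_class_eval: "word_class (G'_rel m) w = eval_word G (G'_gen m) w"
proof (induction w)
  case Nil
  show ?case by (simp add: G_eq G'_inf_def presented_group_def)
next
  case (Cons x w)
  obtain a b where x: "x = (a, b)" by (cases x)
  have split: "word_class (G'_rel m) (u @ v) = word_class (G'_rel m) u \<otimes> word_class (G'_rel m) v" for u v
    by (simp add: G_eq G'_inf_def mult_word_class)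
  have one: "word_class (G'_rel m) [] = \<one>"
    by (simp add: G_eq G'_inf_def presented_group_def)
  have "word_class (G'_rel m) [neg a] \<otimes> word_class (G'_rel m) [pos a] = \<one>"
    unfolding split[symmetric] one[symmetric] by (simp add: word_class_eq_iff pres_cong.cancel_left)
  moreover have "word_class (G'_rel m) [neg a] \<in> carrier G"
    by (simp add: G_eq G'_inf_def presented_group_def)
  ultimately have "word_class (G'_rel m) [neg a] = inv (G'_gen m a)"
    using inv_equality[OF _ gen_closed] by (simp add: G'_gen_def)
  then show ?case
    using split[of "[x]" w] Cons.IH by (cases b) (simp_all add: x G'_gen_def)
qed

lemma relation: "G'_rel m u v \<Longrightarrow> eval_word G (G'_gen m) u = eval_word G (G'_gen m) v"
  unfolding word_class_eval[symmetric] word_class_eq_iff by (rule pres_cong.rel)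

lemma carrier_induct [consumes 1, case_names one gen inv]:
  assumes "g \<in> carrier G" and "P \<one>"
    and "\<And>g a. g \<in> carrier G \<Longrightarrow> P g \<Longrightarrow> P (g \<otimes> G'_gen m a)"
    and "\<And>g a. g \<in> carrier G \<Longrightarrow> P g \<Longrightarrow> P (g \<otimes> inv (G'_gen m a))"
  shows "P g"
proof -
  obtain w where g: "g = eval_word G (G'_gen m) w"
    using assms(1) unfolding word_class_eval[symmetric]
    by (auto simp: G_eq G'_inf_def presented_group_def)
  show ?thesis unfolding g
  proof (induction w rule: rev_induct)
    case (snoc x w)
    obtain a b where x: "x = (a, b)" by (cases x)
    show ?case using snoc assms(3,4)[OF eval_word_closed[OF gen_closed]]
      by (cases b) (simp_all add: x eval_word_append)
  qed (simp add: assms(2))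
qed

lemma r_square [simp]: "r i \<otimes> r i = \<one>"
  using relation[OF G'_rel.r_square] by simp

lemma r_inv [simp]: "inv (r i) = r i"
  by (rule inv_equality) auto

lemma z_comm:
  assumes z: "z \<in> {Z1, Z2, Z3}" and g: "g \<in> carrier G"
  shows "G'_gen m z \<otimes> g = g \<otimes> G'_gen m z"
proof -
  have za: "G'_gen m z \<otimes> G'_gen m a = G'_gen m a \<otimes> G'_gen m z" for a
    using relation[OF G'_rel.z_central[OF z]] by simp
  have zi: "G'_gen m z \<otimes> inv (G'_gen m a) = inv (G'_gen m a) \<otimes> G'_gen m z" for a
  proof -
    have "inv (G'_gen m a) \<otimes> (G'_gen m a \<otimes> G'_gen m z) \<otimes> inv (G'_gen m a) = G'_gen m z \<otimes> inv (G'_gen m a)"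
      by (simp add: m_assoc[symmetric])
    moreover have "inv (G'_gen m a) \<otimes> (G'_gen m z \<otimes> G'_gen m a) \<otimes> inv (G'_gen m a) = inv (G'_gen m a) \<otimes> G'_gen m z"
      by (simp add: m_assoc)
    ultimately show ?thesis by (simp only: za)
  qed
  have step: "G'_gen m z \<otimes> (g \<otimes> x) = g \<otimes> x \<otimes> G'_gen m z"
    if "g \<in> carrier G" "x \<in> carrier G" "G'_gen m z \<otimes> g = g \<otimes> G'_gen m z"
      "G'_gen m z \<otimes> x = x \<otimes> G'_gen m z" for g x
    using that by (metis gen_closed m_assoc)
  show ?thesis
    using g by (induction rule: carrier_induct) (simp, (rule step; simp add: za zi)+)
qed

lemma z_square: "z \<in> {Z1, Z2, Z3} \<Longrightarrow> G'_gen m z \<otimes> G'_gen m z = \<one>"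
  using relation[OF G'_rel.z_square] by simp

text \<open>Indexing the elements of \<open>Z\<close> by exponent vectors over the field with two elements turns all computations with
  signs into additions of such vectors.\<close>

definition \<zeta> :: "bit \<times> bit \<times> bit \<Rightarrow> G'_elem" where
  "\<zeta> = (\<lambda>(a, b, c). (if a = 1 then G'_gen m Z1 else \<one>) \<otimes>
     ((if b = 1 then G'_gen m Z2 else \<one>) \<otimes> (if c = 1 then G'_gen m Z3 else \<one>)))"

lemma \<zeta>_closed [simp, intro]: "\<zeta> v \<in> carrier G"
  by (cases v) (auto simp: \<zeta>_def)

lemma \<zeta>_comm: "g \<in> carrier G \<Longrightarrow> g \<otimes> \<zeta> v = \<zeta> v \<otimes> g"
proof -
  assume g: "g \<in> carrier G"
  have z: "g \<otimes> x = x \<otimes> g" if "x \<in> {\<one>, G'_gen m Z1, G'_gen m Z2, G'_gen m Z3}" for x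
    using that g by (elim insertE emptyE) (simp_all add: z_comm[OF _ g])
  have cl: "x \<in> carrier G" if "x \<in> {\<one>, G'_gen m Z1, G'_gen m Z2, G'_gen m Z3}" for x
    using that by auto
  have "g \<otimes> (x \<otimes> (y \<otimes> w)) = x \<otimes> (y \<otimes> w) \<otimes> g"
    if "x \<in> {\<one>, G'_gen m Z1, G'_gen m Z2, G'_gen m Z3}"
       "y \<in> {\<one>, G'_gen m Z1, G'_gen m Z2, G'_gen m Z3}"
       "w \<in> {\<one>, G'_gen m Z1, G'_gen m Z2, G'_gen m Z3}" for x y w
  proof -
    have "g \<otimes> (x \<otimes> (y \<otimes> w)) = x \<otimes> (g \<otimes> (y \<otimes> w))"
      using z[OF that(1)] cl[OF that(1)] cl[OF that(2)] cl[OF that(3)] g by (simp add: m_assoc[symmetric])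
    also have "g \<otimes> (y \<otimes> w) = y \<otimes> (g \<otimes> w)"
      using z[OF that(2)] cl[OF that(2)] cl[OF that(3)] g by (simp add: m_assoc[symmetric])
    also have "g \<otimes> w = w \<otimes> g" by (rule z[OF that(3)])
    finally show ?thesis
      using cl[OF that(1)] cl[OF that(2)] cl[OF that(3)] g by (simp add: m_assoc)
  qed
  then show ?thesis unfolding \<zeta>_def by (cases v) simp
qed

lemma \<zeta>_lcomm: "g \<in> carrier G \<Longrightarrow> h \<in> carrier G \<Longrightarrow> g \<otimes> (\<zeta> v \<otimes> h) = \<zeta> v \<otimes> (g \<otimes> h)"
  using \<zeta>_comm[of g v] by (simp add: m_assoc[symmetric])

lemma \<zeta>_0 [simp]: "\<zeta> 0 = \<one>"
  by (simp add: \<zeta>_def zero_prod_def)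

lemma \<zeta>_gens: "\<zeta> (1, 0, 0) = G'_gen m Z1" "\<zeta> (0, 1, 0) = G'_gen m Z2" "\<zeta> (0, 0, 1) = G'_gen m Z3"
  by (simp_all add: \<zeta>_def)

lemma \<zeta>_add: "\<zeta> u \<otimes> \<zeta> v = \<zeta> (u + v)"
proof -
  let ?z1 = "G'_gen m Z1" and ?z2 = "G'_gen m Z2" and ?z3 = "G'_gen m Z3"
  have c: "?z2 \<otimes> ?z1 = ?z1 \<otimes> ?z2" "?z3 \<otimes> ?z1 = ?z1 \<otimes> ?z3" "?z3 \<otimes> ?z2 = ?z2 \<otimes> ?z3"
    by (rule z_comm; simp)+
  have s: "?z1 \<otimes> ?z1 = \<one>" "?z2 \<otimes> ?z2 = \<one>" "?z3 \<otimes> ?z3 = \<one>"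
    by (rule z_square; simp)+
  have l: "?z2 \<otimes> (?z1 \<otimes> x) = ?z1 \<otimes> (?z2 \<otimes> x)" "?z3 \<otimes> (?z1 \<otimes> x) = ?z1 \<otimes> (?z3 \<otimes> x)"
    "?z3 \<otimes> (?z2 \<otimes> x) = ?z2 \<otimes> (?z3 \<otimes> x)" "?z1 \<otimes> (?z1 \<otimes> x) = x" "?z2 \<otimes> (?z2 \<otimes> x) = x"
    "?z3 \<otimes> (?z3 \<otimes> x) = x" if "x \<in> carrier G" for x
    using that by (simp_all add: m_assoc[symmetric] c s)
  obtain a b c' where u: "u = (a, b, c')" by (cases u)
  obtain a' b' c'' where v: "v = (a', b', c'')" by (cases v)
  show ?thesis
    unfolding u v \<zeta>_def
    by (cases a; cases b; cases c'; cases a'; cases b'; cases c'') (simp_all add: m_assoc c s l zero_prod_def)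
qed

lemma \<zeta>_add_left: "g \<in> carrier G \<Longrightarrow> \<zeta> u \<otimes> (\<zeta> v \<otimes> g) = \<zeta> (u + v) \<otimes> g"
  by (simp add: m_assoc[symmetric] \<zeta>_add)

lemma r_comm: "i + 2 \<le> j \<or> j + 2 \<le> i \<Longrightarrow> r i \<otimes> r j = \<zeta> (1,0,0) \<otimes> (r j \<otimes> r i)"
  using relation[OF G'_rel.r_comm[of i j m]] by (simp add: \<zeta>_gens)

lemma eta_comm: "j \<noteq> k \<Longrightarrow> \<eta> j \<otimes> \<eta> k = \<zeta> (0,1,0) \<otimes> (\<eta> k \<otimes> \<eta> j)"
  using relation[OF G'_rel.eta_comm[of j k m]] by (simp add: \<zeta>_gens)

lemma r_eta: "r i \<otimes> \<eta> j = \<zeta> (0,0,1) \<otimes> (\<eta> (Transposition.transpose i (Suc i) j) \<otimes> r i)"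
proof -
  have "r i \<otimes> (\<eta> j \<otimes> r i) = \<zeta> (0,0,1) \<otimes> \<eta> (Transposition.transpose i (Suc i) j)"
    using relation[OF G'_rel.r_eta[of m i j]] by (simp add: \<zeta>_gens)
  then have "r i \<otimes> (\<eta> j \<otimes> r i) \<otimes> r i = \<zeta> (0,0,1) \<otimes> \<eta> (Transposition.transpose i (Suc i) j) \<otimes> r i"
    by simp
  then show ?thesis by (simp add: m_assoc)
qed

lemma r_braid: "r (Suc i) \<otimes> (r i \<otimes> r (Suc i)) = r i \<otimes> (r (Suc i) \<otimes> r i)"
proof -
  have "r i \<otimes> (r (Suc i) \<otimes> (r i \<otimes> (r (Suc i) \<otimes> (r i \<otimes> r (Suc i))))) = \<one>"
    using relation[OF G'_rel.r_braid[of m i]] by simp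
  then have "r i \<otimes> (r (Suc i) \<otimes> r i) = inv (r (Suc i) \<otimes> (r i \<otimes> r (Suc i)))"
    by (intro inv_equality[symmetric]) (auto simp: m_assoc)
  also have "\<dots> = r (Suc i) \<otimes> (r i \<otimes> r (Suc i))"
    by (simp add: inv_mult_group m_assoc)
  finally show ?thesis ..
qed

lemma eta_pow_m: "\<eta> j [^] m = \<one>"
proof -
  have "eval_word G (G'_gen m) (replicate n (pos (Eta j))) = \<eta> j [^] n" for n
    by (induction n) (simp, simp add: nat_pow_Suc2[symmetric] del: nat_pow_Suc)
  then show ?thesis using relation[OF G'_rel.eta_power[of m j]] by simp
qed

lemma eta_inv: "inv (\<eta> j) = \<eta> j [^] (m - 1)"
proof (rule inv_equality)
  show "\<eta> j [^] (m - 1) \<otimes> \<eta> j = \<one>"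
    using eta_pow_m[of j] m_pos nat_pow_Suc[of "\<eta> j" "m - 1"] by simp
qed auto

fun r_weight :: "gen \<Rightarrow> bit" where
  "r_weight (Rg i) = 1" | "r_weight _ = 0"

fun eta_weight :: "gen \<Rightarrow> bit" where
  "eta_weight (Eta i) = 1" | "eta_weight _ = 0"

text \<open>The parities of the numbers of letters \<open>r i\<close> and \<open>\<eta> j\<close>. They do not depend on the word chosen in the
  class (\<open>par_word_class\<close>), since every defining relation preserves them; for \<open>eta_power\<close> this is the evenness
  of \<open>m\<close>.\<close>

definition lpar :: "G'_elem \<Rightarrow> bit" where "lpar g = weight r_weight (SOME w. w \<in> g)"
definition opar :: "G'_elem \<Rightarrow> bit" where "opar g = weight eta_weight (SOME w. w \<in> g)"

lemma weight_replicate: "even n \<Longrightarrow> weight \<phi> (replicate n x) = 0"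
proof -
  assume "even n"
  then obtain k where n: "n = k + k" by (auto elim: evenE simp: mult_2)
  have "weight \<phi> (replicate (k + k) x) = weight \<phi> (replicate k x) + weight \<phi> (replicate k x)"
    unfolding replicate_add weight_def by simp
  then show ?thesis by (simp add: n)
qed

lemma weight_relation:
  assumes "\<phi> = r_weight \<or> \<phi> = eta_weight" "G'_rel m u v"
  shows "weight \<phi> u = weight \<phi> v"
  using assms(2)
proof cases
  case (eta_power j)
  then show ?thesis using weight_replicate[OF even_m] by (simp add: weight_def)
qed (use assms(1) in \<open>auto simp: weight_def add.commute\<close>)

lemma par_word_class:
  "lpar (word_class (G'_rel m) w) = weight r_weight w"
  "opar (word_class (G'_rel m) w) = weight eta_weight w"
proof -
  have "(SOME v. v \<in> word_class (G'_rel m) w) \<in> word_class (G'_rel m) w"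
    by (rule someI[of _ w]) (simp add: word_class_def pres_cong.refl)
  then have "pres_cong (G'_rel m) w (SOME v. v \<in> word_class (G'_rel m) w)"
    by (simp add: word_class_def)
  then show "lpar (word_class (G'_rel m) w) = weight r_weight w"
    "opar (word_class (G'_rel m) w) = weight eta_weight w"
    unfolding lpar_def opar_def using weight_pres_cong weight_relation by metis+
qed

lemma par_mult [simp]:
  assumes "g \<in> carrier G" "h \<in> carrier G"
  shows "lpar (g \<otimes> h) = lpar g + lpar h" "opar (g \<otimes> h) = opar g + opar h"
proof -
  obtain u v where "g = word_class (G'_rel m) u" "h = word_class (G'_rel m) v"
    using assms by (auto simp: G_eq G'_inf_def presented_group_def)
  then show "lpar (g \<otimes> h) = lpar g + lpar h" "opar (g \<otimes> h) = opar g + opar h"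
    by (simp_all add: G_eq G'_inf_def mult_word_class par_word_class) (simp_all add: weight_def)
qed

lemma par_one [simp]: "lpar \<one> = 0" "opar \<one> = 0"
  using par_word_class[of "[]"] by (simp_all add: word_class_eval weight_def)

lemma par_gen [simp]: "lpar (G'_gen m a) = r_weight a" "opar (G'_gen m a) = eta_weight a"
  unfolding G'_gen_def par_word_class by (simp_all add: weight_def)

lemma par_inv [simp]:
  assumes "g \<in> carrier G"
  shows "lpar (inv g) = lpar g" "opar (inv g) = opar g"
  using par_mult[of "inv g" g, symmetric] assms by (auto simp only: l_inv par_one bit_add_eq_0 inv_closed)

lemma par_\<zeta> [simp]: "lpar (\<zeta> v) = 0" "opar (\<zeta> v) = 0"
  by (cases v; simp add: \<zeta>_def)+

section \<open>The projection to the wreath product\<close>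

abbreviation perm_of :: "G'_elem \<Rightarrow> nat \<Rightarrow> nat" where "perm_of g \<equiv> snd (Phi m g)"
abbreviation diag_of :: "G'_elem \<Rightarrow> nat \<Rightarrow> int" where "diag_of g \<equiv> fst (Phi m g)"

lemma Phi_closed: "g \<in> carrier G \<Longrightarrow> Phi m g \<in> carrier (G_inf m)"
  using Phi_hom[OF m_gt_1] by (simp add: G_eq hom_def Pi_def)

lemma Phi_mult: "g \<in> carrier G \<Longrightarrow> h \<in> carrier G \<Longrightarrow> Phi m (g \<otimes> h) = Phi m g \<otimes>\<^bsub>G_inf m\<^esub> Phi m h"
  using Phi_hom[OF m_gt_1] by (simp add: G_eq hom_def)

lemma perm_permutation: "g \<in> carrier G \<Longrightarrow> permutation (perm_of g)"
  using Phi_closed[of g] by (auto simp: G_inf_def)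

lemma perm_bij: "g \<in> carrier G \<Longrightarrow> bij (perm_of g)"
  using perm_permutation by (simp add: permutation)

lemma diag_range: "g \<in> carrier G \<Longrightarrow> 0 \<le> diag_of g j \<and> diag_of g j < int m"
proof -
  assume "g \<in> carrier G"
  then have "diag_of g \<in> carrier (D_inf m)" using Phi_closed[of g] by (auto simp: G_inf_def)
  then have "diag_of g j \<in> carrier (integer_mod_group m)" unfolding carrier_D_inf by blast
  then show ?thesis using m_pos by (simp add: carrier_integer_mod_group)
qed

lemma diag_mod [simp]: "g \<in> carrier G \<Longrightarrow> diag_of g j mod int m = diag_of g j"
  using diag_range by simp

lemma perm_mult [simp]: "g \<in> carrier G \<Longrightarrow> h \<in> carrier G \<Longrightarrow> perm_of (g \<otimes> h) = perm_of g \<circ> perm_of h"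
  by (simp add: Phi_mult G_inf_def case_prod_beta)

lemma diag_mult:
  "g \<in> carrier G \<Longrightarrow> h \<in> carrier G \<Longrightarrow>
    diag_of (g \<otimes> h) j = (diag_of g j + diag_of h (inv_into UNIV (perm_of g) j)) mod int m"
  by (simp add: Phi_mult G_inf_def case_prod_beta)

lemma diag_mult_perm:
  "g \<in> carrier G \<Longrightarrow> h \<in> carrier G \<Longrightarrow>
    diag_of (g \<otimes> h) (perm_of g i) = (diag_of g (perm_of g i) + diag_of h i) mod int m"
  using perm_bij[of g] by (simp add: diag_mult bij_is_inj inv_f_f)

lemma Phi_gens: "Phi m (G'_gen m a) = Phi_gen m a"
  unfolding G'_gen_def Phi_word_class[OF m_gt_1]
  using Phi_gen_closed[OF m_gt_1, of a] group.is_monoid[OF group_G_inf] by (simp add: monoid.r_one)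

lemma perm_r [simp]: "perm_of (r i) = Transposition.transpose i (Suc i)" "diag_of (r i) j = 0"
  by (simp_all add: Phi_gens s_gen_def)

lemma perm_eta [simp]: "perm_of (\<eta> i) = id" "diag_of (\<eta> i) j = (if j = i then 1 else 0)"
  by (simp_all add: Phi_gens y_gen_def)

lemma Phi_one [simp]: "perm_of \<one> = id" "diag_of \<one> j = 0"
  using Phi_word_class[OF m_gt_1, of "[]"] by (simp_all add: word_class_eval G_inf_def)

lemma Phi_\<zeta> [simp]: "perm_of (\<zeta> v) = id" "diag_of (\<zeta> v) j = 0"
proof -
  have "perm_of (if a then G'_gen m z else \<one>) = id \<and> (\<forall>j. diag_of (if a then G'_gen m z else \<one>) j = 0)"
    if "z \<in> {Z1, Z2, Z3}" for a z
    using that Phi_gens[of z] by (auto simp: G_inf_def)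
  then show "perm_of (\<zeta> v) = id" "diag_of (\<zeta> v) j = 0"
    by (cases v; force simp: \<zeta>_def diag_mult simp del: if_split)+
qed

lemma perm_inv:
  assumes "g \<in> carrier G"
  shows "perm_of (inv g) = inv_into UNIV (perm_of g)"
proof (rule inv_unique_comp[symmetric])
  show "perm_of g \<circ> perm_of (inv g) = id" "perm_of (inv g) \<circ> perm_of g = id"
    using assms by (simp_all add: perm_mult[symmetric] del: perm_mult)
qed

lemma supp_iff: "j \<notin> supp m g \<longleftrightarrow> perm_of g j = j \<and> diag_of g j = 0"
  by (auto simp: supp_def supp_G_def case_prod_beta)

lemma in_supp: "j \<in> supp m g \<longleftrightarrow> perm_of g j \<noteq> j \<or> diag_of g j \<noteq> 0"
  using supp_iff[of j g] by blast

lemma supp_finite: "g \<in> carrier G \<Longrightarrow> finite (supp m g)"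
proof -
  assume g: "g \<in> carrier G"
  then have "diag_of g \<in> carrier (D_inf m)" using Phi_closed[of g] by (auto simp: G_inf_def)
  then have "finite {j. diag_of g j \<noteq> 0}" unfolding carrier_D_inf by blast
  moreover have "finite {j. perm_of g j \<noteq> j}" using perm_permutation[OF g] by (simp add: permutation)
  moreover have "supp m g = {j. diag_of g j \<noteq> 0} \<union> {j. perm_of g j \<noteq> j}"
    by (auto simp: supp_def supp_G_def case_prod_beta)
  ultimately show ?thesis by simp
qed

lemma supp_mult: "g \<in> carrier G \<Longrightarrow> h \<in> carrier G \<Longrightarrow> supp m (g \<otimes> h) \<subseteq> supp m g \<union> supp m h"
proof (rule subsetI, rule ccontr)
  fix j assume *: "g \<in> carrier G" "h \<in> carrier G" "j \<in> supp m (g \<otimes> h)" "j \<notin> supp m g \<union> supp m h"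
  then have "perm_of g j = j" "diag_of g j = 0" "perm_of h j = j" "diag_of h j = 0" by (auto simp: supp_iff)
  then have "j \<notin> supp m (g \<otimes> h)"
    using diag_mult_perm[OF *(1,2), of j] *(1,2) by (intro iffD2[OF supp_iff]) simp
  then show False using * by simp
qed

lemma supp_inv:
  assumes g: "g \<in> carrier G"
  shows "supp m (inv g) \<subseteq> supp m g"
proof
  fix j assume j: "j \<in> supp m (inv g)"
  show "j \<in> supp m g"
  proof (rule ccontr)
    assume "j \<notin> supp m g"
    then have p: "perm_of g j = j" "diag_of g j = 0" by (simp_all add: supp_iff)
    have q: "perm_of (inv g) j = j"
      unfolding perm_inv[OF g] using inv_f_f[OF bij_is_inj[OF perm_bij[OF g]], of j] p by simp
    have "diag_of (inv g) j = 0"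
      using diag_mult_perm[OF inv_closed[OF g] g, of j] g p q by simp
    then show False using j q by (simp add: in_supp)
  qed
qed

text \<open>Evaluating \<open>(x \<otimes> g \<otimes> inv x) \<otimes> x = x \<otimes> g\<close> at a point fixed by \<open>g\<close> avoids the formula for the diagonal part
  of an inverse.\<close>

lemma supp_conj:
  assumes x: "x \<in> carrier G" and g: "g \<in> carrier G"
  shows "supp m (x \<otimes> g \<otimes> inv x) \<subseteq> perm_of x ` supp m g"
proof (rule subsetI, rule ccontr)
  fix j assume *: "j \<in> supp m (x \<otimes> g \<otimes> inv x)" "j \<notin> perm_of x ` supp m g"
  obtain i where i: "j = perm_of x i" using perm_bij[OF x] by (metis bij_pointE)
  then have "i \<notin> supp m g" using * by blast
  then have "perm_of g i = i" "diag_of g i = 0" by (simp_all add: supp_iff)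
  define y where "y = x \<otimes> g \<otimes> inv x"
  have y: "y \<in> carrier G" "y \<otimes> x = x \<otimes> g" using x g by (simp_all add: y_def m_assoc)
  have "perm_of (y \<otimes> x) i = perm_of (x \<otimes> g) i" by (simp only: y(2))
  then have pj: "perm_of y j = j" using x g y(1) \<open>perm_of g i = i\<close> by (simp add: i)
  have "diag_of (y \<otimes> x) (perm_of y j) = diag_of (x \<otimes> g) (perm_of x i)"
    by (simp add: y(2) pj i[symmetric])
  then have "(diag_of y j + diag_of x j) mod int m = diag_of x j mod int m"
    using x g y(1) pj \<open>diag_of g i = 0\<close> by (simp add: diag_mult_perm i)
  then have "diag_of y j mod int m = 0"
    by (metis add_diff_cancel_right' mod_0 mod_diff_cong diff_self)
  then show False using * pj y(1) supp_iff[of j y] by (simp add: y_def[symmetric])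
qed

section \<open>The kernel of the projection\<close>

text \<open>Equality up to a factor in \<open>Z\<close>. The signs are irrelevant for the kernel of the projection, and the
  enumeration of cosets below becomes that of the wreath product.\<close>

definition eqz :: "G'_elem \<Rightarrow> G'_elem \<Rightarrow> bool" (infix \<open>\<asymp>\<close> 50) where
  "x \<asymp> y \<longleftrightarrow> (\<exists>v. x = \<zeta> v \<otimes> y)"

lemma eqzI: "x = \<zeta> v \<otimes> y \<Longrightarrow> x \<asymp> y"
  by (auto simp only: eqz_def)

lemma eqz_refl: "x \<in> carrier G \<Longrightarrow> x \<asymp> x"
  by (rule eqzI[of _ 0]) simp

lemma eqz_trans [trans]: "x \<asymp> y \<Longrightarrow> y \<asymp> w \<Longrightarrow> w \<in> carrier G \<Longrightarrow> x \<asymp> w"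
  unfolding eqz_def using \<zeta>_add_left by metis

lemma eqz_sym: "x \<asymp> y \<Longrightarrow> y \<in> carrier G \<Longrightarrow> y \<asymp> x"
  unfolding eqz_def using \<zeta>_add_left add_self_bit3 \<zeta>_0 l_one by metis

lemma eqz_mult:
  assumes "x \<asymp> y" "x' \<asymp> y'" "y \<in> carrier G" "y' \<in> carrier G"
  shows "x \<otimes> x' \<asymp> y \<otimes> y'"
proof -
  obtain u v where "x = \<zeta> u \<otimes> y" "x' = \<zeta> v \<otimes> y'" using assms(1,2) by (auto simp only: eqz_def)
  then have "x \<otimes> x' = \<zeta> (u + v) \<otimes> (y \<otimes> y')"
    using assms(3,4) by (simp add: m_assoc \<zeta>_lcomm[of y y'] \<zeta>_add_left)
  then show ?thesis by (rule eqzI)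
qed

lemma gen_eta: "G'_gen m a \<otimes> \<eta> i \<asymp> \<eta> (perm_of (G'_gen m a) i) \<otimes> G'_gen m a"
proof (cases a)
  case (Rg k)
  show ?thesis unfolding Rg perm_r by (rule eqzI[OF r_eta])
next
  case (Eta j)
  show ?thesis
  proof (cases "j = i")
    case True
    then show ?thesis unfolding Eta by (simp add: eqz_refl)
  next
    case False
    then show ?thesis unfolding Eta perm_eta id_apply by (rule eqzI[OF eta_comm])
  qed
qed (simp_all add: z_comm Phi_gens G_inf_def eqz_refl)

text \<open>The induction is over words, so the inverse of a generator needs a separate case: there the relation for the
  generator is applied at the preimage \<open>k\<close> of \<open>i\<close>.\<close>

lemma eta_conj: "g \<in> carrier G \<Longrightarrow> g \<otimes> \<eta> i \<asymp> \<eta> (perm_of g i) \<otimes> g"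
proof (induction arbitrary: i rule: carrier_induct)
  case one
  show ?case by (simp add: eqz_refl)
next
  case (gen g a)
  have "g \<otimes> G'_gen m a \<otimes> \<eta> i = g \<otimes> (G'_gen m a \<otimes> \<eta> i)" using gen by (simp add: m_assoc)
  also have "\<dots> \<asymp> g \<otimes> (\<eta> (perm_of (G'_gen m a) i) \<otimes> G'_gen m a)"
    using gen by (intro eqz_mult gen_eta eqz_refl) auto
  also have "\<dots> = g \<otimes> \<eta> (perm_of (G'_gen m a) i) \<otimes> G'_gen m a" using gen by (simp add: m_assoc)
  also have "\<dots> \<asymp> \<eta> (perm_of g (perm_of (G'_gen m a) i)) \<otimes> g \<otimes> G'_gen m a"
    using gen by (intro eqz_mult gen.IH eqz_refl) auto
  finally show ?case using gen by (simp add: m_assoc)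
next
  case (inv g a)
  define x where "x = G'_gen m a"
  have x: "x \<in> carrier G" by (simp add: x_def)
  define k where "k = perm_of (inv x) i"
  have i: "i = perm_of x k"
    using x by (simp add: k_def perm_inv bij_is_surj perm_bij surj_f_inv_f)
  have comm: "x \<otimes> \<eta> k \<asymp> \<eta> i \<otimes> x"
    using gen_eta[of a k] by (simp only: i x_def)
  have "inv x \<otimes> \<eta> i = inv x \<otimes> (\<eta> i \<otimes> x) \<otimes> inv x" using x by (simp add: m_assoc)
  also have "\<dots> \<asymp> inv x \<otimes> (x \<otimes> \<eta> k) \<otimes> inv x"
    using x by (intro eqz_mult eqz_refl eqz_sym[OF comm]) auto
  also have "\<dots> = \<eta> k \<otimes> inv x" using x by (simp add: m_assoc[symmetric])
  finally have comm': "inv x \<otimes> \<eta> i \<asymp> \<eta> k \<otimes> inv x" using x by simp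
  have "g \<otimes> inv x \<otimes> \<eta> i = g \<otimes> (inv x \<otimes> \<eta> i)" using inv x by (simp add: m_assoc)
  also have "\<dots> \<asymp> g \<otimes> (\<eta> k \<otimes> inv x)"
    using inv x by (intro eqz_mult comm' eqz_refl) auto
  also have "\<dots> = g \<otimes> \<eta> k \<otimes> inv x" using inv x by (simp add: m_assoc)
  also have "\<dots> \<asymp> \<eta> (perm_of g k) \<otimes> g \<otimes> inv x"
    using inv x by (intro eqz_mult inv.IH eqz_refl) auto
  finally show ?case using inv x by (simp add: m_assoc k_def x_def[symmetric])
qed

text \<open>The subgroup generated by \<open>Z\<close> and the generators that move only points below \<open>N\<close>. The inverses of the generators
  are positive powers of them, so closure under right multiplication by generators is enough.\<close>

inductive_set std :: "nat \<Rightarrow> G'_elem set" for N where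
  one: "\<one> \<in> std N"
| zeta: "x \<in> std N \<Longrightarrow> x \<otimes> \<zeta> v \<in> std N"
| r: "x \<in> std N \<Longrightarrow> Suc i < N \<Longrightarrow> x \<otimes> r i \<in> std N"
| eta: "x \<in> std N \<Longrightarrow> j < N \<Longrightarrow> x \<otimes> \<eta> j \<in> std N"

lemma std_closed: "x \<in> std N \<Longrightarrow> x \<in> carrier G"
  by (induction rule: std.induct) auto

lemma std_mono: "x \<in> std N \<Longrightarrow> N \<le> N' \<Longrightarrow> x \<in> std N'"
  by (induction rule: std.induct) (auto intro: std.intros)

lemma std_exhausts: "g \<in> carrier G \<Longrightarrow> \<exists>N. g \<in> std N"
proof (induction rule: carrier_induct)
  case one
  show ?case by (rule exI, rule std.one)
next
  case (gen g a)
  then obtain N where N: "g \<in> std N" by blast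
  show ?case
  proof (cases a)
    case (Rg i)
    show ?thesis unfolding Rg by (rule exI, rule std.r[OF std_mono[OF N, of "N + i + 2"]]) simp_all
  next
    case (Eta j)
    show ?thesis unfolding Eta by (rule exI, rule std.eta[OF std_mono[OF N, of "N + j + 1"]]) simp_all
  qed (simp_all only: \<zeta>_gens[symmetric], (rule exI, rule std.zeta[OF N])+)
next
  case (inv g a)
  then obtain N where N: "g \<in> std N" by blast
  have z: "inv (\<zeta> v) = \<zeta> v" for v
    by (rule inv_equality) (simp_all add: \<zeta>_add)
  show ?case
  proof (cases a)
    case (Rg i)
    show ?thesis unfolding Rg r_inv
      by (rule exI, rule std.r[OF std_mono[OF N, of "N + i + 2"]]) simp_all
  next
    case (Eta j)
    have "g \<otimes> \<eta> j [^] n \<in> std (N + j + 1)" for n :: nat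
    proof (induction n)
      case 0
      show ?case using std_mono[OF N, of "N + j + 1"] inv by simp
    next
      case (Suc n)
      then show ?case using std.eta[OF Suc, of j] inv by (simp add: m_assoc)
    qed
    then show ?thesis unfolding Eta eta_inv by (rule exI)
  qed (simp_all only: \<zeta>_gens[symmetric] z, (rule exI, rule std.zeta[OF N])+)
qed

lemma supp_std: "x \<in> std N \<Longrightarrow> N \<le> j \<Longrightarrow> perm_of x j = j \<and> diag_of x j = 0"
proof (induction rule: std.induct)
  case (zeta x v)
  then show ?case using diag_mult_perm[of x "\<zeta> v" j] std_closed by simp
next
  case (r x i)
  then show ?case using diag_mult_perm[of x "r i" j] std_closed by simp
next
  case (eta x i)
  then show ?case using diag_mult_perm[of x "\<eta> i" j] std_closed by simp
qed simp

text \<open>The product \<open>r (j + l - 1) \<dots> r j\<close>, a lift of the cycle that takes \<open>j\<close> to \<open>j + l\<close> and moves the points in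
  between down by one. These lifts for \<open>j + l = N\<close> represent the cosets of the permutations fixing \<open>N\<close>.\<close>

fun cyc :: "nat \<Rightarrow> nat \<Rightarrow> G'_elem" where
  "cyc j 0 = \<one>"
| "cyc j (Suc l) = r (j + l) \<otimes> cyc j l"

lemma cyc_closed [simp]: "cyc j l \<in> carrier G"
  by (induction l) auto

lemma perm_cyc: "perm_of (cyc j l) j = j + l"
  by (induction l) auto

lemma perm_cyc_le: "i \<le> j + l \<Longrightarrow> perm_of (cyc j l) i \<le> j + l"
proof (induction l arbitrary: i)
  case (Suc l)
  show ?case
  proof (cases "i \<le> j + l")
    case True
    then show ?thesis using Suc.IH[OF True] by (auto simp: Transposition.transpose_def)
  next
    case False
    then have i: "i = Suc (j + l)" using Suc by simp
    have "perm_of (cyc j l') i' = i'" if "j + l' < i'" for l' i'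
      using that by (induction l') auto
    then show ?thesis by (simp add: i)
  qed
qed simp

lemma cyc_far: "Suc i < j \<or> j + l < i \<Longrightarrow> cyc j l \<otimes> r i \<asymp> r i \<otimes> cyc j l"
proof (induction l)
  case 0
  show ?case by (simp add: eqz_refl)
next
  case (Suc l)
  have "cyc j (Suc l) \<otimes> r i = r (j + l) \<otimes> (cyc j l \<otimes> r i)" by (simp add: m_assoc)
  also have "\<dots> \<asymp> r (j + l) \<otimes> (r i \<otimes> cyc j l)"
    using Suc by (intro eqz_mult eqz_refl Suc.IH) auto
  also have "\<dots> = (r (j + l) \<otimes> r i) \<otimes> cyc j l" by (simp add: m_assoc)
  also have "\<dots> \<asymp> (r i \<otimes> r (j + l)) \<otimes> cyc j l"
    using Suc.prems by (intro eqz_mult eqz_refl eqzI[OF r_comm]) auto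
  finally show ?case by (simp add: m_assoc)
qed

text \<open>Up to \<open>Z\<close>, all factors of \<open>cyc j l\<close> but two commute with \<open>r (Suc i)\<close> or \<open>r i\<close>, and past these two the braid relation takes
  \<open>r (Suc i)\<close> to \<open>r i\<close>.\<close>

lemma cyc_shift: "j \<le> i \<Longrightarrow> Suc i < j + l \<Longrightarrow> cyc j l \<otimes> r (Suc i) \<asymp> r i \<otimes> cyc j l"
proof (induction l)
  case (Suc l)
  show ?case
  proof (cases "Suc i < j + l")
    case True
    have "cyc j (Suc l) \<otimes> r (Suc i) = r (j + l) \<otimes> (cyc j l \<otimes> r (Suc i))" by (simp add: m_assoc)
    also have "\<dots> \<asymp> r (j + l) \<otimes> (r i \<otimes> cyc j l)"
      using Suc True by (intro eqz_mult eqz_refl Suc.IH) auto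
    also have "\<dots> = (r (j + l) \<otimes> r i) \<otimes> cyc j l" by (simp add: m_assoc)
    also have "\<dots> \<asymp> (r i \<otimes> r (j + l)) \<otimes> cyc j l"
      using True by (intro eqz_mult eqz_refl eqzI[OF r_comm]) auto
    finally show ?thesis by (simp add: m_assoc)
  next
    case False
    then have jl: "j + l = Suc i" using Suc.prems by simp
    then obtain l' where l: "l = Suc l'" using Suc.prems by (cases l) auto
    have i: "i = j + l'" using jl l by simp
    have "cyc j (Suc l) \<otimes> r (Suc i) = r (Suc i) \<otimes> r i \<otimes> (cyc j l' \<otimes> r (Suc i))"
      by (simp add: l i m_assoc)
    also have "\<dots> \<asymp> r (Suc i) \<otimes> r i \<otimes> (r (Suc i) \<otimes> cyc j l')"
      by (intro eqz_mult eqz_refl cyc_far) (auto simp: i)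
    also have "\<dots> = r (Suc i) \<otimes> (r i \<otimes> r (Suc i)) \<otimes> cyc j l'" by (simp add: m_assoc)
    also have "\<dots> = r i \<otimes> cyc j (Suc l)" by (simp only: r_braid) (simp add: l i m_assoc)
    finally show ?thesis .
  qed
qed simp

lemma eta_pow_far: "x \<in> carrier G \<Longrightarrow> \<eta> N \<otimes> x \<asymp> x \<otimes> \<eta> N \<Longrightarrow> \<eta> N [^] (a::nat) \<otimes> x \<asymp> x \<otimes> \<eta> N [^] a"
proof (induction a)
  case 0
  then show ?case by (simp add: eqz_refl)
next
  case (Suc a)
  have "\<eta> N [^] Suc a \<otimes> x = \<eta> N [^] a \<otimes> (\<eta> N \<otimes> x)" using Suc by (simp add: m_assoc)
  also have "\<dots> \<asymp> \<eta> N [^] a \<otimes> (x \<otimes> \<eta> N)"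
    using Suc.prems by (intro eqz_mult[OF eqz_refl Suc.prems(2)]) auto
  also have "\<dots> = (\<eta> N [^] a \<otimes> x) \<otimes> \<eta> N" using Suc by (simp add: m_assoc)
  also have "\<dots> \<asymp> (x \<otimes> \<eta> N [^] a) \<otimes> \<eta> N"
    using Suc.prems by (intro eqz_mult[OF Suc.IH[OF Suc.prems] eqz_refl]) auto
  finally show ?case using Suc by (simp add: m_assoc)
qed

definition std_cosets :: "nat \<Rightarrow> G'_elem set" where
  "std_cosets N = {g. \<exists>h\<in>std N. \<exists>a j l. j + l = N \<and> g = h \<otimes> (\<eta> N [^] (a::nat) \<otimes> cyc j l)}"

lemma std_cosets_eqz:
  assumes h: "h \<in> std N" and x: "x \<asymp> \<eta> N [^] (a::nat) \<otimes> cyc j l" and N: "j + l = N"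
  shows "h \<otimes> x \<in> std_cosets N"
proof -
  obtain v where "x = \<zeta> v \<otimes> (\<eta> N [^] a \<otimes> cyc j l)" using x by (auto simp only: eqz_def)
  then have "h \<otimes> x = h \<otimes> \<zeta> v \<otimes> (\<eta> N [^] a \<otimes> cyc j l)"
    using std_closed[OF h] by (simp add: m_assoc)
  then show ?thesis unfolding std_cosets_def using std.zeta[OF h] N by blast
qed

text \<open>Right multiplication by a generator of \<open>std (Suc N)\<close> maps the union of the cosets
  \<open>std N \<otimes> \<eta> N [^] a \<otimes> cyc j (N - j)\<close> to itself: the generator either lengthens or shortens the cycle, or raises
  the exponent \<open>a\<close>, or passes to the left and is absorbed by \<open>std N\<close>.\<close>

lemma std_Suc_cosets: "x \<in> std (Suc N) \<Longrightarrow> x \<in> std_cosets N"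
proof (induction rule: std.induct)
  case one
  show ?case using std_cosets_eqz[OF std.one, of \<one> N 0 N 0] by (simp add: eqz_refl)
next
  case (zeta x v)
  then obtain h a j l where h: "h \<in> std N" "j + l = N" "x = h \<otimes> (\<eta> N [^] (a::nat) \<otimes> cyc j l)"
    unfolding std_cosets_def by blast
  have "x \<otimes> \<zeta> v = h \<otimes> (\<zeta> v \<otimes> (\<eta> N [^] a \<otimes> cyc j l))"
    using std_closed[OF h(1)] \<zeta>_comm[of "\<eta> N [^] a \<otimes> cyc j l" v] by (simp add: h(3) m_assoc)
  then show ?case using std_cosets_eqz[OF h(1) eqzI[OF HOL.refl] h(2)] by simp
next
  case (r x i)
  then obtain h a j l where h: "h \<in> std N" "j + l = N" "x = h \<otimes> (\<eta> N [^] (a::nat) \<otimes> cyc j l)"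
    unfolding std_cosets_def by blast
  note hc = std_closed[OF h(1)]
  have x: "x \<otimes> r i = h \<otimes> (\<eta> N [^] a \<otimes> (cyc j l \<otimes> r i))" using hc by (simp add: h(3) m_assoc)
  have absorb: "x \<otimes> r i \<in> std_cosets N" if k: "Suc k < N" and c: "cyc j l \<otimes> r i \<asymp> r k \<otimes> cyc j l" for k
  proof -
    have "\<eta> N \<otimes> r k = \<zeta> (0,0,1) \<otimes> (r k \<otimes> \<eta> N)"
      using r_eta[of k N] k by (simp add: \<zeta>_add_left)
    then have far: "\<eta> N \<otimes> r k \<asymp> r k \<otimes> \<eta> N" by (rule eqzI)
    have "\<eta> N [^] a \<otimes> (cyc j l \<otimes> r i) \<asymp> \<eta> N [^] a \<otimes> (r k \<otimes> cyc j l)"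
      by (rule eqz_mult[OF eqz_refl c]) auto
    also have "\<dots> = (\<eta> N [^] a \<otimes> r k) \<otimes> cyc j l" by (simp add: m_assoc)
    also have "\<dots> \<asymp> (r k \<otimes> \<eta> N [^] a) \<otimes> cyc j l"
      by (rule eqz_mult[OF eta_pow_far[OF _ far] eqz_refl]) auto
    finally have "\<eta> N [^] a \<otimes> (cyc j l \<otimes> r i) \<asymp> (r k \<otimes> \<eta> N [^] a) \<otimes> cyc j l" by simp
    then obtain v where v: "\<eta> N [^] a \<otimes> (cyc j l \<otimes> r i) = \<zeta> v \<otimes> ((r k \<otimes> \<eta> N [^] a) \<otimes> cyc j l)"
      unfolding eqz_def by (rule exE)
    have "x \<otimes> r i = (h \<otimes> r k) \<otimes> (\<zeta> v \<otimes> (\<eta> N [^] a \<otimes> cyc j l))"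
      unfolding x v using hc by (simp add: m_assoc \<zeta>_lcomm[of "r k" "\<eta> N [^] a \<otimes> cyc j l" v])
    then show ?thesis
      using std_cosets_eqz[OF std.r[OF h(1) k] eqzI[OF HOL.refl] h(2)] by simp
  qed
  have i: "i < N" using r by simp
  consider "Suc i < j" | "Suc i = j" | "i = j" | "j < i" by linarith
  then show ?case
  proof cases
    case 1
    then show ?thesis using h(2) by (intro absorb[of i] cyc_far) auto
  next
    case 2
    have snoc: "cyc i (Suc l') = cyc (Suc i) l' \<otimes> r i" for l'
      by (induction l') (simp_all add: m_assoc)
    have c: "cyc j l \<otimes> r i = cyc i (Suc l)" using snoc[of l] 2 by simp
    show ?thesis
      unfolding x c by (rule std_cosets_eqz[OF h(1) eqz_refl]) (use h(2) 2 in auto)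
  next
    case 3
    then obtain l' where l: "l = Suc l'" using i h(2) by (cases l) auto
    have snoc: "cyc i (Suc l') = cyc (Suc i) l' \<otimes> r i" for l'
      by (induction l') (simp_all add: m_assoc)
    have c: "cyc j l \<otimes> r i = cyc (Suc i) l'" using snoc[of l'] 3 l by (simp add: m_assoc del: cyc.simps)
    show ?thesis
      unfolding x c by (rule std_cosets_eqz[OF h(1) eqz_refl]) (use h(2) 3 l in auto)
  next
    case 4
    then obtain k where k: "i = Suc k" by (cases i) auto
    show ?thesis using 4 i k h(2) by (intro absorb[of k]) (auto intro!: cyc_shift)
  qed
next
  case (eta x i)
  then obtain h a j l where h: "h \<in> std N" "j + l = N" "x = h \<otimes> (\<eta> N [^] (a::nat) \<otimes> cyc j l)"
    unfolding std_cosets_def by blast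
  note hc = std_closed[OF h(1)]
  define k where "k = perm_of (cyc j l) i"
  have kN: "k \<le> N" using perm_cyc_le[of i j l] eta h(2) by (simp add: k_def)
  have c: "\<eta> N [^] a \<otimes> (cyc j l \<otimes> \<eta> i) \<asymp> \<eta> N [^] a \<otimes> (\<eta> k \<otimes> cyc j l)"
    unfolding k_def by (rule eqz_mult[OF eqz_refl eta_conj]) auto
  have x: "x \<otimes> \<eta> i = h \<otimes> (\<eta> N [^] a \<otimes> (cyc j l \<otimes> \<eta> i))" using hc by (simp add: h(3) m_assoc)
  show ?case
  proof (cases "k = N")
    case True
    have "\<eta> N [^] a \<otimes> (\<eta> k \<otimes> cyc j l) = \<eta> N [^] Suc a \<otimes> cyc j l"
      unfolding True by (simp add: m_assoc)
    then show ?thesis unfolding x using c h by (intro std_cosets_eqz[of _ _ _ "Suc a"]) auto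
  next
    case False
    then have k: "k < N" using kN by simp
    have far: "\<eta> N \<otimes> \<eta> k \<asymp> \<eta> k \<otimes> \<eta> N" by (rule eqzI[OF eta_comm]) (use False in simp)
    note c
    also have "\<eta> N [^] a \<otimes> (\<eta> k \<otimes> cyc j l) = (\<eta> N [^] a \<otimes> \<eta> k) \<otimes> cyc j l" by (simp add: m_assoc)
    also have "\<dots> \<asymp> (\<eta> k \<otimes> \<eta> N [^] a) \<otimes> cyc j l"
      by (rule eqz_mult[OF eta_pow_far[OF _ far] eqz_refl]) auto
    finally have "\<eta> N [^] a \<otimes> (cyc j l \<otimes> \<eta> i) \<asymp> (\<eta> k \<otimes> \<eta> N [^] a) \<otimes> cyc j l" by simp
    then obtain v where v: "\<eta> N [^] a \<otimes> (cyc j l \<otimes> \<eta> i) = \<zeta> v \<otimes> ((\<eta> k \<otimes> \<eta> N [^] a) \<otimes> cyc j l)"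
      unfolding eqz_def by (rule exE)
    have "x \<otimes> \<eta> i = (h \<otimes> \<eta> k) \<otimes> (\<zeta> v \<otimes> (\<eta> N [^] a \<otimes> cyc j l))"
      unfolding x v using hc by (simp add: m_assoc \<zeta>_lcomm[of "\<eta> k" "\<eta> N [^] a \<otimes> cyc j l" v])
    then show ?thesis
      using std_cosets_eqz[OF std.eta[OF h(1) k] eqzI[OF HOL.refl] h(2)] by simp
  qed
qed

lemma eta_pow_diag: "perm_of (\<eta> N [^] (a::nat)) = id" "diag_of (\<eta> N [^] a) N = int a mod int m"
proof -
  show 1: "perm_of (\<eta> N [^] a) = id" for a :: nat by (induction a) auto
  show "diag_of (\<eta> N [^] a) N = int a mod int m"
  proof (induction a)
    case (Suc a)
    then show ?case using diag_mult_perm[of "\<eta> N [^] a" "\<eta> N" N] 1[of a] by (simp add: mod_simps add.commute)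
  qed simp
qed

lemma eta_pow_eq_one: "int a mod int m = 0 \<Longrightarrow> \<eta> N [^] a = \<one>"
proof -
  assume "int a mod int m = 0"
  then obtain k where "a = m * k" by (metis dvd_def mod_0_imp_dvd of_nat_dvd_iff)
  then show ?thesis by (simp add: nat_pow_pow[symmetric] eta_pow_m nat_pow_one)
qed

text \<open>In the coset representation of \<open>g\<close> the cycle must be empty, since it takes \<open>j\<close> to \<open>N\<close> while \<open>g\<close> fixes \<open>N\<close>, and the
  component at \<open>N\<close> is the exponent of \<open>\<eta> N\<close>.\<close>

lemma std_descend:
  assumes g: "g \<in> std (Suc N)" and N: "perm_of g N = N" "diag_of g N = 0"
  shows "g \<in> std N"
proof -
  obtain h a j l where h: "h \<in> std N" "j + l = N" "g = h \<otimes> (\<eta> N [^] (a::nat) \<otimes> cyc j l)"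
    using std_Suc_cosets[OF g] unfolding std_cosets_def by blast
  note hc = std_closed[OF h(1)]
  have hN: "perm_of h N = N" "diag_of h N = 0" using supp_std[OF h(1)] by auto
  have "perm_of h (perm_of (cyc j l) N) = perm_of h N" using N hN hc by (simp add: h(3) eta_pow_diag)
  then have "perm_of (cyc j l) N = perm_of (cyc j l) j"
    using perm_bij[OF hc] h(2) perm_cyc[of j l] by (simp add: bij_is_inj inj_eq)
  then have "j = N" using perm_bij[OF cyc_closed, of j l] by (simp add: bij_is_inj inj_eq)
  then have gh: "g = h \<otimes> \<eta> N [^] a" using h by simp
  have "int a mod int m = 0"
    using diag_mult_perm[of h "\<eta> N [^] a" N] hc hN N by (simp add: gh eta_pow_diag mod_simps)
  then show ?thesis using h(1) hc by (simp add: gh eta_pow_eq_one)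
qed

text \<open>An element of the kernel descends through all \<open>std N\<close> down to \<open>std 0\<close>, which is \<open>Z\<close>.\<close>

lemma kernel_Phi:
  assumes g: "g \<in> carrier G" and triv: "\<And>j. perm_of g j = j" "\<And>j. diag_of g j = 0"
  shows "g \<in> range \<zeta>"
proof -
  obtain N where "g \<in> std N" using std_exhausts[OF g] by blast
  then have "g \<in> std 0" by (induction N) (auto intro: std_descend triv)
  then show ?thesis
  proof (induction rule: std.induct)
    case one
    then show ?case by (rule range_eqI[of _ _ 0]) simp
  next
    case (zeta x v)
    then obtain u where "x = \<zeta> u" by (auto simp only: image_iff)
    then show ?case by (simp add: \<zeta>_add)
  qed auto
qed

lemma Phi_eq_imp_eqz:
  assumes g: "g \<in> carrier G" and h: "h \<in> carrier G" and eq: "Phi m g = Phi m h"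
  shows "g \<asymp> h"
proof -
  define x where "x = inv h \<otimes> g"
  have x: "x \<in> carrier G" "g = h \<otimes> x" using g h by (simp_all add: x_def m_assoc[symmetric])
  have p: "perm_of x j = j" for j
  proof -
    have "perm_of (h \<otimes> x) j = perm_of h j" by (simp only: x(2)[symmetric] eq)
    then have "perm_of h (perm_of x j) = perm_of h j" using h x(1) by simp
    then show ?thesis using perm_bij[OF h] by (simp add: bij_is_inj inj_eq)
  qed
  have "diag_of x j = 0" for j
  proof -
    have "(diag_of h (perm_of h j) + diag_of x j) mod int m = diag_of h (perm_of h j) mod int m"
      using diag_mult_perm[OF h x(1), of j] eq h by (simp add: x(2)[symmetric])
    then have "diag_of x j mod int m = 0"
      by (metis add_diff_cancel_left' mod_0 mod_diff_cong diff_self)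
    then show ?thesis using x(1) by simp
  qed
  then obtain v where "x = \<zeta> v" using kernel_Phi[OF x(1) p] by auto
  then show ?thesis using h by (intro eqzI[of _ v]) (simp add: x(2) \<zeta>_comm[of h v])
qed

end

section \<open>Elements with disjoint supports\<close>

context rep_group
begin

lemma par_eqz: "x \<asymp> y \<Longrightarrow> y \<in> carrier G \<Longrightarrow> lpar x = lpar y \<and> opar x = opar y"
  unfolding eqz_def by (elim exE) simp

text \<open>The elements that lie over the finite permutations.\<close>

definition pure :: "G'_elem \<Rightarrow> bool" where
  "pure g \<longleftrightarrow> g \<in> carrier G \<and> (\<forall>j. diag_of g j = 0)"

lemma pure_closed [simp]: "pure g \<Longrightarrow> g \<in> carrier G"
  by (simp add: pure_def)

lemma pure_mult: "pure g \<Longrightarrow> pure h \<Longrightarrow> pure (g \<otimes> h)"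
  by (simp add: pure_def diag_mult)

lemma pure_inv: "pure g \<Longrightarrow> pure (inv g)"
proof -
  assume g: "pure g"
  have "diag_of (g \<otimes> inv g) (perm_of g i) = (diag_of g (perm_of g i) + diag_of (inv g) i) mod int m" for i
    using g by (intro diag_mult_perm) auto
  then show ?thesis using g by (simp add: pure_def)
qed

lemma pure_r [simp]: "pure (r i)" and pure_one [simp]: "pure \<one>"
  by (simp_all add: pure_def)

lemma lift_transpose:
  "a \<noteq> b \<Longrightarrow> \<exists>t. pure t \<and> perm_of t = Transposition.transpose a b \<and> lpar t = 1 \<and> opar t = 0"
proof -
  have up: "\<exists>t. pure t \<and> perm_of t = Transposition.transpose a (Suc (a + n)) \<and> lpar t = 1 \<and> opar t = 0" for a n
  proof (induction n)
    case 0
    show ?case by (rule exI[of _ "r a"]) simp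
  next
    case (Suc n)
    then obtain t where t: "pure t" "perm_of t = Transposition.transpose a (Suc (a + n))" "lpar t = 1" "opar t = 0"
      by blast
    let ?r = "r (Suc (a + n))"
    have "perm_of (?r \<otimes> t \<otimes> ?r) = Transposition.transpose a (Suc (a + Suc n))"
      using t by (auto simp: fun_eq_iff Transposition.transpose_def)
    moreover have "pure (?r \<otimes> t \<otimes> ?r)" using t by (intro pure_mult) auto
    moreover have "lpar (?r \<otimes> t \<otimes> ?r) = 1" "opar (?r \<otimes> t \<otimes> ?r) = 0"
      using t by (simp_all add: add.commute)
    ultimately show ?case by blast
  qed
  assume "a \<noteq> b"
  then consider n where "b = Suc (a + n)" | n where "a = Suc (b + n)"
    using less_imp_Suc_add[of a b] less_imp_Suc_add[of b a] by (cases "a < b") auto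
  then show ?thesis
  proof cases
    case 1
    then show ?thesis using up by simp
  next
    case 2
    then show ?thesis using up[of b n] by (simp add: transpose_commute)
  qed
qed

lemma lift_permutes:
  "p permutes S \<Longrightarrow> finite S \<Longrightarrow> \<exists>x. pure x \<and> perm_of x = p \<and> opar x = 0"
proof (induction rule: permutes_induct)
  case id
  show ?case by (rule exI[of _ \<one>]) simp
next
  case (swap a b p)
  then obtain x where x: "pure x" "perm_of x = p" "opar x = 0" by blast
  obtain t where t: "pure t" "perm_of t = Transposition.transpose a b" "opar t = 0"
    using lift_transpose[OF swap(3)] by blast
  show ?case by (rule exI[of _ "t \<otimes> x"]) (use x t in \<open>simp add: pure_mult\<close>)
qed

text \<open>Conjugating with such an \<open>x\<close> moves finitely many given points to prescribed places, which reduces relations between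
  lifts of arbitrary transpositions to relations between the generators.\<close>

lemma lift_moves:
  fixes f :: "nat \<Rightarrow> nat"
  assumes "finite A" "inj_on f A"
  shows "\<exists>x. pure x \<and> (\<forall>i\<in>A. perm_of x i = f i)"
proof -
  obtain p where "p permutes (A \<union> f ` A)" "\<forall>i\<in>A. p i = f i"
    using permutes_extend[of A "A \<union> f ` A" f] assms by auto
  then show ?thesis using lift_permutes[of p "A \<union> f ` A"] assms(1) by auto
qed

lemma conj_pure:
  assumes x: "pure x" and g: "g \<in> carrier G"
  shows "perm_of (x \<otimes> g \<otimes> inv x) (perm_of x i) = perm_of x (perm_of g i)"
    and "diag_of (x \<otimes> g \<otimes> inv x) (perm_of x i) = diag_of g i"
proof -
  have c: "x \<in> carrier G" using x by simp
  have "perm_of (inv x) (perm_of x i) = i" for i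
    using perm_bij[OF c] by (simp add: perm_inv[OF c] bij_is_inj inv_f_f)
  then show "perm_of (x \<otimes> g \<otimes> inv x) (perm_of x i) = perm_of x (perm_of g i)"
    using c g by simp
  have "diag_of (x \<otimes> g \<otimes> inv x) (perm_of x i) = diag_of (x \<otimes> g) (perm_of x i)"
    using c g pure_inv[OF x] by (simp add: diag_mult[of "x \<otimes> g" "inv x"] pure_def)
  also have "\<dots> = diag_of g i"
    using c g x by (simp add: diag_mult_perm pure_def)
  finally show "diag_of (x \<otimes> g \<otimes> inv x) (perm_of x i) = diag_of g i" .
qed

lemma conj_eta:
  assumes "pure x"
  shows "\<eta> (perm_of x i) \<asymp> x \<otimes> \<eta> i \<otimes> inv x"
proof (rule Phi_eq_imp_eqz)
  have b: "bij (perm_of x)" using assms perm_bij by simp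
  show "Phi m (\<eta> (perm_of x i)) = Phi m (x \<otimes> \<eta> i \<otimes> inv x)"
  proof (rule prod_eqI; rule ext)
    fix k
    obtain j where k: "k = perm_of x j" using b by (metis bij_pointE)
    show "diag_of (\<eta> (perm_of x i)) k = diag_of (x \<otimes> \<eta> i \<otimes> inv x) k"
      using b unfolding k conj_pure(2)[OF assms gen_closed] by (simp add: bij_is_inj inj_eq)
    show "perm_of (\<eta> (perm_of x i)) k = perm_of (x \<otimes> \<eta> i \<otimes> inv x) k"
      unfolding k conj_pure(1)[OF assms gen_closed] by simp
  qed
qed (use assms in auto)

lemma conj_transpose:
  assumes "pure x" "pure t" "perm_of t = Transposition.transpose (perm_of x i) (perm_of x (Suc i))"
  shows "t \<asymp> x \<otimes> r i \<otimes> inv x"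
proof (rule Phi_eq_imp_eqz)
  have b: "bij (perm_of x)" using assms perm_bij by simp
  show "Phi m t = Phi m (x \<otimes> r i \<otimes> inv x)"
  proof (rule prod_eqI; rule ext)
    fix k
    obtain j where k: "k = perm_of x j" using b by (metis bij_pointE)
    show "diag_of t k = diag_of (x \<otimes> r i \<otimes> inv x) k"
      using assms(2) unfolding k conj_pure(2)[OF assms(1) gen_closed] by (simp add: pure_def)
    show "perm_of t k = perm_of (x \<otimes> r i \<otimes> inv x) k"
      unfolding k conj_pure(1)[OF assms(1) gen_closed]
      using b by (simp add: assms(3) transpose_apply_commute bij_is_inj inj_eq Transposition.transpose_def)
  qed
qed (use assms in auto)

lemma par_transpose:
  assumes "pure t" "perm_of t = Transposition.transpose a b" "a \<noteq> b"
  shows "lpar t = 1" "opar t = 0"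
proof -
  obtain t' where t': "pure t'" "perm_of t' = Transposition.transpose a b" "lpar t' = 1" "opar t' = 0"
    using lift_transpose[OF assms(3)] by blast
  have "t \<asymp> t'"
    by (rule Phi_eq_imp_eqz) (use assms t' in \<open>auto intro!: prod_eqI simp: pure_def fun_eq_iff\<close>)
  then show "lpar t = 1" "opar t = 0" using par_eqz t' by auto
qed

text \<open>Moving a letter \<open>r\<close> past \<open>r\<close>, \<open>\<eta>\<close> past \<open>\<eta>\<close>, or one past the other at disjoint places costs
  \<open>z\<^sub>1\<close>, \<open>z\<^sub>2\<close> or \<open>z\<^sub>3\<close>; the exponents of these count the pairs of letters.\<close>

definition \<beta> :: "G'_elem \<Rightarrow> G'_elem \<Rightarrow> bit \<times> bit \<times> bit" where
  "\<beta> h k = (lpar h * lpar k, opar h * opar k, lpar h * opar k + opar h * lpar k)"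

lemma \<beta>_mult_left: "h \<in> carrier G \<Longrightarrow> h' \<in> carrier G \<Longrightarrow> \<beta> (h \<otimes> h') k = \<beta> h k + \<beta> h' k"
  by (simp add: \<beta>_def algebra_simps)

lemma \<beta>_sym: "\<beta> h k = \<beta> k h"
  by (simp add: \<beta>_def algebra_simps)

lemma \<beta>_mult_right: "k \<in> carrier G \<Longrightarrow> k' \<in> carrier G \<Longrightarrow> \<beta> h (k \<otimes> k') = \<beta> h k + \<beta> h k'"
  using \<beta>_mult_left[of k k' h] by (simp add: \<beta>_sym[of h])

text \<open>Conjugation transports a commutation relation, and since only the conjugates up to \<open>Z\<close> matter they can be
  recognised by their images under the projection.\<close>

lemma exchange_transport:
  assumes c: "x \<in> carrier G" "h \<in> carrier G" "k \<in> carrier G"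
    and e: "h' \<asymp> x \<otimes> h \<otimes> inv x" "k' \<asymp> x \<otimes> k \<otimes> inv x"
    and ex: "h \<otimes> k = \<zeta> w \<otimes> (k \<otimes> h)"
  shows "h' \<otimes> k' = \<zeta> w \<otimes> (k' \<otimes> h')"
proof -
  obtain u v where u: "h' = \<zeta> u \<otimes> (x \<otimes> h \<otimes> inv x)" and v: "k' = \<zeta> v \<otimes> (x \<otimes> k \<otimes> inv x)"
    using e unfolding eqz_def by blast
  have xx: "a \<in> carrier G \<Longrightarrow> inv x \<otimes> (x \<otimes> a) = a" for a using c by (simp add: m_assoc[symmetric])
  have hk: "h' \<otimes> k' = \<zeta> (u + v) \<otimes> (x \<otimes> (h \<otimes> k) \<otimes> inv x)"
    using c \<zeta>_lcomm[of "x \<otimes> h \<otimes> inv x" "x \<otimes> k \<otimes> inv x" v]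
    unfolding u v by (simp add: m_assoc \<zeta>_add_left xx)
  have kh: "k' \<otimes> h' = \<zeta> (v + u) \<otimes> (x \<otimes> (k \<otimes> h) \<otimes> inv x)"
    using c \<zeta>_lcomm[of "x \<otimes> k \<otimes> inv x" "x \<otimes> h \<otimes> inv x" u]
    unfolding u v by (simp add: m_assoc \<zeta>_add_left xx)
  have "h' \<otimes> k' = \<zeta> (u + v) \<otimes> (\<zeta> w \<otimes> (x \<otimes> (k \<otimes> h) \<otimes> inv x))"
    unfolding hk ex using c \<zeta>_lcomm[of x "k \<otimes> h \<otimes> inv x" w] by (simp add: m_assoc)
  also have "\<dots> = \<zeta> w \<otimes> (k' \<otimes> h')"
    unfolding kh using c by (simp add: \<zeta>_add_left add_ac)
  finally show ?thesis .
qed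

definition com :: "G'_elem \<Rightarrow> G'_elem \<Rightarrow> bool" where
  "com h k \<longleftrightarrow> h \<otimes> k = \<zeta> (\<beta> h k) \<otimes> (k \<otimes> h)"

lemma com_sym: "h \<in> carrier G \<Longrightarrow> k \<in> carrier G \<Longrightarrow> com h k \<Longrightarrow> com k h"
  unfolding com_def \<beta>_sym[of k h] by (simp add: \<zeta>_add_left)

lemma exchange_mult:
  assumes c: "h \<in> carrier G" "h' \<in> carrier G" "k \<in> carrier G"
    and e: "h \<otimes> k = \<zeta> v \<otimes> (k \<otimes> h)" "h' \<otimes> k = \<zeta> v' \<otimes> (k \<otimes> h')"
  shows "h \<otimes> h' \<otimes> k = \<zeta> (v + v') \<otimes> (k \<otimes> (h \<otimes> h'))"
proof -
  have "h \<otimes> h' \<otimes> k = \<zeta> v' \<otimes> ((h \<otimes> k) \<otimes> h')"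
    using c e(2) \<zeta>_lcomm[of h "k \<otimes> h'" v'] by (simp add: m_assoc)
  then show ?thesis using c by (simp add: e(1) m_assoc \<zeta>_add_left add.commute)
qed

lemma com_mult:
  assumes "h \<in> carrier G" "h' \<in> carrier G" "k \<in> carrier G" "com h k" "com h' k"
  shows "com (h \<otimes> h') k"
  using exchange_mult[OF assms(1-3)] assms(4,5) unfolding com_def \<beta>_mult_left[OF assms(1,2)] by blast

lemma com_\<zeta>: "k \<in> carrier G \<Longrightarrow> com (\<zeta> v) k"
  by (simp add: com_def \<beta>_def \<zeta>_comm[of k v] zero_prod_def[symmetric])

lemma com_transport:
  assumes c: "x \<in> carrier G" "h \<in> carrier G" "k \<in> carrier G"
    and e: "h' \<asymp> x \<otimes> h \<otimes> inv x" "k' \<asymp> x \<otimes> k \<otimes> inv x"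
    and "com h k"
  shows "com h' k'"
proof -
  have "lpar h' = lpar h \<and> opar h' = opar h" "lpar k' = lpar k \<and> opar k' = opar k"
    using par_eqz[OF e(1)] par_eqz[OF e(2)] c by simp_all
  then show ?thesis
    using exchange_transport[OF c e] assms(6) by (simp add: com_def \<beta>_def)
qed

lemma com_eta_eta: "j \<noteq> k \<Longrightarrow> com (\<eta> j) (\<eta> k)"
  unfolding com_def using eta_comm[of j k] by (simp add: \<beta>_def)

lemma com_transpose_eta:
  assumes t: "pure t" "perm_of t = Transposition.transpose a b" and d: "a \<noteq> b" "c \<noteq> a" "c \<noteq> b"
  shows "com t (\<eta> c)"
proof -
  have "inj_on (\<lambda>i. if i = 0 then a else if i = Suc 0 then b else c) {0, 1, 2}"
    using d by (auto simp: inj_on_def)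
  from lift_moves[OF _ this] obtain x where x: "pure x" "perm_of x 0 = a" "perm_of x 1 = b" "perm_of x 2 = c"
    by auto
  show ?thesis
  proof (rule com_transport)
    show "t \<asymp> x \<otimes> r 0 \<otimes> inv x" by (rule conj_transpose) (use t x in auto)
    show "\<eta> c \<asymp> x \<otimes> \<eta> 2 \<otimes> inv x" using conj_eta[OF x(1), of 2] x by simp
    show "com (r 0) (\<eta> 2)" unfolding com_def using r_eta[of 0 2] by (simp add: \<beta>_def)
  qed (use x in auto)
qed

lemma com_transpose_transpose:
  assumes t: "pure t" "perm_of t = Transposition.transpose a b" "pure t'" "perm_of t' = Transposition.transpose c d"
    and d: "distinct [a, b, c, d]"
  shows "com t t'"
proof -
  have "inj_on (\<lambda>i. if i = 0 then a else if i = Suc 0 then b else if i = 2 then c else d) {0, 1, 2, 3}"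
    using d by (auto simp: inj_on_def)
  from lift_moves[OF _ this] obtain x where
    x: "pure x" "perm_of x 0 = a" "perm_of x 1 = b" "perm_of x 2 = c" "perm_of x 3 = d"
    by auto
  show ?thesis
  proof (rule com_transport)
    show "t \<asymp> x \<otimes> r 0 \<otimes> inv x" by (rule conj_transpose) (use t x in auto)
    show "t' \<asymp> x \<otimes> r 2 \<otimes> inv x"
      by (rule conj_transpose) (use t x in \<open>auto simp: eval_nat_numeral\<close>)
    show "com (r 0) (r 2)" unfolding com_def using r_comm[of 0 2] by (simp add: \<beta>_def)
  qed (use x in auto)
qed

text \<open>Elements composed of generators with support in \<open>S\<close>. By \<open>supp_gen_on\<close> every element with support in \<open>S\<close> is of
  this form, although a word for it in the defining generators may have to leave \<open>S\<close>.\<close>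

inductive_set gen_on :: "nat set \<Rightarrow> G'_elem set" for S where
  zeta: "\<zeta> v \<in> gen_on S"
| eta: "j \<in> S \<Longrightarrow> \<eta> j \<in> gen_on S"
| swap: "a \<in> S \<Longrightarrow> b \<in> S \<Longrightarrow> a \<noteq> b \<Longrightarrow> pure t \<Longrightarrow> perm_of t = Transposition.transpose a b \<Longrightarrow> t \<in> gen_on S"
| mult: "x \<in> gen_on S \<Longrightarrow> y \<in> gen_on S \<Longrightarrow> x \<otimes> y \<in> gen_on S"

lemma gen_on_closed: "x \<in> gen_on S \<Longrightarrow> x \<in> carrier G"
  by (induction rule: gen_on.induct) auto

lemma gen_on_mono: "x \<in> gen_on S \<Longrightarrow> S \<subseteq> T \<Longrightarrow> x \<in> gen_on T"
  by (induction rule: gen_on.induct) (blast intro: gen_on.intros)+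

lemma one_gen_on: "\<one> \<in> gen_on S"
  using gen_on.zeta[of 0] by simp

lemma gen_on_permutes:
  "p permutes S \<Longrightarrow> finite S \<Longrightarrow> \<exists>x\<in>gen_on S. pure x \<and> perm_of x = p"
proof (induction rule: permutes_induct)
  case id
  show ?case by (rule bexI[OF _ one_gen_on]) simp
next
  case (swap a b p)
  then obtain x where x: "pure x" "perm_of x = p" "x \<in> gen_on S" by blast
  obtain t where t: "pure t" "perm_of t = Transposition.transpose a b"
    using lift_transpose[OF swap(3)] by blast
  show ?case
    by (rule bexI[OF _ gen_on.mult[OF gen_on.swap[OF swap(1-3) t] x(3)]])
      (use x t in \<open>simp add: pure_mult\<close>)
qed

lemma gen_on_diag:
  assumes "finite F" "F \<subseteq> S" "\<And>j. 0 \<le> d j \<and> d j < int m"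
  shows "\<exists>x\<in>gen_on S. perm_of x = id \<and> (\<forall>j. diag_of x j = (if j \<in> F then d j else 0))"
  using assms(1,2)
proof (induction F rule: finite_induct)
  case empty
  show ?case by (rule bexI[OF _ one_gen_on]) simp
next
  case (insert k F)
  then obtain x where x: "x \<in> gen_on S" "perm_of x = id" "\<forall>j. diag_of x j = (if j \<in> F then d j else 0)"
    by blast
  have pow: "\<eta> k [^] n \<in> gen_on S \<and> perm_of (\<eta> k [^] n) = id \<and>
     (\<forall>j. diag_of (\<eta> k [^] n) j = (if j = k then int n mod int m else 0))" for n :: nat
  proof (induction n)
    case 0
    show ?case using one_gen_on by simp
  next
    case (Suc n)
    then show ?case using gen_on.mult[OF _ gen_on.eta[of k S]] insert.prems
      by (auto simp: diag_mult inv_id mod_simps add.commute)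
  qed
  let ?y = "x \<otimes> \<eta> k [^] nat (d k)"
  have "?y \<in> gen_on S" using gen_on.mult[OF x(1)] pow by blast
  moreover have "perm_of ?y = id" using gen_on_closed[OF x(1)] pow[of "nat (d k)"] x(2) by simp
  moreover have "\<forall>j. diag_of ?y j = (if j \<in> insert k F then d j else 0)"
    using gen_on_closed[OF x(1)] pow[of "nat (d k)"] x(2,3) insert.hyps assms(3)
    by (auto simp: diag_mult inv_id)
  ultimately show ?case by blast
qed

text \<open>Some element of \<open>gen_on S\<close> has the same image as \<open>g\<close>, and the two differ by a factor in \<open>Z\<close>.\<close>

lemma supp_gen_on:
  assumes g: "g \<in> carrier G" and S: "supp m g \<subseteq> S"
  shows "g \<in> gen_on S"
proof -
  let ?T = "supp m g"
  have fin: "finite ?T" by (rule supp_finite[OF g])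
  have "perm_of g permutes ?T"
    using perm_bij[OF g] by (simp add: permutes_def bij_iff supp_iff)
  then obtain y where y: "y \<in> gen_on ?T" "pure y" "perm_of y = perm_of g"
    using gen_on_permutes[OF _ fin] by blast
  obtain x where x: "x \<in> gen_on ?T" "perm_of x = id" "\<And>j. diag_of x j = (if j \<in> ?T then diag_of g j else 0)"
    using gen_on_diag[OF fin subset_refl, of "diag_of g"] diag_range[OF g] by blast
  have d0: "diag_of g j = 0" if "j \<notin> ?T" for j using that by (simp add: supp_iff)
  have xc: "x \<in> carrier G" using gen_on_closed[OF x(1)] .
  have "g \<asymp> x \<otimes> y"
  proof (rule Phi_eq_imp_eqz[OF g])
    show "x \<otimes> y \<in> carrier G" using xc y(2) by simp
    show "Phi m g = Phi m (x \<otimes> y)"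
    proof (rule prod_eqI; rule ext)
      fix k
      have yk: "y \<in> carrier G" "\<And>k. diag_of y k = 0" using y(2) by (simp_all add: pure_def)
      have "diag_of (x \<otimes> y) k = diag_of x k"
        using xc yk by (simp add: diag_mult)
      then show "diag_of g k = diag_of (x \<otimes> y) k" using d0[of k] x(3)[of k] by simp
      show "perm_of g k = perm_of (x \<otimes> y) k" using xc yk(1) x(2) y(3) by simp
    qed
  qed
  then obtain v where "g = \<zeta> v \<otimes> (x \<otimes> y)" unfolding eqz_def by blast
  then have "g \<in> gen_on ?T" using gen_on.mult[OF gen_on.zeta gen_on.mult[OF x(1) y(1)]] by simp
  then show ?thesis by (rule gen_on_mono[OF _ S])
qed

text \<open>As \<open>\<beta>\<close> is bilinear, it suffices to let \<open>h\<close> and \<open>k\<close> run through the generators of \<open>gen_on\<close>.\<close>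

lemma com_disjoint:
  assumes h: "h \<in> carrier G" and k: "k \<in> carrier G" and d: "supp m h \<inter> supp m k = {}"
  shows "com h k"
proof -
  have com_h_eta: "com h' (\<eta> c)" if "h' \<in> gen_on (supp m h)" "c \<in> supp m k" for h' c
    using that(1)
  proof (induction rule: gen_on.induct)
    case (eta j)
    then show ?case using d that(2) by (intro com_eta_eta) auto
  next
    case (swap a b t)
    then show ?case using d that(2) by (intro com_transpose_eta[of t a b]) auto
  qed (auto intro: com_\<zeta> com_mult gen_on_closed)
  have com_h_swap: "com h' t"
    if "h' \<in> gen_on (supp m h)" and
      t: "a \<in> supp m k" "b \<in> supp m k" "a \<noteq> b" "pure t" "perm_of t = Transposition.transpose a b" for h' t a b
    using that(1)
  proof (induction rule: gen_on.induct)
    case (eta j)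
    then show ?case using d t by (intro com_sym[OF _ _ com_transpose_eta[of t a b]]) auto
  next
    case (swap a' b' t')
    then show ?case using d t by (intro com_transpose_transpose[of t' a' b' t a b]) auto
  next
    case (mult x y)
    then show ?case using t gen_on_closed[OF mult.hyps(1)] gen_on_closed[OF mult.hyps(2)]
      by (intro com_mult) auto
  qed (use t in \<open>auto intro: com_\<zeta>\<close>)
  have hg: "h \<in> gen_on (supp m h)" by (rule supp_gen_on[OF h]) simp
  have "k \<in> gen_on (supp m k)" by (rule supp_gen_on[OF k]) simp
  then show ?thesis
  proof (induction rule: gen_on.induct)
    case (zeta v)
    show ?case by (rule com_sym[OF _ _ com_\<zeta>]) (use h in auto)
  next
    case (eta j)
    then show ?case by (intro com_h_eta hg)
  next
    case (swap a b t)
    then show ?case by (intro com_h_swap[of h a b t] hg)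
  next
    case (mult x y)
    have c: "x \<in> carrier G" "y \<in> carrier G"
      using gen_on_closed[OF mult.hyps(1)] gen_on_closed[OF mult.hyps(2)] .
    show ?case
      by (rule com_sym[OF m_closed[OF c] h], rule com_mult[OF c h com_sym[OF h c(1) mult.IH(1)] com_sym[OF h c(2) mult.IH(2)]])
  qed
qed

text \<open>Within its own support \<open>h\<close> obeys the rule for disjoint supports up to one factor \<open>z\<^sub>2\<close> for every letter: a lift of
  a transposition interchanges two of the factors \<open>\<eta> j\<close> of \<open>E\<close>, and \<open>\<eta> j\<close> meets itself among these factors, with
  which it commutes. In particular \<open>E\<close> detects the parity of a permutation.\<close>

lemma com_indicator:
  assumes S: "finite S"
    and E: "E \<in> carrier G" "perm_of E = id" "\<And>j. diag_of E j = (if j \<in> S then 1 else 0)"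
    and h: "h \<in> carrier G" "supp m h \<subseteq> S"
  shows "h \<otimes> E = \<zeta> (\<beta> h E + (0, lpar h + opar h, 0)) \<otimes> (E \<otimes> h)"
proof -
  have "h \<in> gen_on S" by (rule supp_gen_on[OF h])
  then show ?thesis
  proof (induction rule: gen_on.induct)
    case (zeta v)
    then show ?case using com_\<zeta>[OF E(1), of v] by (simp add: com_def zero_prod_def[symmetric])
  next
    case (eta j)
    define E' where "E' = inv (\<eta> j) \<otimes> E"
    have E': "E' \<in> carrier G" "E = \<eta> j \<otimes> E'" using E(1) by (simp_all add: E'_def m_assoc[symmetric])
    have pE': "perm_of E' = id" using E(2) E'(1) by (simp add: E'(2))
    have "diag_of E' j = 0"
    proof -
      have "(1 + diag_of E' j) mod int m = 1"
        using E(3)[of j] eta E'(1) by (simp add: E'(2) diag_mult inv_id)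
      then have "(1 + diag_of E' j - 1) mod int m = (1 - 1) mod int m"
        using m_gt_1 by (intro mod_diff_cong) auto
      then show ?thesis using E'(1) by simp
    qed
    then have "j \<notin> supp m E'" using pE' by (simp add: supp_iff)
    moreover have "supp m (\<eta> j) \<subseteq> {j}" by (auto simp: in_supp split: if_splits)
    ultimately have c: "com (\<eta> j) E'" by (intro com_disjoint) (use E' in auto)
    have "\<eta> j \<otimes> E = \<eta> j \<otimes> (\<zeta> (\<beta> (\<eta> j) E') \<otimes> (E' \<otimes> \<eta> j))"
      using c by (simp only: E'(2) com_def)
    also have "\<dots> = \<zeta> (\<beta> (\<eta> j) E') \<otimes> (\<eta> j \<otimes> (E' \<otimes> \<eta> j))"
      using E'(1) by (intro \<zeta>_lcomm) auto
    also have "\<eta> j \<otimes> (E' \<otimes> \<eta> j) = E \<otimes> \<eta> j"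
      using E'(1) by (simp add: E'(2) m_assoc)
    finally have "\<eta> j \<otimes> E = \<zeta> (\<beta> (\<eta> j) E') \<otimes> (E \<otimes> \<eta> j)" .
    moreover have "\<beta> (\<eta> j) E' = \<beta> (\<eta> j) E + (0, 1, 0)"
      unfolding E'(2) by (subst \<beta>_mult_right) (use E'(1) in \<open>auto simp: \<beta>_def add.assoc[symmetric]\<close>)
    ultimately show ?case by simp
  next
    case (swap a b t)
    define e where "e = \<eta> a \<otimes> \<eta> b"
    define E' where "E' = inv e \<otimes> E"
    have e: "e \<in> carrier G" by (simp add: e_def)
    have E': "E' \<in> carrier G" "E = e \<otimes> E'" using E(1) e by (simp_all add: E'_def m_assoc[symmetric])
    have pe: "perm_of e = id" "\<And>j. diag_of e j = (if j = a \<or> j = b then 1 else 0)"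
      using swap(3) m_gt_1 by (auto simp: e_def diag_mult inv_id)
    have pE': "perm_of E' = id" using E(2) E'(1) pe e by (simp add: E'(2))
    have "diag_of E' j = 0" if "j \<in> {a, b}" for j
    proof -
      have "(1 + diag_of E' j) mod int m = 1"
        using E(3)[of j] swap(1,2) that E'(1) e pe by (auto simp: E'(2) diag_mult inv_id)
      then have "(1 + diag_of E' j - 1) mod int m = (1 - 1) mod int m"
        using m_gt_1 by (intro mod_diff_cong) auto
      then show ?thesis using E'(1) by simp
    qed
    then have "a \<notin> supp m E'" "b \<notin> supp m E'" using pE' by (simp_all add: supp_iff)
    moreover have "supp m t \<subseteq> {a, b}"
      using swap(4,5) by (auto simp: in_supp pure_def Transposition.transpose_def split: if_splits)
    ultimately have tE': "com t E'" by (intro com_disjoint) (use E' swap in auto)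
    have te: "t \<otimes> e = \<zeta> (0, 1, 0) \<otimes> (e \<otimes> t)"
    proof -
      have "inj_on (\<lambda>i. if i = 0 then a else b) {0, 1 :: nat}" using swap(3) by (auto simp: inj_on_def)
      from lift_moves[OF _ this] obtain x where x: "pure x" "perm_of x 0 = a" "perm_of x 1 = b" by auto
      have xc: "x \<in> carrier G" using x by simp
      have xx: "y \<in> carrier G \<Longrightarrow> inv x \<otimes> (x \<otimes> y) = y" for y
        using xc by (simp add: m_assoc[symmetric])
      show ?thesis
      proof (rule exchange_transport[OF xc, of "r 0" "\<eta> 0 \<otimes> \<eta> 1"])
        show "t \<asymp> x \<otimes> r 0 \<otimes> inv x" by (rule conj_transpose) (use swap x in auto)
        have "e \<asymp> (x \<otimes> \<eta> 0 \<otimes> inv x) \<otimes> (x \<otimes> \<eta> 1 \<otimes> inv x)"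
          unfolding e_def using conj_eta[OF x(1), of 0] conj_eta[OF x(1), of 1] x(2,3) xc
          by (intro eqz_mult) auto
        then show "e \<asymp> x \<otimes> (\<eta> 0 \<otimes> \<eta> 1) \<otimes> inv x" using xc by (simp add: m_assoc xx)
        have "r 0 \<otimes> (\<eta> 0 \<otimes> \<eta> 1) = \<zeta> (0,0,1) \<otimes> (\<eta> 1 \<otimes> (r 0 \<otimes> \<eta> 1))"
          using r_eta[of 0 0] by (simp add: m_assoc[symmetric])
        also have "\<eta> 1 \<otimes> (r 0 \<otimes> \<eta> 1) = \<zeta> (0,0,1) \<otimes> (\<eta> 1 \<otimes> \<eta> 0 \<otimes> r 0)"
          using r_eta[of 0 1] \<zeta>_lcomm[of "\<eta> 1" "\<eta> 0 \<otimes> r 0" "(0,0,1)"] by (simp add: m_assoc)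
        also have "\<eta> 1 \<otimes> \<eta> 0 = \<zeta> (0,1,0) \<otimes> (\<eta> 0 \<otimes> \<eta> 1)"
          by (rule eta_comm) simp
        finally show "r 0 \<otimes> (\<eta> 0 \<otimes> \<eta> 1) = \<zeta> (0, 1, 0) \<otimes> (\<eta> 0 \<otimes> \<eta> 1 \<otimes> r 0)"
          by (simp add: m_assoc \<zeta>_add_left)
      qed auto
    qed
    have tc: "t \<in> carrier G" using swap by simp
    have "t \<otimes> E = \<zeta> (0,1,0) \<otimes> (e \<otimes> (t \<otimes> E'))"
    proof -
      have "t \<otimes> E = (t \<otimes> e) \<otimes> E'" using tc e E' by (simp add: m_assoc)
      then show ?thesis unfolding te using tc e E'(1) by (simp add: m_assoc)
    qed
    also have "e \<otimes> (t \<otimes> E') = \<zeta> (\<beta> t E') \<otimes> (E \<otimes> t)"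
    proof -
      have "e \<otimes> (t \<otimes> E') = e \<otimes> (\<zeta> (\<beta> t E') \<otimes> (E' \<otimes> t))"
        using tE' by (simp only: com_def)
      also have "\<dots> = \<zeta> (\<beta> t E') \<otimes> (e \<otimes> (E' \<otimes> t))"
        using tc e E'(1) by (intro \<zeta>_lcomm) auto
      also have "e \<otimes> (E' \<otimes> t) = E \<otimes> t"
        using tc e E'(1) by (simp add: E'(2) m_assoc)
      finally show ?thesis .
    qed
    finally have "t \<otimes> E = \<zeta> ((0,1,0) + \<beta> t E') \<otimes> (E \<otimes> t)"
      using tc E(1) by (simp add: \<zeta>_add_left)
    moreover have "\<beta> t E' = \<beta> t E"
    proof -
      have "\<beta> t e = 0" using par_transpose[OF swap(4,5,3)] by (simp add: \<beta>_def e_def zero_prod_def)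
      then show ?thesis unfolding E'(2) using e E'(1) by (simp add: \<beta>_mult_right)
    qed
    ultimately show ?case using par_transpose[OF swap(4,5,3)] by (simp add: add.commute)
  next
    case (mult x y)
    have c: "x \<in> carrier G" "y \<in> carrier G"
      using gen_on_closed[OF mult.hyps(1)] gen_on_closed[OF mult.hyps(2)] .
    show ?case
      using exchange_mult[OF c E(1) mult.IH] c
      by (simp add: \<beta>_mult_left add_ac)
  qed
qed

lemma indicator_exists: "finite S \<Longrightarrow> \<exists>E\<in>carrier G. perm_of E = id \<and> (\<forall>j. diag_of E j = (if j \<in> S then 1 else 0))"
  using gen_on_diag[of S S "\<lambda>_. 1"] m_gt_1 gen_on_closed by force

text \<open>A shift by \<open>N\<close> takes \<open>T\<close> away from everything. If its lift has odd parity, a transposition still further away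
  corrects this. With trivial parities \<open>x\<close> commutes with the elements supported by \<open>A\<close>, not just up to a sign.\<close>

lemma move_support:
  assumes T: "finite T" and A: "finite A" "T \<inter> A = {}" and B: "finite B"
  shows "\<exists>x\<in>carrier G. lpar x = 0 \<and> opar x = 0 \<and> supp m x \<inter> A = {} \<and> perm_of x ` T \<inter> B = {}"
proof -
  obtain N where N: "\<And>i. i \<in> T \<union> A \<union> B \<Longrightarrow> i < N"
    using T A B finite_nat_set_iff_bounded[of "T \<union> A \<union> B"] by auto
  let ?f = "\<lambda>i. i + N"
  obtain p where p: "p permutes (T \<union> ?f ` T)" "\<And>i. i \<in> T \<Longrightarrow> p i = i + N"
    using permutes_extend[of T "T \<union> ?f ` T" ?f] T by auto
  obtain x where x: "pure x" "perm_of x = p" "opar x = 0"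
    using lift_permutes[OF p(1)] T by auto
  have out: "j \<notin> supp m x" if "j < N" "j \<notin> T" for j
    using that p(1) x by (auto simp: supp_iff pure_def permutes_def)
  obtain t where t: "pure t" "perm_of t = Transposition.transpose (2 * N) (Suc (2 * N))" "lpar t = 1" "opar t = 0"
    using lift_transpose[of "2 * N" "Suc (2 * N)"] by auto
  have tout: "j \<notin> supp m t" if "j < 2 * N" for j
    using that t by (simp add: supp_iff pure_def)
  have pT: "p i < 2 * N \<and> p i \<ge> N" if "i \<in> T" for i using p(2)[OF that] N[of i] that by simp
  show ?thesis
  proof (cases "lpar x = 0")
    case True
    show ?thesis
    proof (rule bexI[of _ x], intro conjI)
      show "supp m x \<inter> A = {}" using out N A(2) by auto
      show "perm_of x ` T \<inter> B = {}" using pT N x by fastforce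
    qed (use x True in auto)
  next
    case False
    have c: "x \<in> carrier G" "t \<in> carrier G" using x t by auto
    show ?thesis
    proof (rule bexI[of _ "t \<otimes> x"], intro conjI)
      have "j \<notin> supp m (t \<otimes> x)" if "j \<in> A" for j
      proof -
        have "j < N" "j \<notin> T" using N[of j] that A(2) by auto
        then show ?thesis using supp_mult[OF c(2,1)] out[of j] tout[of j] by auto
      qed
      then show "supp m (t \<otimes> x) \<inter> A = {}" by blast
      have "perm_of (t \<otimes> x) i = p i" if "i \<in> T" for i using c t x pT[OF that] by simp
      then have "perm_of (t \<otimes> x) i \<notin> B" if "i \<in> T" for i
        using pT[OF that] N[of "p i"] that by auto
      then show "perm_of (t \<otimes> x) ` T \<inter> B = {}" by blast
    qed (use x t c False in auto)
  qed
qed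

end

section \<open>Characters\<close>

text \<open>The character of \<open>Z\<close> with prescribed values at the three generators, on exponent vectors.\<close>

fun sgn_char :: "complex \<times> complex \<times> complex \<Rightarrow> bit \<times> bit \<times> bit \<Rightarrow> complex" where
  "sgn_char (c1, c2, c3) (a, b, d) =
     (if a = 1 then c1 else 1) * (if b = 1 then c2 else 1) * (if d = 1 then c3 else 1)"

lemma all_bit: "(\<forall>a::bit. P a) \<longleftrightarrow> P 0 \<and> P 1"
  by (metis bit_not_one_iff)

text \<open>The parity \<open>(l, p)\<close> is orthogonal to every parity \<open>(a, b)\<close> for the form that \<open>\<beta>\<close> and the character \<open>c\<close>
  define.\<close>

definition radical :: "complex \<times> complex \<times> complex \<Rightarrow> bit \<Rightarrow> bit \<Rightarrow> bool" where
  "radical c l p \<longleftrightarrow> (\<forall>a b. sgn_char c (a * l, b * p, a * p + b * l) = 1)"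

lemma radical_0: "radical c 0 0"
  by (cases c) (simp add: radical_def)

lemma radical_rank_one:
  "radical (-1, -1, -1) l p \<longleftrightarrow> l = p"
  "radical (-1, 1, 1) l p \<longleftrightarrow> l = 0"
  "radical (1, 1, 1) l p"
  by (cases l; cases p; simp add: radical_def all_bit)+

context rep_group
begin

definition spin :: "complex \<times> complex \<times> complex \<Rightarrow> (G'_elem \<Rightarrow> complex) \<Rightarrow> bool" where
  "spin c f \<longleftrightarrow> (\<forall>v. \<forall>g\<in>carrier G. f (\<zeta> v \<otimes> g) = sgn_char c v * f g)"

lemma spinD: "spin c f \<Longrightarrow> g \<in> carrier G \<Longrightarrow> f (\<zeta> v \<otimes> g) = sgn_char c v * f g"
  unfolding spin_def by blast

lemma spin_of_type:
  assumes "is_chi m Y \<chi>" "has_spin_type m \<chi> f"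
  shows "spin (spin_triple Y) f"
proof -
  obtain c1 c2 c3 where c: "spin_triple Y = (c1, c2, c3)" by (cases "spin_triple Y")
  then have \<chi>: "\<chi> (G'_gen m Z1) = c1" "\<chi> (G'_gen m Z2) = c2" "\<chi> (G'_gen m Z3) = c3"
    using assms(1) by (auto simp: is_chi_def)
  have Z: "G'_gen m z \<in> Z_sub m" if "z \<in> {Z1, Z2, Z3}" for z
    unfolding Z_sub_def using that by (intro generate.incl) blast
  have f: "f (G'_gen m z \<otimes> g) = \<chi> (G'_gen m z) * f g" if "z \<in> {Z1, Z2, Z3}" "g \<in> carrier G" for z g
    using assms(2) Z[OF that(1)] that(2) unfolding has_spin_type_def by (simp add: G_eq)
  have "f (\<zeta> (a, b, d) \<otimes> g) = sgn_char (c1, c2, c3) (a, b, d) * f g" if g: "g \<in> carrier G" for a b d g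
    using g by (simp add: \<zeta>_def m_assoc f \<chi>)
  then show ?thesis by (auto simp: spin_def c)
qed

text \<open>The class function \<open>f\<close> takes the same value at \<open>g\<close> and at its conjugate \<open>\<zeta> w \<otimes> g\<close>.\<close>

lemma spin_vanish:
  assumes f: "f \<in> K1 G" "spin c f" and x: "x \<in> carrier G" and g: "g \<in> carrier G"
    and ex: "x \<otimes> g = \<zeta> w \<otimes> (g \<otimes> x)" and c: "sgn_char c w = -1"
  shows "f g = 0"
proof -
  have "f g = f (x \<otimes> g \<otimes> inv x)" using K1_closed(3)[OF f(1) g x] by simp
  also have "x \<otimes> g \<otimes> inv x = \<zeta> w \<otimes> g" unfolding ex using x g by (simp add: m_assoc)
  also have "f (\<zeta> w \<otimes> g) = - f g" using spinD[OF f(2) g] c by simp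
  finally show ?thesis by simp
qed

lemma far_point:
  assumes "g \<in> carrier G"
  obtains N where "\<And>j. N \<le> j \<Longrightarrow> j \<notin> supp m g"
  using supp_finite[OF assms] finite_nat_set_iff_bounded_le[of "supp m g"]
  by (metis Suc_n_not_le_n le_trans not_less_eq_eq)

text \<open>Conjugation by \<open>r N\<close> or \<open>\<eta> N\<close> beyond the support of \<open>g\<close>.\<close>

lemma far_vanish:
  assumes f: "f \<in> K1 G" "spin c f" and g: "g \<in> carrier G"
    and c: "sgn_char c (lpar g, 0, opar g) = -1 \<or> sgn_char c (0, opar g, lpar g) = -1"
  shows "f g = 0"
proof -
  obtain N where N: "\<And>j. N \<le> j \<Longrightarrow> j \<notin> supp m g" using far_point[OF g] by blast
  have "supp m (r N) \<subseteq> {N, Suc N}" "supp m (\<eta> N) \<subseteq> {N}"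
    by (auto simp: in_supp Transposition.transpose_def split: if_splits)
  then have "com (r N) g" "com (\<eta> N) g"
    using N[of N] N[of "Suc N"] g by (auto intro!: com_disjoint)
  then show ?thesis
    using c spin_vanish[OF f _ g, of "r N"] spin_vanish[OF f _ g, of "\<eta> N"]
    by (auto simp: com_def \<beta>_def)
qed

text \<open>Conjugation by \<open>h\<close>, which commutes with itself and meets \<open>k\<close> with the sign \<open>\<beta> h k\<close>.\<close>

lemma self_vanish:
  assumes f: "f \<in> K1 G" "spin c f" and h: "h \<in> carrier G" and k: "k \<in> carrier G"
    and d: "supp m h \<inter> supp m k = {}" and c: "sgn_char c (\<beta> h k) = -1"
  shows "f (h \<otimes> k) = 0"
proof (rule spin_vanish[OF f h _ _ c])
  have "h \<otimes> (h \<otimes> k) = h \<otimes> (\<zeta> (\<beta> h k) \<otimes> (k \<otimes> h))"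
    using com_disjoint[OF h k d] by (simp only: com_def)
  also have "\<dots> = \<zeta> (\<beta> h k) \<otimes> (h \<otimes> (k \<otimes> h))" using h k by (intro \<zeta>_lcomm) auto
  finally show "h \<otimes> (h \<otimes> k) = \<zeta> (\<beta> h k) \<otimes> (h \<otimes> k \<otimes> h)" using h k by (simp add: m_assoc)
qed (use h k in auto)

text \<open>Conjugation by the element \<open>E\<close> of \<open>com_indicator\<close> for the support of \<open>h\<close>. The hypothesis ranges over the possible
  parities \<open>a\<close>, \<open>b\<close> of \<open>E\<close>.\<close>

lemma indicator_vanish:
  assumes f: "f \<in> K1 G" "spin c f" and h: "h \<in> carrier G" and k: "k \<in> carrier G"
    and d: "supp m h \<inter> supp m k = {}"
    and c: "\<And>a b. sgn_char c ((lpar h + lpar k) * a, (opar h + opar k) * b + (lpar h + opar h),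
                (lpar h + lpar k) * b + (opar h + opar k) * a) = -1"
  shows "f (h \<otimes> k) = 0"
proof -
  obtain E where E: "E \<in> carrier G" "perm_of E = id" "\<And>j. diag_of E j = (if j \<in> supp m h then 1 else 0)"
    using indicator_exists[OF supp_finite[OF h]] by blast
  let ?v = "\<beta> h E + (0, lpar h + opar h, 0)"
  have hE: "h \<otimes> E = \<zeta> ?v \<otimes> (E \<otimes> h)"
    by (rule com_indicator[OF supp_finite[OF h] E h]) simp
  have "supp m E \<subseteq> supp m h" using E by (auto simp: in_supp split: if_splits)
  then have "com k E" using d by (intro com_disjoint k E(1)) auto
  then have kE: "k \<otimes> E = \<zeta> (\<beta> k E) \<otimes> (E \<otimes> k)" by (simp add: com_def)
  have "h \<otimes> k \<otimes> E = \<zeta> (?v + \<beta> k E) \<otimes> (E \<otimes> (h \<otimes> k))"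
    by (rule exchange_mult[OF h k E(1) hE kE])
  then have "E \<otimes> (h \<otimes> k) = \<zeta> (?v + \<beta> k E) \<otimes> (h \<otimes> k \<otimes> E)"
    using h k E(1) by (simp add: \<zeta>_add_left)
  moreover have "?v + \<beta> k E = ((lpar h + lpar k) * lpar E, (opar h + opar k) * opar E + (lpar h + opar h),
                (lpar h + lpar k) * opar E + (opar h + opar k) * lpar E)"
    by (simp add: \<beta>_def algebra_simps)
  ultimately show ?thesis
    using spin_vanish[OF f E(1), of "h \<otimes> k"] c h k by simp
qed

text \<open>If \<open>h\<close> and \<open>k\<close> both have parity \<open>(1, 0)\<close>, no element of disjoint support and no part of \<open>h \<otimes> k\<close> need change the
  sign, but the indicator of the support of \<open>h\<close> does. In all other cases either a far element or \<open>h\<close>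
  does. For \<open>f h\<close> a far element suffices, except for parity \<open>(1, 0)\<close> and \<open>c3 = 1\<close>, where
  the indicator is used again.\<close>

lemma type_V_VI_vanish:
  assumes f: "f \<in> K1 G" "spin (1, -1, c3) f" "c3 = 1 \<or> c3 = -1"
    and h: "h \<in> carrier G" and k: "k \<in> carrier G"
    and d: "supp m h \<inter> supp m k = {}"
    and nz: "\<not> (lpar h = 0 \<and> opar h = 0)" "\<not> (lpar k = 0 \<and> opar k = 0)"
  shows "f (h \<otimes> k) = 0 \<and> f h = 0"
proof -
  have hk: "h \<otimes> k \<in> carrier G" using h k by simp
  note far = far_vanish[OF f(1,2) hk] and self = self_vanish[OF f(1,2) h k d]
    and ind = indicator_vanish[OF f(1,2) h k d]
  have d1: "supp m h \<inter> supp m \<one> = {}" by (auto simp: in_supp)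
  have ind1: "f h = 0" if "\<And>a b. sgn_char (1, -1, c3) (lpar h * a, opar h * b + (lpar h + opar h),
                lpar h * b + opar h * a) = -1"
    using indicator_vanish[OF f(1,2) h one_closed d1] that h by simp
  note far1 = far_vanish[OF f(1,2) h]
  have "f (h \<otimes> k) = 0"
  proof (cases "lpar h = 1 \<and> opar h = 0 \<and> lpar k = 1 \<and> opar k = 0")
    case True
    then have "lpar h = 1" "opar h = 0" "lpar k = 1" "opar k = 0" by simp_all
    then show ?thesis by (intro ind) simp
  next
    case False
    then show ?thesis
      using nz far self h k f(3)
      by (cases "lpar h"; cases "opar h"; cases "lpar k"; cases "opar k") (auto simp: \<beta>_def)
  qed
  moreover have "f h = 0"
  proof (cases "lpar h = 1 \<and> opar h = 0 \<and> c3 = 1")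
    case True
    then have "lpar h = 1" "opar h = 0" "c3 = 1" by simp_all
    then show ?thesis by (intro ind1) simp
  next
    case False
    then show ?thesis using nz far1 f(3)
      by (cases "lpar h"; cases "opar h") auto
  qed
  ultimately show ?thesis by blast
qed

text \<open>For the types I and IV the form has rank one, so two parities outside the radical are never orthogonal and
  conjugation by \<open>h\<close> changes the sign. For VIII everything is radical.\<close>

lemma first_kind_vanish:
  assumes Y: "first_kind Y" and f: "f \<in> K1 G" "spin (spin_triple Y) f"
    and h: "h \<in> carrier G" and k: "k \<in> carrier G" and d: "supp m h \<inter> supp m k = {}"
    and nr: "\<not> radical (spin_triple Y) (lpar h) (opar h)" "\<not> radical (spin_triple Y) (lpar k) (opar k)"
  shows "f (h \<otimes> k) = 0 \<and> f h = 0"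
proof -
  have VI: ?thesis if "spin_triple Y = (1, -1, c3)" "c3 = 1 \<or> c3 = -1" for c3
  proof (rule type_V_VI_vanish[OF f(1) _ that(2) h k d])
    show "spin (1, -1, c3) f" using f(2) that(1) by simp
    show "\<not> (lpar h = 0 \<and> opar h = 0)" "\<not> (lpar k = 0 \<and> opar k = 0)"
      using nr radical_0[of "spin_triple Y"] by metis+
  qed
  have I: ?thesis if "Y = Y_I"
  proof -
    have par: "lpar h \<noteq> opar h" "lpar k \<noteq> opar k" using nr by (auto simp: that radical_rank_one)
    have "sgn_char (spin_triple Y) (\<beta> h k) = -1"
      using par unfolding that \<beta>_def
      by (cases "lpar h"; cases "opar h"; cases "lpar k"; cases "opar k") simp_all
    moreover have "sgn_char (spin_triple Y) (lpar h, 0, opar h) = -1"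
      using par unfolding that by (cases "lpar h"; cases "opar h") simp_all
    ultimately show ?thesis using self_vanish[OF f h k d] far_vanish[OF f h] by blast
  qed
  have IV: ?thesis if "Y = Y_IV"
  proof -
    have par: "lpar h = 1" "lpar k = 1" using nr by (auto simp: that radical_rank_one)
    have "sgn_char (spin_triple Y) (\<beta> h k) = -1" "sgn_char (spin_triple Y) (lpar h, 0, opar h) = -1"
      by (simp_all add: that \<beta>_def par)
    then show ?thesis using self_vanish[OF f h k d] far_vanish[OF f h] by blast
  qed
  have VIII: ?thesis if "Y = Y_VIII"
    using nr by (simp add: that radical_rank_one)
  show ?thesis
  proof (cases Y)
    case Y_V
    show ?thesis by (rule VI[of "-1"]) (simp_all add: Y_V)
  next
    case Y_VI
    show ?thesis by (rule VI[of 1]) (simp_all add: Y_VI)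
  qed (use I IV VIII Y in \<open>simp_all add: first_kind_def\<close>)
qed

text \<open>The sequence \<open>u\<close> starts with \<open>k\<close>, and each term is a conjugate of the preceding one by some \<open>x\<close> of trivial parities
  that avoids the support of \<open>h\<close> and the first \<open>n\<close> points. So \<open>f (h \<otimes> u n)\<close> never changes, and \<open>f (g \<otimes> u n)\<close> is
  eventually constant for every \<open>g\<close>. The limit is a class function because \<open>u n\<close>, having the parity of \<open>k\<close>,
  passes through any fixed element with a sign that \<open>f\<close> ignores.\<close>

lemma E_char_radical_mult:
  assumes f: "f \<in> E_char G" and sp: "spin c f" and h: "h \<in> carrier G" and k: "k \<in> carrier G"
    and d: "supp m h \<inter> supp m k = {}" and rad: "radical c (lpar k) (opar k)"
  shows "f (h \<otimes> k) = f h * f k"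
proof -
  have fK: "f \<in> K1 G" using f by (rule E_char_K1)
  \<comment> \<open>The points that the support of \<open>u n\<close> has to avoid; including those of \<open>h\<close> for all \<open>n\<close> makes \<open>f (h \<otimes> u n)\<close> constant.\<close>
  define A where "A n = supp m h \<union> {..<n}" for n :: nat
  have Afin: "finite (A n)" for n using supp_finite[OF h] by (simp add: A_def)
  define P where "P n u \<longleftrightarrow> u \<in> carrier G \<and> lpar u = lpar k \<and> opar u = opar k \<and>
      supp m u \<inter> A n = {} \<and> (n = 0 \<longrightarrow> u = k)" for n u
  define Q where "Q n u u' \<longleftrightarrow> (\<exists>x\<in>carrier G. lpar x = 0 \<and> opar x = 0 \<and> supp m x \<inter> A n = {} \<and>
      u' = x \<otimes> u \<otimes> inv x)" for n u u'
  have "\<exists>u. \<forall>n. P n (u n) \<and> Q n (u n) (u (Suc n))"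
  proof (rule dependent_nat_choice)
    show "\<exists>u. P 0 u" using k d by (auto simp: P_def A_def)
  next
    fix u n assume u: "P n u"
    then obtain x where x: "x \<in> carrier G" "lpar x = 0" "opar x = 0" "supp m x \<inter> A n = {}"
      "perm_of x ` supp m u \<inter> A (Suc n) = {}"
      using move_support[OF supp_finite Afin _ Afin, of u n "Suc n"] unfolding P_def by blast
    let ?u = "x \<otimes> u \<otimes> inv x"
    have "P (Suc n) ?u"
      using x u supp_conj[of x u] by (auto simp: P_def)
    moreover have "Q n u ?u" using x by (auto simp only: Q_def)
    ultimately show "\<exists>u'. P (Suc n) u' \<and> Q n u u'" by blast
  qed
  then obtain u where u: "\<And>n. P n (u n)" "\<And>n. Q n (u n) (u (Suc n))" by blast
  have uc: "u n \<in> carrier G" for n using u(1) by (simp add: P_def)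
  have u0: "u 0 = k" using u(1)[of 0] by (simp add: P_def)
  have step: "f (g \<otimes> u (Suc n)) = f (g \<otimes> u n)" if g: "g \<in> carrier G" "supp m g \<subseteq> A n" for g n
  proof -
    obtain x where x: "x \<in> carrier G" "lpar x = 0" "opar x = 0" "supp m x \<inter> A n = {}"
      "u (Suc n) = x \<otimes> u n \<otimes> inv x" using u(2)[of n] by (auto simp only: Q_def)
    have "com g x" using x g by (intro com_disjoint) auto
    then have gx: "g \<otimes> x = x \<otimes> g"
      using x g by (simp add: com_def \<beta>_def zero_prod_def[symmetric])
    have "g \<otimes> u (Suc n) = (g \<otimes> x) \<otimes> u n \<otimes> inv x" using x g uc by (simp add: m_assoc)
    also have "\<dots> = x \<otimes> (g \<otimes> u n) \<otimes> inv x" unfolding gx using x g uc by (simp add: m_assoc)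
    finally show ?thesis using K1_closed(3)[OF fK, of "g \<otimes> u n" x] x(1) g uc by simp
  qed
  have const: "f (g \<otimes> u n) = f (g \<otimes> u N)" if "g \<in> carrier G" "supp m g \<subseteq> A N" "N \<le> n" for g n N
    using that(3)
  proof (induction n rule: dec_induct)
    case (step n)
    have "supp m g \<subseteq> A n" using that(2) step.hyps(1) by (auto simp: A_def)
    then show ?case using step.IH \<open>\<And>n g. \<lbrakk>g \<in> carrier G; supp m g \<subseteq> A n\<rbrakk> \<Longrightarrow> f (g \<otimes> u (Suc n)) = f (g \<otimes> u n)\<close>[OF that(1)]
      by simp
  qed simp
  have bound: "\<exists>N. supp m g \<subseteq> A N" if g: "g \<in> carrier G" for g
  proof -
    obtain N where "\<And>j. N \<le> j \<Longrightarrow> j \<notin> supp m g" using far_point[OF g] by blast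
    then have "supp m g \<subseteq> A N" unfolding A_def using not_le by blast
    then show ?thesis by blast
  qed
  \<comment> \<open>From the term \<open>lev g\<close> on, \<open>f (g \<otimes> u n)\<close> has its limit value.\<close>
  define lev where "lev g = (SOME N. supp m g \<subseteq> A N)" for g
  have lev: "supp m g \<subseteq> A (lev g)" if "g \<in> carrier G" for g
    unfolding lev_def by (rule someI_ex[OF bound[OF that]])
  define \<phi> where "\<phi> g = f (g \<otimes> u (lev g))" for g
  have lim: "f (g \<otimes> u n) = \<phi> g" if "g \<in> carrier G" "supp m g \<subseteq> A n" for g n
  proof (cases "lev g \<le> n")
    case True
    then show ?thesis using const[OF that(1) lev[OF that(1)] True] by (simp add: \<phi>_def)
  next
    case False
    then show ?thesis using const[OF that, of "lev g"] by (simp add: \<phi>_def)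
  qed
  have "\<phi> h = \<phi> \<one> * f h"
  proof (rule E_char_asymptotically_central[OF f uc _ _ h])
    fix g assume g: "g \<in> carrier G"
    have "f (g \<otimes> u n) = \<phi> g" if "lev g \<le> n" for n
      using const[OF g lev[OF g] that] by (simp add: \<phi>_def)
    then show "\<forall>\<^sub>F n in sequentially. f (g \<otimes> u n) = \<phi> g"
      unfolding eventually_sequentially by blast
  next
    fix a g assume a: "a \<in> carrier G" and g: "g \<in> carrier G"
    have aga: "a \<otimes> g \<otimes> inv a \<in> carrier G" using a g by simp
    define n where "n = lev (inv a) + lev g + lev (a \<otimes> g \<otimes> inv a)"
    have An: "A i \<subseteq> A n" if "i \<le> n" for i using that by (auto simp: A_def)
    have s: "supp m (inv a) \<subseteq> A n" "supp m g \<subseteq> A n" "supp m (a \<otimes> g \<otimes> inv a) \<subseteq> A n"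
      using lev[of "inv a"] lev[of g] lev[OF aga] a g An[of "lev (inv a)"] An[of "lev g"]
        An[of "lev (a \<otimes> g \<otimes> inv a)"] by (auto simp: n_def)
    have "com (inv a) (u n)" using s(1) u(1)[of n] a by (intro com_disjoint) (auto simp: P_def)
    then have "inv a \<otimes> u n = \<zeta> (\<beta> (inv a) (u n)) \<otimes> (u n \<otimes> inv a)" by (simp add: com_def)
    then have "a \<otimes> g \<otimes> inv a \<otimes> u n = a \<otimes> g \<otimes> (\<zeta> (\<beta> (inv a) (u n)) \<otimes> (u n \<otimes> inv a))"
      using a g uc by (simp add: m_assoc)
    also have "\<dots> = \<zeta> (\<beta> (inv a) (u n)) \<otimes> (a \<otimes> g \<otimes> (u n \<otimes> inv a))"
      using a g uc by (intro \<zeta>_lcomm) auto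
    finally have "f (a \<otimes> g \<otimes> inv a \<otimes> u n) = sgn_char c (\<beta> (inv a) (u n)) * f (a \<otimes> g \<otimes> (u n \<otimes> inv a))"
      using a g uc spinD[OF sp] by simp
    also have "sgn_char c (\<beta> (inv a) (u n)) = 1"
      using rad u(1)[of n] by (simp add: radical_def \<beta>_def P_def)
    also have "a \<otimes> g \<otimes> (u n \<otimes> inv a) = a \<otimes> (g \<otimes> u n) \<otimes> inv a" using a g uc by (simp add: m_assoc)
    finally show "\<phi> (a \<otimes> g \<otimes> inv a) = \<phi> g"
      using K1_closed(3)[OF fK, of "g \<otimes> u n" a] a g uc lim[OF g s(2)] lim[OF aga s(3)] by simp
  qed
  moreover have "\<phi> h = f (h \<otimes> k)" using lim[OF h, of 0] u0 by (simp add: A_def)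
  moreover have "\<phi> \<one> = f k" using lim[OF one_closed, of 0] u0 k by (simp add: in_supp subset_iff)
  ultimately show ?thesis by simp
qed

lemma E_char_radical_mult':
  assumes f: "f \<in> E_char G" and sp: "spin c f" and h: "h \<in> carrier G" and k: "k \<in> carrier G"
    and d: "supp m h \<inter> supp m k = {}"
    and rad: "radical c (lpar k) (opar k) \<or> radical c (lpar h) (opar h)"
  shows "f (h \<otimes> k) = f h * f k"
  using rad
proof
  assume "radical c (lpar h) (opar h)"
  then have "f (k \<otimes> h) = f k * f h"
    using d by (intro E_char_radical_mult[OF f sp k h]) auto
  then show ?thesis using K1_comm[OF E_char_K1[OF f] h k] by (simp add: mult.commute)
qed (rule E_char_radical_mult[OF f sp h k d])

lemma F_factI:
  assumes "f \<in> K1 G"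
    and "\<And>h k. h \<in> carrier G \<Longrightarrow> k \<in> carrier G \<Longrightarrow> supp m h \<inter> supp m k = {} \<Longrightarrow> f (h \<otimes> k) = f h * f k"
  shows "f \<in> F_fact m"
  using assms by (simp add: F_fact_def factorisable_def G_eq)

lemma F_factD:
  assumes "f \<in> F_fact m"
  shows "f \<in> K1 G"
    and "h \<in> carrier G \<Longrightarrow> k \<in> carrier G \<Longrightarrow> supp m h \<inter> supp m k = {} \<Longrightarrow> f (h \<otimes> k) = f h * f k"
  using assms by (simp_all add: F_fact_def factorisable_def G_eq)

lemma E_first_kind_factorisable:
  assumes Y: "first_kind Y" and f: "f \<in> E_char G" "spin (spin_triple Y) f"
  shows "f \<in> F_fact m"
proof (rule F_factI)
  show fK: "f \<in> K1 G" using f(1) by (rule E_char_K1)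
  fix h k assume hk: "h \<in> carrier G" "k \<in> carrier G" "supp m h \<inter> supp m k = {}"
  show "f (h \<otimes> k) = f h * f k"
    using E_char_radical_mult'[OF f hk] first_kind_vanish[OF Y fK f(2) hk] by fastforce
qed

lemma disjoint_conjugates:
  assumes k: "k \<in> carrier G"
  shows "\<exists>x :: nat \<Rightarrow> G'_elem. (\<forall>i<n. x i \<in> carrier G) \<and>
    (\<forall>i<n. \<forall>j<n. i \<noteq> j \<longrightarrow> supp m (x i \<otimes> k \<otimes> inv (x i)) \<inter> supp m (x j \<otimes> k \<otimes> inv (x j)) = {})"
proof (induction n)
  case (Suc n)
  then obtain x :: "nat \<Rightarrow> G'_elem" where x: "\<And>i. i < n \<Longrightarrow> x i \<in> carrier G"
    "\<And>i j. i < n \<Longrightarrow> j < n \<Longrightarrow> i \<noteq> j \<Longrightarrow> supp m (x i \<otimes> k \<otimes> inv (x i)) \<inter> supp m (x j \<otimes> k \<otimes> inv (x j)) = {}"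
    by blast
  let ?B = "\<Union>i<n. supp m (x i \<otimes> k \<otimes> inv (x i))"
  have "finite ?B" using x(1) k by (intro finite_UN_I supp_finite) auto
  then obtain y where y: "y \<in> carrier G" "perm_of y ` supp m k \<inter> ?B = {}"
    using move_support[OF supp_finite[OF k] finite.emptyI, of ?B] by auto
  have new: "supp m (y \<otimes> k \<otimes> inv y) \<inter> supp m (x i \<otimes> k \<otimes> inv (x i)) = {}" if "i < n" for i
    using y(2) supp_conj[OF y(1) k] that by blast
  have new': "supp m (x i \<otimes> k \<otimes> inv (x i)) \<inter> supp m (y \<otimes> k \<otimes> inv y) = {}" if "i < n" for i
    using new[OF that] by blast
  let ?x = "x(n := y)"
  have closed: "?x i \<in> carrier G" if "i < Suc n" for i
    using that x(1)[of i] y(1) by (cases "i = n") simp_all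
  have disj: "supp m (?x i \<otimes> k \<otimes> inv (?x i)) \<inter> supp m (?x j \<otimes> k \<otimes> inv (?x j)) = {}"
    if ij: "i < Suc n" "j < Suc n" "i \<noteq> j" for i j
  proof -
    consider "i = n" "j < n" | "j = n" "i < n" | "i < n" "j < n" using ij by linarith
    then show ?thesis
      by cases (use ij new[of j] new'[of i] x(2)[of i j] in simp_all)
  qed
  show ?case by (rule exI[of _ ?x]) (use closed disj in blast)
qed simp

text \<open>Factorisability makes conjugates with disjoint supports uncorrelated.\<close>

lemma F_fact_subset_E_char:
  assumes f: "f \<in> F_fact m"
  shows "f \<in> E_char G"
proof (rule E_charI_conjugates)
  show fK: "f \<in> K1 G" using F_factD(1)[OF f] .
  fix k and n :: nat assume k: "k \<in> carrier G"
  obtain x :: "nat \<Rightarrow> G'_elem" where x: "\<And>i. i < n \<Longrightarrow> x i \<in> carrier G"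
    "\<And>i j. i < n \<Longrightarrow> j < n \<Longrightarrow> i \<noteq> j \<Longrightarrow> supp m (x i \<otimes> k \<otimes> inv (x i)) \<inter> supp m (x j \<otimes> k \<otimes> inv (x j)) = {}"
    using disjoint_conjugates[OF k, of n] by blast
  have "f (inv (x j \<otimes> k \<otimes> inv (x j)) \<otimes> (x i \<otimes> k \<otimes> inv (x i))) = cnj (f k) * f k"
    if "i < n" "j < n" "i \<noteq> j" for i j
  proof -
    have c: "x i \<in> carrier G" "x j \<in> carrier G" using x(1) that by auto
    have y: "x j \<otimes> k \<otimes> inv (x j) \<in> carrier G" "x i \<otimes> k \<otimes> inv (x i) \<in> carrier G" using c k by auto
    have "supp m (inv (x j \<otimes> k \<otimes> inv (x j))) \<inter> supp m (x i \<otimes> k \<otimes> inv (x i)) = {}"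
      using supp_inv[OF y(1)] x(2)[of j i] that by auto
    then have "f (inv (x j \<otimes> k \<otimes> inv (x j)) \<otimes> (x i \<otimes> k \<otimes> inv (x i)))
        = f (inv (x j \<otimes> k \<otimes> inv (x j))) * f (x i \<otimes> k \<otimes> inv (x i))"
      using y by (intro F_factD(2)[OF f]) auto
    then show ?thesis
      using positive_definite_inv[OF K1_closed(1,2)[OF fK] y(1)] K1_closed(3)[OF fK k] c by simp
  qed
  then show "\<exists>x :: nat \<Rightarrow> G'_elem. (\<forall>i<n. x i \<in> carrier G) \<and>
      (\<forall>i<n. \<forall>j<n. i \<noteq> j \<longrightarrow>
         f (inv (x j \<otimes> k \<otimes> inv (x j)) \<otimes> (x i \<otimes> k \<otimes> inv (x i))) = cnj (f k) * f k)"
    using x(1) by blast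
qed

lemma F_fact_mult:
  assumes "f1 \<in> F_fact m" "f2 \<in> F_fact m"
  shows "(\<lambda>g. f1 g * f2 g) \<in> F_fact m"
proof (rule F_factI[OF K1_mult[OF F_factD(1)[OF assms(1)] F_factD(1)[OF assms(2)]]])
  fix h k assume "h \<in> carrier G" "k \<in> carrier G" "supp m h \<inter> supp m k = {}"
  note hk = this
  show "f1 (h \<otimes> k) * f2 (h \<otimes> k) = f1 h * f2 h * (f1 k * f2 k)"
    by (simp add: F_factD(2)[OF assms(1) hk] F_factD(2)[OF assms(2) hk])
qed

text \<open>Where the parity of \<open>h\<close> or \<open>k\<close> is trivial, both factors are multiplicative, whatever their types. Elsewhere both
  sides of the factorisation are zero, because that one of \<open>f1\<close>, \<open>f2\<close> and their product which has type V or VI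
  vanishes at \<open>h \<otimes> k\<close> and at \<open>h\<close>.\<close>

lemma E_mult_type_V_VI:
  assumes f: "f1 \<in> E_char G" "f2 \<in> E_char G"
    and sp: "spin (spin_triple Y1) f1" "spin (spin_triple Y2) f2" "spin (spin_triple Y3) (\<lambda>g. f1 g * f2 g)"
    and Y: "Y1 \<in> {Y_V, Y_VI} \<or> Y2 \<in> {Y_V, Y_VI} \<or> Y3 \<in> {Y_V, Y_VI}"
  shows "(\<lambda>g. f1 g * f2 g) \<in> F_fact m"
proof -
  have K: "f1 \<in> K1 G" "f2 \<in> K1 G" using f by (simp_all add: E_char_K1)
  note K3 = K1_mult[OF K]
  have V: "f (h \<otimes> k) = 0 \<and> f h = 0"
    if YV: "Y \<in> {Y_V, Y_VI}" and rest: "f \<in> K1 G" "spin (spin_triple Y) f" "h \<in> carrier G" "k \<in> carrier G"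
      "supp m h \<inter> supp m k = {}" "\<not> (lpar h = 0 \<and> opar h = 0)" "\<not> (lpar k = 0 \<and> opar k = 0)" for f Y h k
  proof -
    obtain c3 where "spin_triple Y = (1, -1, c3)" "c3 = 1 \<or> c3 = -1" using YV by auto
    then show ?thesis using type_V_VI_vanish[of f c3 h k] rest by simp
  qed
  show ?thesis
  proof (rule F_factI[OF K3])
    fix h k assume hk: "h \<in> carrier G" "k \<in> carrier G" "supp m h \<inter> supp m k = {}"
    show "f1 (h \<otimes> k) * f2 (h \<otimes> k) = f1 h * f2 h * (f1 k * f2 k)"
    proof (cases "(lpar k = 0 \<and> opar k = 0) \<or> (lpar h = 0 \<and> opar h = 0)")
      case True
      then have rad: "radical c (lpar k) (opar k) \<or> radical c (lpar h) (opar h)" for c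
        using radical_0[of c] by auto
      show ?thesis
        by (simp add: E_char_radical_mult'[OF f(1) sp(1) hk rad] E_char_radical_mult'[OF f(2) sp(2) hk rad])
    next
      case False
      then have nz: "\<not> (lpar h = 0 \<and> opar h = 0)" "\<not> (lpar k = 0 \<and> opar k = 0)" by auto
      show ?thesis
        using Y V[OF _ K(1) sp(1) hk nz] V[OF _ K(2) sp(2) hk nz] V[OF _ K3 sp(3) hk nz] by auto
    qed
  qed
qed

end

theorem theorem12p8:
  fixes m :: nat
  assumes "even m" and "m > 0"
  shows
    "(\<forall>f1 f2. f1 \<in> E_char (G'_inf m) \<and> factorisable m f1 \<and> f2 \<in> E_char (G'_inf m) \<and> factorisable m f2
         \<longrightarrow> (\<lambda>g. f1 g * f2 g) \<in> E_char (G'_inf m)) \<and>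
     F_fact m \<star> F_fact m \<subseteq> F_fact m \<and>
     (\<forall>Y1 Y2 Y3 \<chi>1 \<chi>2 \<chi>3.
         is_chi m Y1 \<chi>1 \<and> is_chi m Y2 \<chi>2 \<and> is_chi m Y3 \<chi>3 \<and>
         (\<forall>z\<in>Z_sub m. \<chi>3 z = \<chi>1 z * \<chi>2 z) \<longrightarrow>
           F_spin m \<chi>1 \<star> F_spin m \<chi>2 \<subseteq> F_spin m \<chi>3 \<and>
           (first_kind Y1 \<and> first_kind Y2 \<longrightarrow>
              E_spin m \<chi>1 \<star> E_spin m \<chi>2 \<subseteq> E_spin m \<chi>3) \<and>
           (Y1 \<in> {Y_V, Y_VI} \<or> Y2 \<in> {Y_V, Y_VI} \<or> Y3 \<in> {Y_V, Y_VI} \<longrightarrow>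
              E_spin m \<chi>1 \<star> E_spin m \<chi>2 \<subseteq> E_spin m \<chi>3))"
proof -
  interpret rep_group "G'_inf m" m
  proof -
    interpret group "G'_inf m" unfolding G'_inf_def by (rule group_presented_group)
    show "rep_group (G'_inf m) m" by unfold_locales (use assms in auto)
  qed
  have fact: "(\<lambda>g. f1 g * f2 g) \<in> E_char (G'_inf m)"
    if "f1 \<in> E_char (G'_inf m)" "factorisable m f1" "f2 \<in> E_char (G'_inf m)" "factorisable m f2" for f1 f2
    using that by (intro F_fact_subset_E_char F_fact_mult) (simp_all add: F_fact_def E_char_K1)
  have FF: "F_fact m \<star> F_fact m \<subseteq> F_fact m"
    using F_fact_mult by (auto simp: pointwise_prod_def)
  have main: "F_spin m \<chi>1 \<star> F_spin m \<chi>2 \<subseteq> F_spin m \<chi>3 \<and>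
           (first_kind Y1 \<and> first_kind Y2 \<longrightarrow>
              E_spin m \<chi>1 \<star> E_spin m \<chi>2 \<subseteq> E_spin m \<chi>3) \<and>
           (Y1 \<in> {Y_V, Y_VI} \<or> Y2 \<in> {Y_V, Y_VI} \<or> Y3 \<in> {Y_V, Y_VI} \<longrightarrow>
              E_spin m \<chi>1 \<star> E_spin m \<chi>2 \<subseteq> E_spin m \<chi>3)"
    if chi: "is_chi m Y1 \<chi>1" "is_chi m Y2 \<chi>2" "is_chi m Y3 \<chi>3" "\<forall>z\<in>Z_sub m. \<chi>3 z = \<chi>1 z * \<chi>2 z"
    for Y1 Y2 Y3 \<chi>1 \<chi>2 \<chi>3
  proof -
    have type: "has_spin_type m \<chi>3 (\<lambda>g. f1 g * f2 g)"
      if "has_spin_type m \<chi>1 f1" "has_spin_type m \<chi>2 f2" for f1 f2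
      using that chi(4) by (simp add: has_spin_type_def)
    have "F_spin m \<chi>1 \<star> F_spin m \<chi>2 \<subseteq> F_spin m \<chi>3"
      using F_fact_mult type by (auto simp: pointwise_prod_def F_spin_def)
    moreover have "E_spin m \<chi>1 \<star> E_spin m \<chi>2 \<subseteq> E_spin m \<chi>3" if "first_kind Y1" "first_kind Y2"
      using F_fact_subset_E_char[OF F_fact_mult[OF E_first_kind_factorisable[OF that(1) _ spin_of_type[OF chi(1)]]
          E_first_kind_factorisable[OF that(2) _ spin_of_type[OF chi(2)]]]] type
      by (auto simp: pointwise_prod_def E_spin_def)
    moreover have "E_spin m \<chi>1 \<star> E_spin m \<chi>2 \<subseteq> E_spin m \<chi>3"
      if "Y1 \<in> {Y_V, Y_VI} \<or> Y2 \<in> {Y_V, Y_VI} \<or> Y3 \<in> {Y_V, Y_VI}"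
      using F_fact_subset_E_char[OF E_mult_type_V_VI[OF _ _ spin_of_type[OF chi(1)] spin_of_type[OF chi(2)]
          spin_of_type[OF chi(3)] that]] type
      by (auto simp: pointwise_prod_def E_spin_def)
    ultimately show ?thesis by blast
  qed
  show ?thesis
  proof (intro conjI[OF _ conjI[OF FF]])
    show "\<forall>f1 f2. f1 \<in> E_char (G'_inf m) \<and> factorisable m f1 \<and> f2 \<in> E_char (G'_inf m) \<and> factorisable m f2
         \<longrightarrow> (\<lambda>g. f1 g * f2 g) \<in> E_char (G'_inf m)"
      using fact by blast
  qed (intro allI impI, elim conjE, rule main; assumption)
qed

end
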